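(* Let $d\ge 0$ be an integer, let $X$ be a complete metric space and let $S\subset X$ be a separable Borel subset which admits a $d$-dimensional weak tangent field. Then for any finite Borel measure $\mu$ on $S$ and any $m\in\mathbb{N}$, the set $$\{f\in\mathrm{Lip}_1(X,\mathbb{R}^m):\ \exists N\subset S,\ \mu(N)=0\ \text{and}\ \dim_H(f(S\setminus N))\le d\}$$ is residual in $\mathrm{Lip}_1(X,\mathbb{R}^m)$.
   Context: $\mathbb{R}^m$ carries the Euclidean norm. $\mathrm{Lip}_1(X,\mathbb{R}^m)$ is the complete metric space of all bounded $1$-Lipschitz maps $X\to\mathbb{R}^m$ with the supremum metric. A subset of a metric space is residual if it contains a countable intersection of dense open sets. $\dim_H$ is Hausdorff dimension. Curve fragments: $\Gamma(X)$ is the set of all Lipschitz maps $\gamma\colon\operatorname{Dom}\gamma\to X$ with $\operatorname{Dom}\gamma\subset[0,1]$ non-empty and compact. For a Lipschitz map $F\colon X\to\mathbb{R}^n$, $(F\circ\gamma)'(t)$ denotes the derivative (relative to $\operatorname{Dom}\gamma$), which exists for $\mathcal{H}^1$-a.e. $t\in\operatorname{Dom}\gamma$. Weak tangent fields: let $S\subset X$ be Borel, $F\colon X\to\mathbb{R}^n$ Lipschitz and $d\le n$. A Borel map $\tau$ from $S$ to the Grassmannian of $d$-dimensional linear subspaces of $\mathbb{R}^n$ is a $d$-dimensional weak tangent field to $S$ with respect to $F$ if for every $\gamma\in\Gamma(X)$, $(F\circ\gamma)'(t)\in\tau(\gamma(t))$ for $\mathcal{H}^1$-a.e. $t\in\gamma^{-1}(S)$.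 The set $S$ admits a $d$-dimensional weak tangent field if for every $n\in\mathbb{N}$ with $n\ge d$ and every Lipschitz $F\colon X\to\mathbb{R}^n$ there exists a $d$-dimensional weak tangent field to $S$ with respect to $F$ (considering Lipschitz maps defined only on $S$ is equivalent, by extension). *)

theory Defs
  imports "HOL-Analysis.Analysis" "HOL-Library.Poly_Mapping"
begin

section \<open>All the spaces \<open>\<real>\<^sup>n\<close> inside one type\<close>

text \<open>
  The definition of admitting a weak tangent field quantifies over the dimension \<open>n\<close> of the target,
  so the type-indexed spaces \<open>real ^ 'n\<close> cannot be used there. Instead \<open>\<real>\<^sup>n\<close> is the coordinate
  subspace of those finitely supported sequences \<open>nat \<Rightarrow>\<^sub>0 real\<close> that vanish at all indices
  \<open>i \<ge> n\<close>, with the Euclidean inner product \<open>\<Sum>i. x i * y i\<close>.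
\<close>

lemma sum_keys_superset:
  fixes f :: "'a \<Rightarrow>\<^sub>0 'b::zero" and h :: "'a \<Rightarrow> 'c::comm_monoid_add"
  assumes "finite A" "Poly_Mapping.keys f \<subseteq> A" "\<And>k. Poly_Mapping.lookup f k = 0 \<Longrightarrow> h k = 0"
  shows "(\<Sum>k\<in>Poly_Mapping.keys f. h k) = (\<Sum>k\<in>A. h k)"
proof (rule sum.mono_neutral_left)
  show "\<forall>k\<in>A - Poly_Mapping.keys f. h k = 0"
    using assms(3) by (meson DiffD2 in_keys_iff)
qed (use assms in auto)

instantiation poly_mapping :: (type, real_vector) real_vector
begin

lift_definition scaleR_poly_mapping :: "real \<Rightarrow> ('a \<Rightarrow>\<^sub>0 'b) \<Rightarrow> ('a \<Rightarrow>\<^sub>0 'b)"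
  is "\<lambda>c f k. c *\<^sub>R f k"
  by (rule finite_subset[rotated]) auto

lemma lookup_scaleR: "Poly_Mapping.lookup (c *\<^sub>R f) k = c *\<^sub>R Poly_Mapping.lookup f k"
  for f :: "'a \<Rightarrow>\<^sub>0 'b"
  by transfer simp

instance
proof
  fix f g :: "'a \<Rightarrow>\<^sub>0 'b" and a b :: real
  show "a *\<^sub>R (f + g) = a *\<^sub>R f + a *\<^sub>R g" "(a + b) *\<^sub>R f = a *\<^sub>R f + b *\<^sub>R f"
    "a *\<^sub>R b *\<^sub>R f = (a * b) *\<^sub>R f" "1 *\<^sub>R f = f"
    by (rule poly_mapping_eqI, simp add: lookup_add lookup_scaleR algebra_simps)+
qed

end

instantiation poly_mapping :: (type, real_inner) real_inner
begin

definition inner_poly_mapping :: "('a \<Rightarrow>\<^sub>0 'b) \<Rightarrow> ('a \<Rightarrow>\<^sub>0 'b) \<Rightarrow> real"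
  where "inner_poly_mapping f g =
    (\<Sum>k\<in>Poly_Mapping.keys f. inner (Poly_Mapping.lookup f k) (Poly_Mapping.lookup g k))"

definition norm_poly_mapping :: "('a \<Rightarrow>\<^sub>0 'b) \<Rightarrow> real"
  where "norm_poly_mapping f = sqrt (inner f f)"

definition sgn_poly_mapping :: "('a \<Rightarrow>\<^sub>0 'b) \<Rightarrow> ('a \<Rightarrow>\<^sub>0 'b)"
  where "sgn_poly_mapping f = f /\<^sub>R norm f"

definition dist_poly_mapping :: "('a \<Rightarrow>\<^sub>0 'b) \<Rightarrow> ('a \<Rightarrow>\<^sub>0 'b) \<Rightarrow> real"
  where "dist_poly_mapping f g = norm (f - g)"

definition uniformity_poly_mapping :: "(('a \<Rightarrow>\<^sub>0 'b) \<times> ('a \<Rightarrow>\<^sub>0 'b)) filter"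
  where "uniformity_poly_mapping = (INF e\<in>{0 <..}. principal {(x, y). dist x y < e})"

definition open_poly_mapping :: "('a \<Rightarrow>\<^sub>0 'b) set \<Rightarrow> bool"
  where "open_poly_mapping U = (\<forall>x\<in>U. \<forall>\<^sub>F (x', y) in uniformity. x' = x \<longrightarrow> y \<in> U)"

lemma inner_poly_mapping_superset:
  fixes f g :: "'a \<Rightarrow>\<^sub>0 'b"
  assumes "finite A" "Poly_Mapping.keys f \<subseteq> A"
  shows "inner f g = (\<Sum>k\<in>A. inner (Poly_Mapping.lookup f k) (Poly_Mapping.lookup g k))"
  unfolding inner_poly_mapping_def using assms by (rule sum_keys_superset) auto

instance
proof
  fix f g h :: "'a \<Rightarrow>\<^sub>0 'b" and a :: real
  show "dist f g = norm (f - g)" by (rule dist_poly_mapping_def)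
  show "sgn f = f /\<^sub>R norm f" by (rule sgn_poly_mapping_def)
  show "uniformity = (INF e\<in>{0 <..}. principal {(x :: 'a \<Rightarrow>\<^sub>0 'b, y). dist x y < e})"
    by (rule uniformity_poly_mapping_def)
  show "open U = (\<forall>x\<in>U. \<forall>\<^sub>F (x', y) in uniformity. x' = x \<longrightarrow> y \<in> U)"
    for U :: "('a \<Rightarrow>\<^sub>0 'b) set" by (rule open_poly_mapping_def)
  show "norm f = sqrt (inner f f)" by (rule norm_poly_mapping_def)
  let ?A = "Poly_Mapping.keys f \<union> Poly_Mapping.keys g \<union> Poly_Mapping.keys h"
  have A: "finite ?A" "Poly_Mapping.keys f \<subseteq> ?A" "Poly_Mapping.keys g \<subseteq> ?A" by auto
  show "inner f g = inner g f"
    by (simp add: inner_poly_mapping_superset[OF A(1,2)] inner_poly_mapping_superset[OF A(1,3)]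
        inner_commute)
  have "Poly_Mapping.keys (f + g) \<subseteq> ?A" using keys_add[of f g] by blast
  then show "inner (f + g) h = inner f h + inner g h"
    by (simp add: inner_poly_mapping_superset[OF A(1)] A lookup_add inner_add_left sum.distrib)
  have "Poly_Mapping.keys (a *\<^sub>R f) \<subseteq> ?A" 
    by (intro subsetI) (metis UnI1 in_keys_iff lookup_scaleR scaleR_zero_right)
  then show "inner (a *\<^sub>R f) g = a * inner f g"
    by (simp add: inner_poly_mapping_superset[OF A(1)] A lookup_scaleR sum_distrib_left)
  show "0 \<le> inner f f" by (simp add: inner_poly_mapping_def sum_nonneg)
  show "(inner f f = 0) = (f = 0)"
  proof
    assume "inner f f = 0"
    then have "Poly_Mapping.lookup f k = 0" if "k \<in> Poly_Mapping.keys f" for k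
      using that by (simp add: inner_poly_mapping_def sum_nonneg_eq_0_iff)
    then show "f = 0" by (intro poly_mapping_eqI) (metis in_keys_iff lookup_zero)
  qed (simp add: inner_poly_mapping_def)
qed

end

definition euclidean :: "nat \<Rightarrow> (nat \<Rightarrow>\<^sub>0 real) set"
  where "euclidean n = {x. \<forall>i\<ge>n. Poly_Mapping.lookup x i = 0}"

lemma norm_euclidean:
  assumes "x \<in> euclidean n"
  shows "norm x = sqrt (\<Sum>i<n. (Poly_Mapping.lookup x i)\<^sup>2)"
proof -
  have "Poly_Mapping.keys x \<subseteq> {..<n}"
  proof
    fix i assume "i \<in> Poly_Mapping.keys x"
    then have "Poly_Mapping.lookup x i \<noteq> 0" by (meson in_keys_iff)
    then show "i \<in> {..<n}" using assms unfolding euclidean_def by (force simp: not_le)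
  qed
  then show ?thesis
    by (simp add: norm_eq_sqrt_inner inner_poly_mapping_superset[of "{..<n}"] power2_eq_square)
qed

section \<open>The Grassmannian\<close>

definition grassmannian :: "nat \<Rightarrow> nat \<Rightarrow> (nat \<Rightarrow>\<^sub>0 real) set set"
  where "grassmannian n d = {V. subspace V \<and> V \<subseteq> euclidean n \<and> dim V = d}"

text \<open>
  Writing \<open>P V\<close> for the orthogonal projection onto \<open>V\<close>, one has \<open>infdist x V = norm (x - P V x)\<close>.
  For subspaces of equal finite dimension the supremum below is therefore the operator norm of
  \<open>P V - P W\<close>: it is clearly at most that norm, and restricting the supremum to \<open>x \<in> V\<close> already
  attains it. So this is the usual gap metric on the Grassmannian.
\<close>

definition grassmannian_dist :: "(nat \<Rightarrow>\<^sub>0 real) set \<Rightarrow> (nat \<Rightarrow>\<^sub>0 real) set \<Rightarrow> real"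
  where "grassmannian_dist V W = (SUP x\<in>cball 0 1. \<bar>infdist x V - infdist x W\<bar>)"

lemma orthogonal_projection_exists:
  fixes B :: "'a::real_inner set"
  assumes "finite B"
  shows "\<exists>p\<in>span B. \<forall>w\<in>span B. inner (x - p) w = 0"
  using assms
proof (induction B arbitrary: x)
  case empty
  then show ?case by simp
next
  case (insert a B)
  obtain q where q: "q \<in> span B" "\<And>w. w \<in> span B \<Longrightarrow> inner (a - q) w = 0"
    using insert.IH by blast
  obtain p where p: "p \<in> span B" "\<And>w. w \<in> span B \<Longrightarrow> inner (x - p) w = 0"
    using insert.IH by blast
  define c where "c = inner (x - p) (a - q) / inner (a - q) (a - q)"
  have c: "c * inner (a - q) (a - q) = inner (x - p) (a - q)"
    by (cases "a - q = 0") (simp_all add: c_def)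
  have sub: "span B \<subseteq> span (insert a B)" by (intro span_mono) auto
  have a: "a \<in> span (insert a B)" by (simp add: span_base)
  show ?case
  proof (intro bexI ballI)
    show "p + c *\<^sub>R (a - q) \<in> span (insert a B)"
      using p(1) q(1) sub a by (intro span_add span_scale span_diff) auto
    fix w assume "w \<in> span (insert a B)"
    then obtain k where k: "w - k *\<^sub>R a \<in> span B" by (auto simp: span_breakdown_eq)
    define u where "u = w - k *\<^sub>R a + k *\<^sub>R q"
    have u: "u \<in> span B" unfolding u_def using k q(1) by (intro span_add span_scale)
    have w: "w = u + k *\<^sub>R (a - q)" by (simp add: u_def algebra_simps)
    have "inner (x - (p + c *\<^sub>R (a - q))) w
      = inner (x - p) u - c * inner (a - q) u
        + k * (inner (x - p) (a - q) - c * inner (a - q) (a - q))"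
      unfolding w by (simp add: inner_simps algebra_simps)
    then show "inner (x - (p + c *\<^sub>R (a - q))) w = 0"
      using p(2)[OF u] q(2)[OF u] c by simp
  qed
qed

lemma infdist_0_imp_in_span:
  fixes B :: "'a::real_inner set"
  assumes "finite B" "infdist x (span B) = 0"
  shows "x \<in> span B"
proof -
  obtain p where p: "p \<in> span B" "\<And>w. w \<in> span B \<Longrightarrow> inner (x - p) w = 0"
    using orthogonal_projection_exists[OF assms(1)] by blast
  have "norm (x - p) \<le> dist x w" if "w \<in> span B" for w
  proof -
    have "inner (x - p) (p - w) = 0" using p that by (simp add: span_diff)
    then have "(norm (x - w))\<^sup>2 = (norm (x - p))\<^sup>2 + (norm (p - w))\<^sup>2"
      using norm_add_Pythagorean[of "x - p" "p - w"] by (simp add: orthogonal_def)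
    then have "(norm (x - p))\<^sup>2 \<le> (norm (x - w))\<^sup>2" by simp
    then show ?thesis
      unfolding dist_norm by (rule power2_le_imp_le) simp
  qed
  then have "norm (x - p) \<le> infdist x (span B)"
    unfolding infdist_def using p(1) by (smt (verit) cINF_greatest empty_iff)
  then show ?thesis using assms(2) p(1) by auto
qed

lemma euclidean_subset_span: "euclidean n \<subseteq> span ((\<lambda>i. Poly_Mapping.single i 1) ` {..<n})"
proof
  fix x assume x: "x \<in> euclidean n"
  have "x = (\<Sum>i<n. Poly_Mapping.lookup x i *\<^sub>R Poly_Mapping.single i 1)"
  proof (rule poly_mapping_eqI)
    fix k
    have "(\<Sum>i<n. Poly_Mapping.lookup (Poly_Mapping.lookup x i *\<^sub>R Poly_Mapping.single i (1::real)) k)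
      = (\<Sum>i<n. if i = k then Poly_Mapping.lookup x k else 0)"
      by (intro sum.cong) (auto simp: lookup_scaleR lookup_single when_def)
    also have "\<dots> = Poly_Mapping.lookup x k" using x by (auto simp: euclidean_def)
    finally show "Poly_Mapping.lookup x k = Poly_Mapping.lookup (\<Sum>i<n. Poly_Mapping.lookup x i *\<^sub>R Poly_Mapping.single i 1) k"
      by (simp add: lookup_sum)
  qed
  also have "\<dots> \<in> span ((\<lambda>i. Poly_Mapping.single i 1) ` {..<n})"
    by (intro span_sum span_scale span_base) auto
  finally show "x \<in> span ((\<lambda>i. Poly_Mapping.single i 1) ` {..<n})" .
qed

lemma grassmannian_finite_basis:
  assumes "V \<in> grassmannian n d"
  obtains B where "finite B" "V = span B" "independent B" "card B = d"
proof -
  let ?E = "(\<lambda>i. Poly_Mapping.single i (1::real)) ` {..<n}"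
  have V: "subspace V" "V \<subseteq> euclidean n" "dim V = d"
    using assms by (auto simp: grassmannian_def)
  obtain B where B: "B \<subseteq> V" "independent B" "V \<subseteq> span B" "card B = dim V"
    using basis_exists by blast
  have "B \<subseteq> span ?E" using B(1) V(2) euclidean_subset_span by blast
  then have "finite B" using independent_span_bound[of ?E B] B(2) by simp
  moreover have "V = span B" using B V(1) span_minimal by blast
  ultimately show thesis using B V that by simp
qed

lemma bdd_above_grassmannian_dist:
  "bdd_above ((\<lambda>x. \<bar>infdist x V - infdist x W\<bar>) ` cball (0::'a::real_normed_vector) 1)"
proof (rule bdd_aboveI2)
  fix x :: 'a assume "x \<in> cball 0 1"
  then have "dist x 0 \<le> 1" by simp
  then show "\<bar>infdist x V - infdist x W\<bar> \<le> infdist 0 V + infdist 0 W + 1"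
    using infdist_triangle[of x V 0] infdist_triangle[of x W 0]
      infdist_nonneg[of x V] infdist_nonneg[of x W] infdist_nonneg[of 0 V] infdist_nonneg[of 0 W]
    by linarith
qed

lemma grassmannian_dist_upper:
  "x \<in> cball 0 1 \<Longrightarrow> \<bar>infdist x V - infdist x W\<bar> \<le> grassmannian_dist V W"
  unfolding grassmannian_dist_def by (intro cSUP_upper bdd_above_grassmannian_dist)

lemma grassmannian_dist_0_subset:
  assumes V: "V \<in> grassmannian n d" and W: "W \<in> grassmannian n d"
    and 0: "grassmannian_dist V W = 0"
  shows "V \<subseteq> W"
proof
  fix v assume v: "v \<in> V"
  have sV: "subspace V" and sW: "subspace W" using V W by (auto simp: grassmannian_def)
  show "v \<in> W"
  proof (cases "v = 0")
    case True
    then show ?thesis using sW by (simp add: subspace_0)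
  next
    case False
    define x where "x = v /\<^sub>R norm v"
    have x: "x \<in> V" "norm x = 1"
      unfolding x_def using v sV False by (auto intro: subspace_scale)
    have "infdist x W = 0"
      using grassmannian_dist_upper[of x V W] x 0 by simp
    moreover obtain B where "finite B" "W = span B" by (rule grassmannian_finite_basis[OF W])
    ultimately have "x \<in> W" using infdist_0_imp_in_span[of B x] by simp
    then have "norm v *\<^sub>R x \<in> W" using sW by (intro subspace_scale)
    then show ?thesis using False by (simp add: x_def)
  qed
qed

interpretation grassmannian: Metric_space "grassmannian n d" grassmannian_dist for n d
proof
  fix V W U :: "(nat \<Rightarrow>\<^sub>0 real) set"
  show "0 \<le> grassmannian_dist V W"
    using grassmannian_dist_upper[of 0 V W] by simp
  show "grassmannian_dist V W = grassmannian_dist W V"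
    by (simp add: grassmannian_dist_def abs_minus_commute)
  then have sym: "grassmannian_dist W V = grassmannian_dist V W" ..
  assume V: "V \<in> grassmannian n d" and W: "W \<in> grassmannian n d"
  show "grassmannian_dist V W = 0 \<longleftrightarrow> V = W"
    using grassmannian_dist_0_subset[OF V W] grassmannian_dist_0_subset[OF W V] sym
    by (auto simp: grassmannian_dist_def)
  show "grassmannian_dist V U \<le> grassmannian_dist V W + grassmannian_dist W U"
    unfolding grassmannian_dist_def[of V U]
  proof (rule cSUP_least)
    fix x :: "nat \<Rightarrow>\<^sub>0 real" assume "x \<in> cball 0 1"
    then show "\<bar>infdist x V - infdist x U\<bar> \<le> grassmannian_dist V W + grassmannian_dist W U"
      using grassmannian_dist_upper[of x V W] grassmannian_dist_upper[of x W U] by linarith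
  qed simp
qed

definition grassmannian_borel :: "nat \<Rightarrow> nat \<Rightarrow> (nat \<Rightarrow>\<^sub>0 real) set measure"
  where "grassmannian_borel n d =
    sigma (grassmannian n d) {U. openin (grassmannian.mtopology n d) U}"

section \<open>Hausdorff measure and dimension\<close>

text \<open>
  \<open>diam(U)\<^sup>s\<close> with the conventions that the empty set contributes \<open>0\<close> and that
  \<open>0\<^sup>0 = 1\<close> for nonempty \<open>U\<close>; note that \<open>0 powr 0 = 0\<close>. The argument \<open>U\<close> is meant to be bounded.
\<close>

definition diameter_power :: "real \<Rightarrow> 'a::metric_space set \<Rightarrow> ennreal"
  where "diameter_power s U =
    (if U = {} then 0 else if s = 0 then 1 else ennreal (diameter U powr s))"

definition hausdorff_premeasure :: "real \<Rightarrow> real \<Rightarrow> 'a::metric_space set \<Rightarrow> ennreal"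
  where "hausdorff_premeasure s \<delta> A =
    (INF U\<in>{U :: nat \<Rightarrow> 'a set. A \<subseteq> (\<Union>i. U i) \<and> (\<forall>i. bounded (U i) \<and> diameter (U i) \<le> \<delta>)}.
      suminf (\<lambda>i. diameter_power s (U i)))"

definition hausdorff_measure :: "real \<Rightarrow> 'a::metric_space set \<Rightarrow> ennreal"
  where "hausdorff_measure s A = (SUP \<delta>\<in>{0<..}. hausdorff_premeasure s \<delta> A)"

definition hausdorff_dim :: "'a::metric_space set \<Rightarrow> ennreal"
  where "hausdorff_dim A = (INF s\<in>{s. 0 \<le> s \<and> hausdorff_measure s A = 0}. ennreal s)"

section \<open>Weak tangent fields\<close>

text \<open>A curve fragment is a function together with its domain; values outside are irrelevant.\<close>

definition curve_fragment :: "real set \<Rightarrow> (real \<Rightarrow> 'a::metric_space) \<Rightarrow> bool"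
  where "curve_fragment D \<gamma> \<longleftrightarrow>
    D \<subseteq> {0..1} \<and> D \<noteq> {} \<and> compact D \<and> (\<exists>L. L-lipschitz_on D \<gamma>)"

text \<open>
  The exceptional set contains the points where the derivative does not exist. At an isolated
  point of \<open>D\<close> every vector is a derivative, but there are only countably many such points.
\<close>

definition weak_tangent_field ::
  "nat \<Rightarrow> nat \<Rightarrow> 'a::metric_space set \<Rightarrow> ('a \<Rightarrow> (nat \<Rightarrow>\<^sub>0 real)) \<Rightarrow> ('a \<Rightarrow> (nat \<Rightarrow>\<^sub>0 real) set) \<Rightarrow> bool"
  where "weak_tangent_field n d S F \<tau> \<longleftrightarrow>
    \<tau> \<in> restrict_space borel S \<rightarrow>\<^sub>M grassmannian_borel n d \<and>
    (\<forall>D \<gamma>. curve_fragment D \<gamma> \<longrightarrow>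
      hausdorff_measure 1
        {t \<in> D. \<gamma> t \<in> S \<and>
          \<not> (\<exists>v. ((F \<circ> \<gamma>) has_vector_derivative v) (at t within D) \<and> v \<in> \<tau> (\<gamma> t))} = 0)"

definition admits_weak_tangent_field :: "nat \<Rightarrow> 'a::metric_space set \<Rightarrow> bool"
  where "admits_weak_tangent_field d S \<longleftrightarrow>
    (\<forall>n\<ge>d. \<forall>F :: 'a \<Rightarrow> (nat \<Rightarrow>\<^sub>0 real).
      range F \<subseteq> euclidean n \<and> (\<exists>L. L-lipschitz_on UNIV F) \<longrightarrow>
      (\<exists>\<tau>. weak_tangent_field n d S F \<tau>))"

section \<open>Bounded 1-Lipschitz maps and residual sets\<close>

text \<open>The type \<open>'a \<Rightarrow>\<^sub>C 'b\<close> of bounded continuous functions carries the supremum metric.\<close>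

definition Lip1 :: "('a::metric_space \<Rightarrow>\<^sub>C 'b::metric_space) set"
  where "Lip1 = {f. 1-lipschitz_on UNIV (apply_bcontfun f)}"

definition residual_in :: "'a topology \<Rightarrow> 'a set \<Rightarrow> bool"
  where "residual_in T A \<longleftrightarrow> A \<subseteq> topspace T \<and>
    (\<exists>\<U>. countable \<U> \<and> (\<forall>U\<in>\<U>. openin T U \<and> T closure_of U = topspace T) \<and>
      topspace T \<inter> \<Inter>\<U> \<subseteq> A)"

end

theory Submission
  imports Defs
begin

text \<open>
  The maps admitting a compact set \<open>K\<close> of almost full measure whose image has small
  \<open>s\<close>-dimensional content form an open set, so by a Borel--Cantelli argument with \<open>s\<close> decreasing
  to \<open>d\<close> it suffices to show that this set is dense. Up to a null set, \<open>S\<close> splits into finitely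
  many separated compact pieces on which the tangent field of \<open>f\<close> is nearly a constant subspace.
  On such a piece \<open>K\<close> a component \<open>h = \<langle>e, f\<rangle>\<close> orthogonal to the subspace has derivative at most
  \<open>\<epsilon>\<close> along every curve fragment, and we replace it by the infimum of \<open>h\<close> plus the cost of chains
  of jumps in \<open>K\<close>, where short jumps cost only \<open>\<epsilon>\<close> times their length and long jumps cost the full
  amount \<open>\<rho>\<close> that the Lipschitz bound leaves to this component. As the length allowed for short
  jumps tends to \<open>0\<close>, the new function converges to \<open>h\<close>: a limiting optimal chain is a curve
  fragment along which \<open>h\<close> cannot increase faster than the cost. The new function is
  \<open>\<epsilon>\<close>-Lipschitz at small scales, so after discarding a thin family of slabs of small measure its
  values can be rounded to a finite set without exceeding the Lipschitz bound. Doing this for all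
  normal directions \<open>e\<close> maps most of \<open>K\<close> into finitely many \<open>d\<close>-dimensional affine subspaces.
\<close>

section \<open>Chains of jumps\<close>

text \<open>The components of a map into a Euclidean space share one Lipschitz bound, so the
  increment left to a single component between two points depends on what the others use there: it
  is no multiple of the distance and need not satisfy the triangle inequality. Its chain infimum
  \<open>\<rho>\<close> is a metric, so extension is still possible, and the original component
  stays below \<open>\<rho>\<close> by a margin \<open>\<kappa> * dist x y\<close>, bought by
  scaling the map by 1 - \<theta> beforehand. This margin pays for every later change. Rounding to
  finitely many values loses a fraction 1/N of the measure but multiplies small-scale slopes by N,
  so slowness of order \<epsilon> suffices under the condition N * \<epsilon> \<le> \<kappa>; this
  is why a component is flattened before it is rounded. Limits of chains are curve fragments rather
  than curves since K may be totally disconnected: jumps survive in the limit, but there the cost is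
  \<open>\<rho>\<close>, which dominates the increment of h without any information on
  derivatives.\<close>

inductive chain :: "'a set \<Rightarrow> ('a \<Rightarrow> 'a \<Rightarrow> real) \<Rightarrow> 'a \<Rightarrow> 'a \<Rightarrow> real \<Rightarrow> bool"
  for A c where
  chain_refl: "x \<in> A \<Longrightarrow> chain A c x x 0"
| chain_step: "chain A c x y s \<Longrightarrow> z \<in> A \<Longrightarrow> chain A c x z (s + c y z)"

text \<open>For nonnegative symmetric \<open>c\<close>, the largest pseudometric on \<open>A\<close>
  that lies below \<open>c\<close>.\<close>

definition chain_dist :: "'a set \<Rightarrow> ('a \<Rightarrow> 'a \<Rightarrow> real) \<Rightarrow> 'a \<Rightarrow> 'a \<Rightarrow> real"
  where "chain_dist A c x y = Inf {s. chain A c x y s}"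

lemma chain_in: "chain A c x y s \<Longrightarrow> x \<in> A \<and> y \<in> A"
  by (induction rule: chain.induct) auto

lemma chain_single: "x \<in> A \<Longrightarrow> y \<in> A \<Longrightarrow> chain A c x y (c x y)"
  using chain_step[OF chain_refl, of x A y c] by simp

lemma chain_trans: "chain A c y z t \<Longrightarrow> chain A c x y s \<Longrightarrow> chain A c x z (s + t)"
proof (induction rule: chain.induct)
  case (chain_step y z t w)
  have "chain A c x w (s + t + c z w)"
    using chain_step by (intro chain.intros(2)) auto
  then show ?case by (simp add: add.assoc)
qed simp

lemma chain_sym:
  assumes "\<And>x y. c x y = c y x"
  shows "chain A c x y s \<Longrightarrow> chain A c y x s"
proof (induction rule: chain.induct)
  case (chain_step x y s z)
  have "chain A c z y (c y z)"
    using chain_step chain_in[OF chain_step.hyps(1)] chain_single[of z A y c] assms[of y z] by auto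
  from chain_trans[OF chain_step.IH this] show ?case by (simp add: add.commute)
qed (rule chain_refl)

text \<open>The maximality of \<open>chain_dist\<close>: the triangle inequality carries a bound
  from single jumps to whole chains. Suitable choices of \<open>q\<close> are a multiple of the
  distance, the chain distance of a cheaper cost, or the increment of a function plus such a
  multiple.\<close>

lemma chain_lower:
  assumes "\<And>x. x \<in> A \<Longrightarrow> q x x \<le> 0"
    and "\<And>x y z. x \<in> A \<Longrightarrow> y \<in> A \<Longrightarrow> z \<in> A \<Longrightarrow> q x z \<le> q x y + q y z"
    and "\<And>x y. x \<in> A \<Longrightarrow> y \<in> A \<Longrightarrow> q x y \<le> c x y"
  shows "chain A c x y s \<Longrightarrow> q x y \<le> s"
proof (induction rule: chain.induct)
  case (chain_step x y s z)
  then show ?case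
    using assms(2)[of x y z] assms(3)[of y z] chain_in[OF chain_step.hyps(1)] by auto
qed (rule assms(1))

context
  fixes A :: "'a set" and c :: "'a \<Rightarrow> 'a \<Rightarrow> real"
  assumes nonneg: "\<And>x y. 0 \<le> c x y"
begin

lemma chain_nonneg: "chain A c x y s \<Longrightarrow> 0 \<le> s"
  by (induction rule: chain.induct) (auto simp: nonneg)

lemma chain_bdd_below: "bdd_below {s. chain A c x y s}"
  using chain_nonneg by (intro bdd_belowI[of _ 0]) auto

lemma chain_dist_le: "chain A c x y s \<Longrightarrow> chain_dist A c x y \<le> s"
  unfolding chain_dist_def by (rule cInf_lower[OF _ chain_bdd_below]) simp

lemma chain_dist_le_cost: "x \<in> A \<Longrightarrow> y \<in> A \<Longrightarrow> chain_dist A c x y \<le> c x y"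
  by (rule chain_dist_le) (rule chain_single)

lemma chain_approx:
  assumes "x \<in> A" "y \<in> A" "0 < e"
  obtains s where "chain A c x y s" "s < chain_dist A c x y + e"
proof -
  have "{s. chain A c x y s} \<noteq> {}" using chain_single[OF assms(1,2)] by auto
  moreover have "Inf {s. chain A c x y s} < chain_dist A c x y + e"
    using assms by (simp add: chain_dist_def)
  ultimately obtain s where "s \<in> {s. chain A c x y s}" "s < chain_dist A c x y + e"
    by (metis (no_types, lifting) cInf_lessD)
  then show thesis using that by simp
qed

lemma chain_dist_geI:
  assumes "x \<in> A" "y \<in> A" "\<And>s. chain A c x y s \<Longrightarrow> a \<le> s"
  shows "a \<le> chain_dist A c x y"
  unfolding chain_dist_def using chain_single[OF assms(1,2)] assms(3)
  by (intro cInf_greatest) auto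

lemma chain_dist_nonneg: "x \<in> A \<Longrightarrow> y \<in> A \<Longrightarrow> 0 \<le> chain_dist A c x y"
  using chain_dist_geI[of x y 0] chain_nonneg by blast

lemma chain_dist_refl: "x \<in> A \<Longrightarrow> chain_dist A c x x = 0"
  using chain_dist_le[OF chain_refl[of x A c]] chain_dist_nonneg[of x x] by auto

lemma chain_dist_triangle:
  assumes "x \<in> A" "y \<in> A" "z \<in> A"
  shows "chain_dist A c x z \<le> chain_dist A c x y + chain_dist A c y z"
proof (rule field_le_epsilon)
  fix e :: real assume "0 < e"
  then have e: "0 < e / 2" by simp
  obtain s where s: "chain A c x y s" "s < chain_dist A c x y + e / 2"
    using chain_approx[OF assms(1,2) e] .
  obtain t where t: "chain A c y z t" "t < chain_dist A c y z + e / 2"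
    using chain_approx[OF assms(2,3) e] .
  show "chain_dist A c x z \<le> chain_dist A c x y + chain_dist A c y z + e"
    using chain_dist_le[OF chain_trans[OF t(1) s(1)]] s t by linarith
qed

end

lemma chain_dist_commute:
  assumes "\<And>x y. c x y = c y x"
  shows "chain_dist A c x y = chain_dist A c y x"
proof -
  have "chain A c x y s \<longleftrightarrow> chain A c y x s" for s
    by (rule iffI; rule chain_sym[of c A, OF assms])
  then show ?thesis by (simp add: chain_dist_def)
qed

section \<open>Null sets and growth of functions on compact subsets of the line\<close>

lemma hausdorff_null_open_cover:
  fixes E :: "real set"
  assumes E: "hausdorff_measure 1 E = 0" and e: "0 < e"
  obtains G where "open G" "E \<subseteq> G" "emeasure lborel G \<le> ennreal e"
proof -
  \<comment> \<open>Fattened to a ball, each set has length at most twice its diameter plus twice a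
    geometric excess, which also serves sets of diameter 0. Both totals are at most 2 * e'.\<close>
  define e' where "e' = e / 4"
  have e': "0 < e'" using e by (simp add: e'_def)
  have "hausdorff_premeasure 1 1 E \<le> hausdorff_measure 1 E"
    unfolding hausdorff_measure_def by (rule SUP_upper) simp
  then have "hausdorff_premeasure 1 1 E < ennreal e'" using E e' by simp
  then obtain U :: "nat \<Rightarrow> real set" where U: "E \<subseteq> (\<Union>i. U i)" "\<And>i. bounded (U i)"
    and sum: "suminf (\<lambda>i. diameter_power 1 (U i)) < ennreal e'"
    unfolding hausdorff_premeasure_def by (auto simp: INF_less_iff)
  define x where "x i = (SOME y. y \<in> U i)" for i
  define r where "r i = diameter (U i) + e' * (1/2) ^ Suc i" for i
  have r: "0 < r i" for i
    using diameter_ge_0[OF U(2), of i] e' by (simp add: r_def add_nonneg_pos)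
  define B where "B i = (if U i = {} then {} else ball (x i) (r i))" for i
  have sub: "U i \<subseteq> B i" for i
  proof
    fix y assume y: "y \<in> U i"
    then have "x i \<in> U i" unfolding x_def by (rule someI)
    then have "dist (x i) y \<le> diameter (U i)"
      using y diameter_bounded_bound[OF U(2)] by blast
    also have "\<dots> < r i" using e' by (simp add: r_def)
    finally show "y \<in> B i" using y by (auto simp: B_def)
  qed
  have em: "emeasure lborel (B i) \<le> 2 * diameter_power 1 (U i) + 2 * ennreal (e' * (1/2) ^ Suc i)" for i
  proof (cases "U i = {}")
    case False
    have "emeasure lborel (B i) = ennreal (2 * r i)"
      using False r[of i] by (simp add: B_def ball_eq_greaterThanLessThan)
    also have "\<dots> = 2 * diameter_power 1 (U i) + 2 * ennreal (e' * (1/2) ^ Suc i)"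
    proof -
      have two: "ennreal (2 * x) = 2 * ennreal x" if "0 \<le> x" for x :: real
        using that by (simp add: ennreal_mult)
      have "ennreal (2 * r i) = ennreal (2 * diameter (U i)) + ennreal (2 * (e' * (1/2) ^ Suc i))"
        using e' diameter_ge_0[OF U(2), of i] unfolding r_def distrib_left
        by (intro ennreal_plus) auto
      then show ?thesis
        using False e' diameter_ge_0[OF U(2), of i] by (simp add: diameter_power_def two del: power_Suc)
    qed
    finally show ?thesis by simp
  qed (simp add: B_def)
  show thesis
  proof (rule that[of "\<Union>i. B i"])
    show "open (\<Union>i. B i)" by (auto simp: B_def)
    show "E \<subseteq> (\<Union>i. B i)" using U(1) sub by blast
    have half: "suminf (\<lambda>i. ennreal (e' * (1/2) ^ Suc i)) = ennreal e'"
      using sums_mult[OF power_half_series, of e'] e'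
      by (intro suminf_ennreal_eq) (auto simp del: power_Suc)
    have "emeasure lborel (\<Union>i. B i) \<le> suminf (\<lambda>i. emeasure lborel (B i))"
      by (rule emeasure_subadditive_countably) (auto simp: B_def)
    also have "\<dots> \<le> suminf (\<lambda>i. 2 * diameter_power 1 (U i) + 2 * ennreal (e' * (1/2) ^ Suc i))"
      by (rule suminf_le[OF em]) auto
    also have "\<dots> = 2 * suminf (\<lambda>i. diameter_power 1 (U i)) + 2 * ennreal e'"
      by (simp add: suminf_add[symmetric] ennreal_suminf_cmult half del: power_Suc)
    also have "\<dots> \<le> 2 * ennreal e' + 2 * ennreal e'"
      by (intro add_mono mult_left_mono less_imp_le[OF sum]) auto
    also have "\<dots> = ennreal (2 * e' + 2 * e')"
      using e' by (subst ennreal_plus) (auto simp: ennreal_mult)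
    also have "\<dots> = ennreal e" by (simp add: e'_def)
    finally show "emeasure lborel (\<Union>i. B i) \<le> ennreal e" .
  qed
qed

text \<open>
  A substitute for integrating the derivative: sweep \<open>D\<close> from left to right, paying \<open>C\<close> per unit
  length on an open set of small measure that covers \<open>E\<close>.
\<close>

lemma real_subset_sweep:
  fixes \<phi> :: "real \<Rightarrow> real"
  assumes D: "compact D" "a \<in> D" "b \<in> D" "a \<le> b"
    and lip: "C-lipschitz_on D \<phi>" and M: "0 \<le> M"
    and gap: "\<And>s t. s \<in> D \<Longrightarrow> t \<in> D \<Longrightarrow> s < t \<Longrightarrow> {s<..<t} \<inter> D = {} \<Longrightarrow> \<phi> t - \<phi> s \<le> M * (t - s)"
    and E: "hausdorff_measure 1 E = 0"
    and der: "\<And>t. t \<in> D - E \<Longrightarrow> \<exists>v. (\<phi> has_real_derivative v) (at t within D) \<and> v \<le> M"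
  shows "\<phi> b - \<phi> a \<le> M * (b - a)"
proof -
  have C: "0 \<le> C" using lip by (rule lipschitz_on_nonneg)
  have lipD: "\<phi> t - \<phi> s \<le> C * (t - s)" if "s \<in> D" "t \<in> D" "s \<le> t" for s t
    using lipschitz_onD[OF lip that(2,1)] that(3) by (simp add: dist_real_def)
  have main: "\<phi> b - \<phi> a \<le> (M + e) * (b - a) + C * e" if e: "0 < e" for e
  proof -
    obtain G where G: "open G" "E \<subseteq> G" "emeasure lborel G \<le> ennreal e"
      using hausdorff_null_open_cover[OF E e] .
    define m where "m t = measure lborel (G \<inter> {a..t})" for t
    have fin: "G \<inter> {a..t} \<in> fmeasurable lborel" for t
    proof (rule fmeasurableI2[of "{a..t}"])
      show "{a..t} \<in> fmeasurable lborel" by (auto simp: fmeasurable_def emeasure_lborel_Icc_eq)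
      show "G \<inter> {a..t} \<in> sets lborel" using G(1) by auto
    qed auto
    have Gb: "G \<in> sets borel" using G(1) by (rule borel_open)
    have m_mono: "m s \<le> m t" if "s \<le> t" for s t
      unfolding m_def using that fin Gb by (intro measure_mono_fmeasurable) auto
    have m_le: "m t \<le> e" for t
    proof -
      have "emeasure lborel (G \<inter> {a..t}) \<le> ennreal e"
        using G(3) emeasure_mono[of "G \<inter> {a..t}" G lborel] G(1) by (auto intro: order_trans)
      then show ?thesis
        unfolding m_def measure_def using e enn2real_leI by fastforce
    qed
    have m_incr: "m s + (t - s) \<le> m t" if "a \<le> s" "s \<le> t" "{s..t} \<subseteq> G" for s t
    proof -
      have "m s + measure lborel {s<..t} = measure lborel ((G \<inter> {a..s}) \<union> {s<..t})"
        unfolding m_def using that(2)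
        by (intro measure_Un_AE[symmetric] AE_I2 fin) (auto simp: fmeasurable_def)
      also have "\<dots> \<le> m t"
        unfolding m_def using that fin Gb by (intro measure_mono_fmeasurable) auto
      finally show ?thesis using that by simp
    qed
    define \<psi> where "\<psi> t = (M + e) * (t - a) + C * m t" for t
    have \<psi>_incr: "\<psi> s + (M + e) * (t - s) \<le> \<psi> t" if "s \<le> t" for s t
      using mult_left_mono[OF m_mono[OF that] C] by (simp add: \<psi>_def algebra_simps)
    have \<psi>_mono: "\<psi> s \<le> \<psi> t" if "s \<le> t" for s t
      using \<psi>_incr[OF that] M e that mult_nonneg_nonneg[of "M + e" "t - s"] by linarith
    \<comment> \<open>By the Lipschitz bound and the monotonicity of \<open>\<psi>\<close>, the
      supremum s of the points that obey the barrier \<open>\<psi>\<close> is itself such a point.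
      It remains to see that s is b.\<close>
    define Q where "Q = {t \<in> D. a \<le> t \<and> t \<le> b \<and> \<phi> t - \<phi> a \<le> \<psi> t}"
    have aQ: "a \<in> Q"
      using D C by (auto simp: Q_def \<psi>_def m_def)
    have bdd: "bdd_above Q" by (auto simp: Q_def)
    define s where "s = Sup Q"
    have s: "a \<le> s" "s \<le> b"
    proof -
      show "a \<le> s" unfolding s_def by (rule cSup_upper[OF aQ bdd])
      show "s \<le> b" unfolding s_def
      proof (rule cSup_least)
        show "Q \<noteq> {}" using aQ by blast
      qed (simp add: Q_def)
    qed
    have near: "\<exists>t\<in>Q. s - \<delta> < t \<and> t \<le> s" if "0 < \<delta>" for \<delta>
    proof -
      have "s - \<delta> < Sup Q" using that by (simp add: s_def)
      then obtain t where "t \<in> Q" "s - \<delta> < t" using aQ by (metis empty_iff less_cSupD)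
      then show ?thesis using cSup_upper[OF _ bdd] by (auto simp: s_def)
    qed
    have sD: "s \<in> D"
    proof -
      have "s \<in> closure D"
        unfolding closure_approachable
      proof (intro allI impI)
        fix \<delta> :: real assume "0 < \<delta>"
        then obtain t where "t \<in> Q" "s - \<delta> < t" "t \<le> s" using near by blast
        then show "\<exists>y\<in>D. dist y s < \<delta>" by (intro bexI[of _ t]) (auto simp: Q_def dist_real_def)
      qed
      then show ?thesis using D(1) compact_imp_closed closure_closed by blast
    qed
    have sQ: "\<phi> s - \<phi> a \<le> \<psi> s"
    proof (rule field_le_epsilon)
      fix \<delta> :: real assume d: "0 < \<delta>"
      then have "0 < \<delta> / (C + 1)" using C by simp
      then obtain t where t: "t \<in> Q" "s - \<delta> / (C + 1) < t" "t \<le> s" using near by blast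
      have "C * (s - t) \<le> (C + 1) * (\<delta> / (C + 1))"
        using t C by (intro mult_mono) auto
      also have "\<dots> = \<delta>" using C by simp
      finally show "\<phi> s - \<phi> a \<le> \<psi> s + \<delta>"
        using lipD[of t s] t sD \<psi>_mono[of t s] by (auto simp: Q_def)
    qed
    have no_larger: "\<not> \<phi> t - \<phi> s \<le> \<psi> t - \<psi> s" if "t \<in> D" "s < t" "t \<le> b" for t
    proof
      assume "\<phi> t - \<phi> s \<le> \<psi> t - \<psi> s"
      then have "t \<in> Q" using that sQ s by (auto simp: Q_def)
      then show False using cSup_upper[OF _ bdd, of t] that by (simp add: s_def)
    qed
    \<comment> \<open>From s < b the barrier could be followed further: across a gap of D to the
      right of s by \<open>gap\<close>; inside G, where \<open>\<psi>\<close> has the extra slope C,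
      if s is in E; and otherwise by the derivative at s.\<close>
    have "s = b"
    proof (rule ccontr)
      assume "s \<noteq> b"
      with s have sb: "s < b" by simp
      have acc: "\<exists>t\<in>D. s < t \<and> t < s + \<delta> \<and> t \<le> b" if d: "0 < \<delta>" for \<delta>
      proof (rule ccontr)
        assume neg: "\<not> ?thesis"
        \<comment> \<open>Cutting \<delta> down to b - s keeps b in F, so a first point of D beyond
          the gap exists.\<close>
        define F where "F = D \<inter> {s + min \<delta> (b - s)..b}"
        have F: "compact F" "b \<in> F"
          using D sb d by (auto simp: F_def compact_Int_closed)
        then obtain t where t: "t \<in> F" "\<And>u. u \<in> F \<Longrightarrow> t \<le> u"
          using compact_attains_inf[of F] by blast
        have tD: "t \<in> D" "s < t" "t \<le> b" using t(1) d sb by (auto simp: F_def min_def split: if_splits)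
        have "u \<notin> D" if "s < u" "u < t" for u
        proof
          assume u: "u \<in> D"
          then have "u \<notin> F" using t(2)[of u] that by auto
          then have "u < s + min \<delta> (b - s)" using u that tD by (auto simp: F_def)
          then show False using neg u that tD by auto
        qed
        then have "{s<..<t} \<inter> D = {}" by auto
        then have "\<phi> t - \<phi> s \<le> M * (t - s)" by (rule gap[OF sD tD(1,2)])
        also have "\<dots> \<le> (M + e) * (t - s)" using e tD by (intro mult_right_mono) auto
        also have "\<dots> \<le> \<psi> t - \<psi> s" using \<psi>_incr[of s t] tD by simp
        finally show False using no_larger[of t] tD by auto
      qed
      show False
      proof (cases "s \<in> E")
        case True
        then obtain \<delta> where d: "0 < \<delta>" "ball s \<delta> \<subseteq> G" using G openE by blast
        obtain t where t: "t \<in> D" "s < t" "t < s + \<delta>" "t \<le> b" using acc[OF d(1)] by blast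
        have "{s..t} \<subseteq> G" using d(2) t by (auto simp: dist_real_def subset_eq)
        then have "C * (m s + (t - s)) \<le> C * m t"
          using m_incr[of s t] s t C by (intro mult_left_mono) auto
        moreover have "0 \<le> (M + e) * (t - s)" using M e t by simp
        ultimately have "C * (t - s) \<le> \<psi> t - \<psi> s"
          by (simp add: \<psi>_def algebra_simps)
        then show False using no_larger[of t] lipD[of s t] t sD by auto
      next
        case False
        then obtain v where v: "(\<phi> has_real_derivative v) (at s within D)" "v \<le> M"
          using der sD by blast
        then obtain \<delta> where d: "0 < \<delta>"
          and dd: "\<And>y. y \<in> D \<Longrightarrow> norm (y - s) < \<delta> \<Longrightarrow> norm (\<phi> y - \<phi> s - v * (y - s)) \<le> e * norm (y - s)"
          using e unfolding has_field_derivative_def has_derivative_within_alt by blast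
        obtain t where t: "t \<in> D" "s < t" "t < s + \<delta>" "t \<le> b" using acc[OF d] by blast
        have "\<phi> t - \<phi> s \<le> v * (t - s) + e * (t - s)"
          using dd[of t] t by (auto simp: abs_le_iff)
        also have "\<dots> \<le> (M + e) * (t - s)"
          using v(2) t mult_right_mono[of v M "t - s"] by (simp add: algebra_simps)
        also have "\<dots> \<le> \<psi> t - \<psi> s" using \<psi>_incr[of s t] t by simp
        finally show False using no_larger[of t] t by auto
      qed
    qed
    then have "\<phi> b - \<phi> a \<le> (M + e) * (b - a) + C * m b" using sQ by (simp add: \<psi>_def)
    also have "\<dots> \<le> (M + e) * (b - a) + C * e"
      using m_le[of b] C by (simp add: mult_left_mono)
    finally show ?thesis .
  qed
  show ?thesis
  proof (rule field_le_epsilon)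
    fix \<delta> :: real assume d: "0 < \<delta>"
    define k where "k = b - a + C"
    have k: "0 \<le> k" using D C by (simp add: k_def)
    define e where "e = \<delta> / (k + 1)"
    have e: "0 < e" using d k by (simp add: e_def)
    have "e * k \<le> e * (k + 1)" using e by simp
    also have "\<dots> = \<delta>" using k by (simp add: e_def)
    finally show "\<phi> b - \<phi> a \<le> M * (b - a) + \<delta>"
      using main[OF e] by (simp add: k_def algebra_simps)
  qed
qed

section \<open>Flattening a function that is slow along curve fragments\<close>

text \<open>Speed is measured by any Lipschitz constant of the whole fragment. This suits a fragment
  parametrised by normalised cost: if its total cost is T, then T / \<epsilon> is a Lipschitz
  constant and the bound on the slope becomes T.\<close>

definition slow_on :: "'a::metric_space set \<Rightarrow> ('a \<Rightarrow> real) \<Rightarrow> real \<Rightarrow> bool"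
  where "slow_on K h \<epsilon> \<longleftrightarrow>
    (\<forall>D \<gamma> L. curve_fragment D \<gamma> \<and> L-lipschitz_on D \<gamma> \<and> \<gamma> ` D \<subseteq> K \<longrightarrow>
      (\<exists>E. hausdorff_measure 1 E = 0 \<and>
        (\<forall>t\<in>D - E. \<exists>v. ((h \<circ> \<gamma>) has_real_derivative v) (at t within D) \<and> \<bar>v\<bar> \<le> \<epsilon> * L)))"

text \<open>The two-sided bounds make \<open>\<rho>\<close> a metric equivalent to the distance.
  Chains stay in the compact set K, so their intermediate points accumulate in K as the threshold
  for short jumps tends to 0.\<close>

locale cheap_jumps =
  fixes K :: "'a::metric_space set" and \<rho> :: "'a \<Rightarrow> 'a \<Rightarrow> real" and C \<epsilon> :: real
  assumes compact: "compact K"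
    and rho_sym: "\<rho> x y = \<rho> y x"
    and rho_triangle: "\<rho> x z \<le> \<rho> x y + \<rho> y z"
    and C_nonneg: "0 \<le> C"
    and rho_le: "\<rho> x y \<le> C * dist x y"
    and eps_pos: "0 < \<epsilon>"
    and rho_ge: "\<epsilon> * dist x y \<le> \<rho> x y"
begin

definition cost :: "nat \<Rightarrow> 'a \<Rightarrow> 'a \<Rightarrow> real"
  where "cost k x y = (if dist x y \<le> 1 / Suc k then \<epsilon> * dist x y else \<rho> x y)"

definition cd :: "nat \<Rightarrow> 'a \<Rightarrow> 'a \<Rightarrow> real"
  where "cd k = chain_dist K (cost k)"

text \<open>As k grows fewer jumps are cheap, so on K this is a monotone limit, bounded by
  \<open>\<rho>\<close>.\<close>

definition cd_lim :: "'a \<Rightarrow> 'a \<Rightarrow> real"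
  where "cd_lim x y = (SUP k. cd k x y)"

lemma cost_sym: "cost k x y = cost k y x"
  by (simp add: cost_def dist_commute rho_sym)

lemma cost_le_rho: "cost k x y \<le> \<rho> x y"
  by (simp add: cost_def rho_ge)

lemma cost_ge: "\<epsilon> * dist x y \<le> cost k x y"
  by (simp add: cost_def rho_ge)

lemma cost_nonneg: "0 \<le> cost k x y"
  using cost_ge[of x y k] eps_pos by (meson less_imp_le mult_nonneg_nonneg order_trans zero_le_dist)

lemma cost_mono:
  assumes "k \<le> l"
  shows "cost k x y \<le> cost l x y"
proof -
  have "1 / real (Suc l) \<le> 1 / real (Suc k)" using assms by (simp add: frac_le)
  then show ?thesis using rho_ge[of x y] by (auto simp: cost_def)
qed

lemma cd_le_rho: "x \<in> K \<Longrightarrow> y \<in> K \<Longrightarrow> cd k x y \<le> \<rho> x y"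
  unfolding cd_def using chain_dist_le_cost[where c = "cost k" and A = K, OF cost_nonneg, of x y] cost_le_rho[of k x y] by linarith

lemma cd_le: "x \<in> K \<Longrightarrow> y \<in> K \<Longrightarrow> cd k x y \<le> C * dist x y"
  using cd_le_rho rho_le order_trans by blast

lemma cd_triangle: "x \<in> K \<Longrightarrow> y \<in> K \<Longrightarrow> z \<in> K \<Longrightarrow> cd k x z \<le> cd k x y + cd k y z"
  unfolding cd_def by (rule chain_dist_triangle[OF cost_nonneg])

lemma cd_commute: "cd k x y = cd k y x"
  unfolding cd_def by (rule chain_dist_commute) (rule cost_sym)

lemma cd_refl: "x \<in> K \<Longrightarrow> cd k x x = 0"
  unfolding cd_def by (rule chain_dist_refl[OF cost_nonneg])

lemma cd_ge:
  assumes "x \<in> K" "y \<in> K"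
  shows "\<epsilon> * dist x y \<le> cd k x y"
  unfolding cd_def
proof (rule chain_dist_geI[OF cost_nonneg assms])
  fix s assume "chain K (cost k) x y s"
  then show "\<epsilon> * dist x y \<le> s"
  proof (rule chain_lower[where q = "\<lambda>x y. \<epsilon> * dist x y", rotated 3])
    fix x y z
    show "\<epsilon> * dist x z \<le> \<epsilon> * dist x y + \<epsilon> * dist y z"
      using mult_left_mono[OF dist_triangle[of x z y]] eps_pos by (simp add: distrib_left)
  qed (simp_all add: cost_ge)
qed

lemma cd_mono:
  assumes "k \<le> l" "x \<in> K" "y \<in> K"
  shows "cd k x y \<le> cd l x y"
  unfolding cd_def[of l]
proof (rule chain_dist_geI[OF cost_nonneg assms(2,3)])
  fix s assume "chain K (cost l) x y s"
  then show "cd k x y \<le> s"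
  proof (rule chain_lower[where q = "cd k", rotated 3])
    fix x y assume "x \<in> K" "y \<in> K"
    then show "cd k x y \<le> cost l x y"
      using chain_dist_le_cost[where c = "cost k" and A = K, OF cost_nonneg, of x y] cost_mono[OF assms(1), of x y]
      by (simp add: cd_def)
  qed (simp_all add: cd_refl cd_triangle)
qed

lemma cd_lipschitz:
  assumes "x \<in> K" "y \<in> K" "x' \<in> K" "y' \<in> K"
  shows "cd k x y \<le> cd k x' y' + C * (dist x x' + dist y y')"
proof -
  have "cd k x y \<le> cd k x x' + (cd k x' y' + cd k y' y)"
    using cd_triangle[of x x' y k] cd_triangle[of x' y' y k] assms by linarith
  also have "\<dots> \<le> C * dist x x' + (cd k x' y' + C * dist y' y)"
    using cd_le assms by (intro add_mono) auto
  finally show ?thesis by (simp add: algebra_simps dist_commute)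
qed

lemma cd_le_lim: "x \<in> K \<Longrightarrow> y \<in> K \<Longrightarrow> cd k x y \<le> cd_lim x y"
  unfolding cd_lim_def using cd_le_rho by (intro cSUP_upper bdd_aboveI2) auto

lemma cd_lim_leI: "(\<And>k. cd k x y \<le> a) \<Longrightarrow> cd_lim x y \<le> a"
  unfolding cd_lim_def by (rule cSUP_least) auto

lemma cd_lim_le_rho: "x \<in> K \<Longrightarrow> y \<in> K \<Longrightarrow> cd_lim x y \<le> \<rho> x y"
  by (intro cd_lim_leI cd_le_rho)

lemma cd_lim_commute: "cd_lim x y = cd_lim y x"
  unfolding cd_lim_def by (simp add: cd_commute)

lemma cd_lim_refl: "x \<in> K \<Longrightarrow> cd_lim x x = 0"
  by (simp add: cd_lim_def cd_refl)

lemma cd_lim_triangle: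
  assumes "x \<in> K" "y \<in> K" "z \<in> K"
  shows "cd_lim x z \<le> cd_lim x y + cd_lim y z"
proof (rule cd_lim_leI)
  fix k show "cd k x z \<le> cd_lim x y + cd_lim y z"
    using cd_triangle[OF assms, of k] cd_le_lim[OF assms(1,2), of k] cd_le_lim[OF assms(2,3), of k]
    by linarith
qed

lemma cd_lim_ge: "x \<in> K \<Longrightarrow> y \<in> K \<Longrightarrow> \<epsilon> * dist x y \<le> cd_lim x y"
  using cd_ge[of x y 0] cd_le_lim[of x y 0] by linarith

lemma cd_lim_nonneg: "x \<in> K \<Longrightarrow> y \<in> K \<Longrightarrow> 0 \<le> cd_lim x y"
  using cd_lim_ge[of x y] eps_pos by (meson less_imp_le mult_nonneg_nonneg order_trans zero_le_dist)

lemma cd_lim_pos: "x \<in> K \<Longrightarrow> y \<in> K \<Longrightarrow> x \<noteq> y \<Longrightarrow> 0 < cd_lim x y"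
  using cd_lim_ge[of x y] mult_pos_pos[of \<epsilon> "dist x y"] eps_pos zero_less_dist_iff[of x y] by linarith

lemma cd_lim_lipschitz:
  assumes "x \<in> K" "y \<in> K" "x' \<in> K" "y' \<in> K"
  shows "cd_lim x y \<le> cd_lim x' y' + C * (dist x x' + dist y y')"
proof (rule cd_lim_leI)
  fix k show "cd k x y \<le> cd_lim x' y' + C * (dist x x' + dist y y')"
    using cd_lipschitz[OF assms, of k] cd_le_lim[OF assms(3,4), of k] by linarith
qed

lemma cd_lim_tendsto:
  assumes "\<And>n::nat. u n \<in> K" "\<And>n. v n \<in> K" "u \<longlonglongrightarrow> x" "v \<longlonglongrightarrow> y" "x \<in> K" "y \<in> K"
  shows "(\<lambda>n. cd_lim (u n) (v n)) \<longlonglongrightarrow> cd_lim x y"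
proof (rule metric_tendsto_imp_tendsto)
  show "(\<lambda>n. C * (dist (u n) x + dist (v n) y)) \<longlonglongrightarrow> 0"
    by (intro tendsto_mult_right_zero tendsto_add_zero) (use assms(3,4) in \<open>simp_all only: tendsto_dist_iff[symmetric]\<close>)
  show "\<forall>\<^sub>F n in sequentially. dist (cd_lim (u n) (v n)) (cd_lim x y)
      \<le> dist (C * (dist (u n) x + dist (v n) y)) 0"
  proof (intro always_eventually allI)
    fix n
    have "0 \<le> C * (dist (u n) x + dist (v n) y)" using C_nonneg by simp
    then show "dist (cd_lim (u n) (v n)) (cd_lim x y) \<le> dist (C * (dist (u n) x + dist (v n) y)) 0"
      using cd_lim_lipschitz[of "u n" "v n" x y] cd_lim_lipschitz[of x y "u n" "v n"] assms
      by (simp add: dist_real_def dist_commute abs_le_iff)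
  qed
qed

text \<open>To get away from x without stopping at a point far from both x and y, a chain has to
  jump from the a-ball of x into that of y. Such a jump is longer than the threshold, so it costs
  the full \<open>\<rho>\<close>, which is at least \<open>\<rho> x y - 2 * C * a\<close>. The
  endpoint w is left free for the induction.\<close>

lemma chain_far_point:
  assumes a: "0 < a"
  shows "chain K (cost k) x w s \<Longrightarrow> 1 / Suc k < dist x y - 2 * a \<Longrightarrow>
    (\<exists>z s1 s2. a \<le> dist x z \<and> a \<le> dist y z \<and> chain K (cost k) x z s1 \<and> chain K (cost k) z w s2 \<and> s = s1 + s2)
    \<or> dist x w < a \<or> \<rho> x y - 2 * C * a \<le> s"
proof (induction x w s rule: chain.induct)
  case (chain_step x w s w')
  let ?c = "cost k w w'"
  have m1: "\<exists>z s1 s2. a \<le> dist x z \<and> a \<le> dist y z \<and> chain K (cost k) x z s1 \<and> chain K (cost k) z w' s2 \<and> s + ?c = s1 + s2"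
    if "a \<le> dist x z" "a \<le> dist y z" "chain K (cost k) x z s1" "chain K (cost k) z w s2" "s = s1 + s2"
    for z s1 s2
  proof -
    have "chain K (cost k) z w' (s2 + ?c)" using that(4) chain_step.hyps(2) by (rule chain.intros(2))
    then show ?thesis using that by (intro exI[of _ z] exI[of _ s1] exI[of _ "s2 + ?c"]) auto
  qed
  have m2: "\<rho> x y - 2 * C * a \<le> s + ?c" if "\<rho> x y - 2 * C * a \<le> s"
    using that cost_nonneg[of k w w'] by linarith
  have m3: "\<exists>z s1 s2. a \<le> dist x z \<and> a \<le> dist y z \<and> chain K (cost k) x z s1 \<and> chain K (cost k) z w' s2 \<and> s + ?c = s1 + s2"
    if "a \<le> dist x w'" "a \<le> dist y w'"
    using that chain.intros(2)[OF chain_step.hyps] chain_refl[OF chain_step.hyps(2), of "cost k"]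
    by (intro exI[of _ w'] exI[of _ "s + ?c"] exI[of _ 0] conjI) (assumption | simp)+
  have m4: "\<rho> x y - 2 * C * a \<le> s + ?c" if "dist x w < a" "dist y w' < a"
  proof -
    have "dist x y \<le> dist x w + dist w w' + dist y w'"
      using dist_triangle[of x y w] dist_triangle[of w y w'] by (simp add: dist_commute)
    then have "1 / Suc k < dist w w'" using that chain_step.prems by linarith
    then have "?c = \<rho> w w'" by (simp add: cost_def)
    moreover have "\<rho> x y \<le> \<rho> x w + \<rho> w w' + \<rho> w' y"
      using rho_triangle[of x y w] rho_triangle[of w y w'] by linarith
    moreover have "\<rho> x w \<le> C * a"
      using rho_le[of x w] mult_left_mono[of "dist x w" a C] that C_nonneg by linarith
    moreover have "\<rho> w' y \<le> C * a"
      using rho_le[of w' y] mult_left_mono[of "dist w' y" a C] that C_nonneg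
      by (simp add: dist_commute)
    moreover have "0 \<le> s" by (rule chain_nonneg[OF cost_nonneg chain_step.hyps(1)])
    ultimately show ?thesis by linarith
  qed
  from chain_step.IH[OF chain_step.prems] show ?case
  proof (elim disjE exE conjE)
    fix z s1 s2
    assume "a \<le> dist x z" "a \<le> dist y z" "chain K (cost k) x z s1" "chain K (cost k) z w s2" "s = s1 + s2"
    then show ?case by (intro disjI1 m1)
  next
    assume "dist x w < a"
    then show ?case using m3 m4 by (cases "dist x w' < a"; cases "dist y w' < a") auto
  next
    assume "\<rho> x y - 2 * C * a \<le> s"
    then show ?case using m2 by simp
  qed
qed (use a in auto)

text \<open>A near-optimal chain is too cheap to contain a jump from near x to near y, so it visits
  a point far from both; the distance a is independent of k, hence a cluster point of these points
  stays away from x and y.\<close>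

lemma between:
  assumes xy: "x \<in> K" "y \<in> K" and less: "cd_lim x y < \<rho> x y"
  shows "\<exists>z\<in>K. z \<noteq> x \<and> z \<noteq> y \<and> cd_lim x z + cd_lim z y = cd_lim x y"
proof -
  have "x \<noteq> y" using less rho_le[of x x] cd_lim_refl[OF xy(1)] by auto
  \<comment> \<open>b is the smaller of the distance and the cost deficit. Then a is chosen so that
    2 * a and 2 * C * a take at most half of b, and k0 so that the threshold and the error 1 / Suc k
    take less than the other half.\<close>
  define b where "b = min (dist x y) (\<rho> x y - cd_lim x y)"
  have b: "0 < b" "b \<le> dist x y" "b \<le> \<rho> x y - cd_lim x y"
    using less \<open>x \<noteq> y\<close> by (auto simp: b_def)
  define a where "a = b / (4 * (C + 1))"
  have a: "0 < a" using b C_nonneg by (simp add: a_def)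
  have a2: "2 * a \<le> b / 2"
    using b C_nonneg by (simp add: a_def field_simps)
  have aC: "2 * C * a \<le> b / 2"
    using b C_nonneg by (simp add: a_def field_simps)
  obtain k0 :: nat where k0: "1 / Suc k0 < b / 2"
    using nat_approx_posE[of "b / 2"] b(1) by auto
  have ex: "\<exists>z\<in>K. a \<le> dist x z \<and> a \<le> dist y z \<and> cd k x z + cd k z y \<le> cd_lim x y + 1 / Suc k"
    if k: "k0 \<le> k" for k
  proof -
    have "1 / real (Suc k) \<le> 1 / Suc k0" using k by (simp add: frac_le)
    then have kb: "1 / real (Suc k) < b / 2" using k0 by linarith
    obtain s where s: "chain K (cost k) x y s" "s < cd k x y + 1 / Suc k"
      using chain_approx[where c = "cost k" and A = K, OF cost_nonneg xy, of "1 / Suc k"] by (auto simp: cd_def)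
    have s': "s < cd_lim x y + 1 / Suc k" using s(2) cd_le_lim[OF xy, of k] by linarith
    have "1 / Suc k < dist x y - 2 * a" using kb a2 b by linarith
    from chain_far_point[OF a s(1) this] have far: "(\<exists>z s1 s2. a \<le> dist x z \<and> a \<le> dist y z \<and> chain K (cost k) x z s1 \<and> chain K (cost k) z y s2 \<and> s = s1 + s2)"
      using a2 aC b s' kb by (elim disjE) (simp, linarith+)
    then obtain z s1 s2
      where z: "a \<le> dist x z" "a \<le> dist y z" "chain K (cost k) x z s1" "chain K (cost k) z y s2" "s = s1 + s2"
      by blast
    have "cd k x z \<le> s1" "cd k z y \<le> s2"
      unfolding cd_def using z chain_dist_le[where c = "cost k", OF cost_nonneg] by blast+
    then show ?thesis using z s' chain_in[OF z(3)] by (intro bexI[of _ z]) auto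
  qed
  have "\<exists>z. \<forall>n. z n \<in> K \<and> a \<le> dist x (z n) \<and> a \<le> dist y (z n) \<and>
      cd (n + k0) x (z n) + cd (n + k0) (z n) y \<le> cd_lim x y + 1 / Suc (n + k0)"
    by (intro choice allI) (use ex[of "_ + k0"] in \<open>simp only: Bex_def le_add2 simp_thms\<close>)
  then obtain z where z: "\<And>n. z n \<in> K" "\<And>n. a \<le> dist x (z n)" "\<And>n. a \<le> dist y (z n)"
    "\<And>n. cd (n + k0) x (z n) + cd (n + k0) (z n) y \<le> cd_lim x y + 1 / Suc (n + k0)" by blast
  obtain w r where w: "w \<in> K" "strict_mono r" "(z \<circ> r) \<longlonglongrightarrow> w"
    using compact z(1) unfolding compact_def by blast
  have lim: "(\<lambda>n. dist u (z (r n))) \<longlonglongrightarrow> dist u w" for u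
    using w(3) by (intro tendsto_intros) (simp add: o_def)
  have "a \<le> dist x w" "a \<le> dist y w"
    using z LIMSEQ_le_const[OF lim] by blast+
  then have ne: "w \<noteq> x" "w \<noteq> y" using a by auto
  \<comment> \<open>A fixed j is compared with the growing index r n + k0 by monotonicity, and the
    moving point z (r n) with w by the Lipschitz bound, before n tends to infinity.\<close>
  have le: "cd j x w + cd j w y \<le> cd_lim x y" for j
  proof -
    have lim0: "(\<lambda>n. 1 / real (Suc (r n + k0))) \<longlonglongrightarrow> 0"
    proof (rule filterlim_compose[of "\<lambda>n. 1 / real (Suc (n + k0))" _ sequentially])
      show "(\<lambda>n. 1 / real (Suc (n + k0))) \<longlonglongrightarrow> 0"
        using LIMSEQ_ignore_initial_segment[OF lim_1_over_n[where 'a = real], of "Suc k0"] by simp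
      show "filterlim r sequentially sequentially" by (rule filterlim_subseq[OF w(2)])
    qed
    have "(\<lambda>n. cd_lim x y + 1 / Suc (r n + k0) + 2 * C * dist w (z (r n))) \<longlonglongrightarrow> cd_lim x y + 0 + 2 * C * dist w w"
      by (intro tendsto_intros lim0 lim)
    then have L: "(\<lambda>n. cd_lim x y + 1 / Suc (r n + k0) + 2 * C * dist w (z (r n))) \<longlonglongrightarrow> cd_lim x y"
      by simp
    show ?thesis
    proof (rule LIMSEQ_le_const[OF L], intro exI[of _ j] allI impI)
      fix n assume n: "j \<le> n"
      have jn: "j \<le> r n + k0" using n seq_suble[OF w(2), of n] by simp
      have "cd j x w + cd j w y \<le> cd j x (z (r n)) + cd j (z (r n)) y + 2 * C * dist w (z (r n))"
        using cd_lipschitz[of x w x "z (r n)" j] cd_lipschitz[of w y "z (r n)" y j] xy w(1) z(1)[of "r n"]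
        by (simp add: algebra_simps)
      also have "cd j x (z (r n)) + cd j (z (r n)) y \<le> cd_lim x y + 1 / Suc (r n + k0)"
        using cd_mono[OF jn xy(1) z(1), of "r n"] cd_mono[OF jn z(1)[of "r n"] xy(2)] z(4)[of "r n"]
        by linarith
      finally show "cd j x w + cd j w y \<le> cd_lim x y + 1 / Suc (r n + k0) + 2 * C * dist w (z (r n))"
        by simp
    qed
  qed
  have "cd_lim x w + cd_lim w y \<le> cd_lim x y"
  proof -
    \<comment> \<open>The two suprema are taken independently; by monotonicity the common index max
      k j serves both.\<close>
    have mix: "cd k x w + cd j w y \<le> cd_lim x y" for k j
      using le[of "max k j"] cd_mono[of k "max k j" x w] cd_mono[of j "max k j" w y] xy w(1) by simp
    have "cd_lim x w \<le> cd_lim x y - cd j w y" for j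
      by (rule cd_lim_leI) (use mix[of _ j] in \<open>simp add: algebra_simps\<close>)
    then have "cd_lim w y \<le> cd_lim x y - cd_lim x w"
      by (intro cd_lim_leI) (simp add: algebra_simps)
    then show ?thesis by simp
  qed
  then show ?thesis using cd_lim_triangle[OF xy(1) w(1) xy(2)] w(1) ne by (intro bexI[of _ w]) auto
qed

text \<open>
  Subsets of \<open>K\<close> that \<open>cd_lim x\<close> maps isometrically into the real line. A maximal one serves as the
  limiting optimal chain from \<open>x\<close> to \<open>y\<close>: by maximality and the lemma \<open>between\<close>, its gaps cost \<open>\<rho>\<close>.
\<close>

definition geodesic :: "'a \<Rightarrow> 'a \<Rightarrow> 'a set \<Rightarrow> bool"
  where "geodesic x y A \<longleftrightarrow> A \<subseteq> K \<and> x \<in> A \<and> y \<in> A \<and>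
    (\<forall>u\<in>A. cd_lim x u + cd_lim u y = cd_lim x y) \<and>
    (\<forall>u\<in>A. \<forall>v\<in>A. cd_lim u v = \<bar>cd_lim x u - cd_lim x v\<bar>)"

text \<open>By this a maximal geodesic set is closed, hence compact, as the domain of a curve
  fragment has to be.\<close>

lemma geodesic_closure:
  assumes "geodesic x y A"
  shows "geodesic x y (closure A)"
proof -
  have A: "A \<subseteq> K" "x \<in> A" "y \<in> A" "\<And>u. u \<in> A \<Longrightarrow> cd_lim x u + cd_lim u y = cd_lim x y"
    "\<And>u v. u \<in> A \<Longrightarrow> v \<in> A \<Longrightarrow> cd_lim u v = \<bar>cd_lim x u - cd_lim x v\<bar>"
    using assms unfolding geodesic_def by blast+
  have cl: "closure A \<subseteq> K" using A(1) compact by (intro closure_minimal compact_imp_closed)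
  have K: "x \<in> K" "y \<in> K" using A(1-3) by blast+
  have "cd_lim x u + cd_lim u y = cd_lim x y" if u: "u \<in> closure A" for u
  proof -
    obtain f where f: "\<And>n. f n \<in> A" "f \<longlonglongrightarrow> u" using u unfolding closure_sequential by blast
    have "(\<lambda>n. cd_lim x (f n) + cd_lim (f n) y) \<longlonglongrightarrow> cd_lim x u + cd_lim u y"
      by (intro tendsto_add cd_lim_tendsto) (use f u cl A(1) K in auto)
    then show ?thesis using A(4)[OF f(1)] by (simp add: LIMSEQ_const_iff)
  qed
  moreover have "cd_lim u v = \<bar>cd_lim x u - cd_lim x v\<bar>" if u: "u \<in> closure A" "v \<in> closure A" for u v
  proof -
    obtain f where f: "\<And>n. f n \<in> A" "f \<longlonglongrightarrow> u" using u unfolding closure_sequential by blast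
    obtain g where g: "\<And>n. g n \<in> A" "g \<longlonglongrightarrow> v" using u unfolding closure_sequential by blast
    have "(\<lambda>n. cd_lim (f n) (g n)) \<longlonglongrightarrow> cd_lim u v"
      by (intro cd_lim_tendsto) (use f g u cl A(1) in auto)
    moreover have "(\<lambda>n. \<bar>cd_lim x (f n) - cd_lim x (g n)\<bar>) \<longlonglongrightarrow> \<bar>cd_lim x u - cd_lim x v\<bar>"
      by (intro tendsto_rabs tendsto_diff cd_lim_tendsto) (use f g u cl A(1) K in auto)
    ultimately show ?thesis using A(5)[OF f(1) g(1)] LIMSEQ_unique by auto
  qed
  ultimately show ?thesis
    using cl A(2,3) closure_subset[of A] by (auto simp: geodesic_def)
qed

text \<open>By \<open>gap\<close> every point w of A lies on the far side of u or of v. The triangle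
  inequality through that point bounds the distance of w and z from above, the one through x from
  below, and the two bounds agree.\<close>

lemma geodesic_insert:
  assumes g: "geodesic x y A" and uv: "u \<in> A" "v \<in> A" and z: "z \<in> K"
    and zb: "cd_lim u z + cd_lim z v = cd_lim u v"
    and lt: "cd_lim x u < cd_lim x v"
    and gap: "\<And>w. w \<in> A \<Longrightarrow> cd_lim x w \<le> cd_lim x u \<or> cd_lim x v \<le> cd_lim x w"
  shows "geodesic x y (insert z A)"
proof -
  have A: "A \<subseteq> K" "x \<in> A" "y \<in> A" "\<And>u. u \<in> A \<Longrightarrow> cd_lim x u + cd_lim u y = cd_lim x y"
    "\<And>u v. u \<in> A \<Longrightarrow> v \<in> A \<Longrightarrow> cd_lim u v = \<bar>cd_lim x u - cd_lim x v\<bar>"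
    using g unfolding geodesic_def by blast+
  have K: "x \<in> K" "y \<in> K" "u \<in> K" "v \<in> K" using A(1-3) uv by blast+
  have uv_eq: "cd_lim u v = cd_lim x v - cd_lim x u" using A(5)[OF uv] lt by simp
  have Pz: "cd_lim x z = cd_lim x u + cd_lim u z" and zy: "cd_lim x z + cd_lim z y = cd_lim x y"
    using cd_lim_triangle[OF K(1,3) z] cd_lim_triangle[OF K(1) z K(4)] cd_lim_triangle[OF K(1) z K(2)]
      cd_lim_triangle[OF z K(4,2)] A(4)[OF uv(2)] uv_eq zb by linarith+
  have zw: "cd_lim w z = \<bar>cd_lim x w - cd_lim x z\<bar>" if w: "w \<in> A" for w
  proof -
    have wK: "w \<in> K" using w A(1) by blast
    have nn: "0 \<le> cd_lim u z" "0 \<le> cd_lim z v" using cd_lim_nonneg[OF K(3) z] cd_lim_nonneg[OF z K(4)] .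
    show ?thesis
      using gap[OF w]
    proof
      assume le: "cd_lim x w \<le> cd_lim x u"
      then have "cd_lim w u = cd_lim x u - cd_lim x w" using A(5)[OF w uv(1)] by simp
      then show ?thesis
        using cd_lim_triangle[OF wK K(3) z] cd_lim_triangle[OF K(1) wK z] Pz le nn by linarith
    next
      assume le: "cd_lim x v \<le> cd_lim x w"
      then have "cd_lim w v = cd_lim x w - cd_lim x v" using A(5)[OF w uv(2)] by simp
      then show ?thesis
        using cd_lim_triangle[OF wK K(4) z] cd_lim_triangle[OF K(1) z wK] Pz le nn zb uv_eq
          cd_lim_commute[of v z] cd_lim_commute[of z w] by linarith
    qed
  qed
  show ?thesis
    unfolding geodesic_def
  proof (intro conjI ballI)
    show "insert z A \<subseteq> K" "x \<in> insert z A" "y \<in> insert z A" using z A(1-3) by blast+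
    fix w assume w: "w \<in> insert z A"
    then show "cd_lim x w + cd_lim w y = cd_lim x y" using A(4)[of w] zy by blast
    fix w' assume w': "w' \<in> insert z A"
    show "cd_lim w w' = \<bar>cd_lim x w - cd_lim x w'\<bar>"
    proof (cases "w = z"; cases "w' = z")
      assume "w = z" "w' \<noteq> z"
      then show ?thesis using zw[of w'] w' cd_lim_commute[of z w'] by (simp add: abs_minus_commute)
    next
      assume "w \<noteq> z" "w' \<noteq> z"
      then show ?thesis using A(5)[of w w'] w w' by blast
    qed (use zw[of w] w cd_lim_refl[OF z] in auto)
  qed
qed

lemma geodesic_maximal:
  assumes "x \<in> K" "y \<in> K"
  shows "\<exists>A. geodesic x y A \<and> (\<forall>B. geodesic x y B \<longrightarrow> A \<subseteq> B \<longrightarrow> B = A)"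
proof -
  have "\<exists>M\<in>Collect (geodesic x y). \<forall>X\<in>Collect (geodesic x y). M \<subseteq> X \<longrightarrow> X = M"
  proof (rule subset_Zorn_nonempty)
    have "geodesic x y {x, y}"
      using assms cd_lim_refl cd_lim_nonneg[OF assms] cd_lim_commute[of x y] by (auto simp: geodesic_def)
    then show "Collect (geodesic x y) \<noteq> {}" by blast
    fix \<C> assume C: "\<C> \<noteq> {}" "subset.chain (Collect (geodesic x y)) \<C>"
    have g: "geodesic x y A" if "A \<in> \<C>" for A using C(2) that by (auto simp: subset.chain_def)
    have "\<exists>A\<in>\<C>. u \<in> A \<and> v \<in> A" if uv: "u \<in> \<Union>\<C>" "v \<in> \<Union>\<C>" for u v
    proof -
      obtain U where U: "u \<in> U" "U \<in> \<C>" using uv(1) by blast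
      obtain V where V: "v \<in> V" "V \<in> \<C>" using uv(2) by blast
      note UV = U V
      then have "U \<subseteq> V \<or> V \<subseteq> U" using C(2) unfolding subset.chain_def by blast
      then show ?thesis using UV by blast
    qed
    then have "cd_lim u v = \<bar>cd_lim x u - cd_lim x v\<bar>" if "u \<in> \<Union>\<C>" "v \<in> \<Union>\<C>" for u v
      using that g unfolding geodesic_def by meson
    then show "\<Union>\<C> \<in> Collect (geodesic x y)"
      using C(1) g unfolding geodesic_def by blast
  qed
  then show ?thesis unfolding Bex_def Ball_def mem_Collect_eq .
qed

text \<open>The fragment is the inverse of the normalised cost p on a maximal geodesic set. It is
  Lipschitz because cost dominates \<epsilon> times distance, and its domain is compact because p is
  Lipschitz. Its gaps are genuine jumps of cost \<open>\<rho>\<close>, so both the gap and the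
  derivative hypothesis of the sweep hold with slope T.\<close>

lemma slow_le_cd_lim:
  assumes xy: "x \<in> K" "y \<in> K" and slow: "slow_on K h \<epsilon>"
    and h: "\<And>u v. u \<in> K \<Longrightarrow> v \<in> K \<Longrightarrow> \<bar>h u - h v\<bar> \<le> \<rho> u v"
  shows "h y - h x \<le> cd_lim x y"
proof (cases "x = y")
  case True
  then show ?thesis using cd_lim_nonneg[OF xy] by simp
next
  case False
  define T where "T = cd_lim x y"
  have T: "0 < T" unfolding T_def using xy False by (rule cd_lim_pos)
  obtain A where g: "geodesic x y A" and max: "\<And>B. geodesic x y B \<Longrightarrow> A \<subseteq> B \<Longrightarrow> B = A"
    using geodesic_maximal[OF xy] by blast
  have A: "A \<subseteq> K" "x \<in> A" "y \<in> A" "\<And>u. u \<in> A \<Longrightarrow> cd_lim x u + cd_lim u y = T"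
    "\<And>u v. u \<in> A \<Longrightarrow> v \<in> A \<Longrightarrow> cd_lim u v = \<bar>cd_lim x u - cd_lim x v\<bar>"
    using g unfolding geodesic_def T_def by blast+
  have "closure A = A" by (rule max[OF geodesic_closure[OF g] closure_subset])
  then have "closed A" using closed_closure[of A] by simp
  then have cA: "compact A" using compact A(1) by (metis compact_Int_closed inf.absorb2)
  define p where "p u = cd_lim x u / T" for u
  have inj: "inj_on p A"
  proof (rule inj_onI)
    fix u v assume uv: "u \<in> A" "v \<in> A" "p u = p v"
    then have "cd_lim u v = 0" using A(5)[OF uv(1,2)] T by (simp add: p_def)
    then show "u = v" using cd_lim_pos[of u v] uv A(1) by force
  qed
  define D where "D = p ` A"
  define \<gamma> where "\<gamma> = inv_into A p"
  have \<gamma>p: "\<gamma> (p u) = u" if "u \<in> A" for u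
    unfolding \<gamma>_def using inj that by (rule inv_into_f_f)
  have \<gamma>A: "\<gamma> t \<in> A" and p\<gamma>: "p (\<gamma> t) = t" if "t \<in> D" for t
    using that \<gamma>p by (auto simp: D_def)
  have dist_\<gamma>: "cd_lim (\<gamma> s) (\<gamma> t) = T * \<bar>s - t\<bar>" if "s \<in> D" "t \<in> D" for s t
  proof -
    have "cd_lim (\<gamma> s) (\<gamma> t) = \<bar>T * p (\<gamma> s) - T * p (\<gamma> t)\<bar>"
      using A(5)[OF \<gamma>A[OF that(1)] \<gamma>A[OF that(2)]] T by (simp add: p_def)
    also have "\<dots> = T * \<bar>s - t\<bar>"
      using T by (simp add: p\<gamma> that abs_mult flip: right_diff_distrib)
    finally show ?thesis .
  qed
  have "(C / T)-lipschitz_on A p"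
  proof (rule lipschitz_onI)
    fix u v assume uv: "u \<in> A" "v \<in> A"
    then have "\<bar>cd_lim x u - cd_lim x v\<bar> \<le> C * dist u v"
      using A(5)[OF uv] cd_lim_le_rho[of u v] rho_le[of u v] A(1) by fastforce
    moreover have "dist (p u) (p v) = \<bar>cd_lim x u - cd_lim x v\<bar> / T"
      using T by (simp add: p_def dist_real_def diff_divide_distrib[symmetric])
    ultimately show "dist (p u) (p v) \<le> C / T * dist u v"
      using T by (simp add: divide_right_mono)
  qed (use T C_nonneg in auto)
  then have cD: "compact D"
    unfolding D_def using cA compact_continuous_image lipschitz_on_continuous_on by blast
  have D01: "D \<subseteq> {0..1}" 
  proof
    fix t assume "t \<in> D"
    then obtain u where u: "u \<in> A" "t = p u" by (auto simp: D_def)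
    have "0 \<le> cd_lim x u" "0 \<le> cd_lim u y" using cd_lim_nonneg A(1) u xy by auto
    then show "t \<in> {0..1}" using A(4)[OF u(1)] T u(2) by (simp add: p_def)
  qed
  have px: "p x = 0" "p y = 1" using cd_lim_refl[OF xy(1)] T by (auto simp: p_def T_def)
  have D': "0 \<in> D" "1 \<in> D" using A(2,3) px by (auto simp: D_def image_iff intro: bexI[of _ x] bexI[of _ y])
  have lip\<gamma>: "(T / \<epsilon>)-lipschitz_on D \<gamma>"
  proof (rule lipschitz_onI)
    fix s t assume st: "s \<in> D" "t \<in> D"
    have "\<epsilon> * dist (\<gamma> s) (\<gamma> t) \<le> T * dist s t"
      using cd_lim_ge[of "\<gamma> s" "\<gamma> t"] dist_\<gamma>[OF st] \<gamma>A st A(1) by (auto simp: dist_real_def)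
    then show "dist (\<gamma> s) (\<gamma> t) \<le> T / \<epsilon> * dist s t" using eps_pos by (simp add: field_simps)
  qed (use T eps_pos in auto)
  have frag: "curve_fragment D \<gamma>"
    unfolding curve_fragment_def using D01 D' cD lip\<gamma> by blast
  obtain E where E: "hausdorff_measure 1 E = 0"
    and Ed: "\<And>t. t \<in> D - E \<Longrightarrow> \<exists>v. ((h \<circ> \<gamma>) has_real_derivative v) (at t within D) \<and> \<bar>v\<bar> \<le> \<epsilon> * (T / \<epsilon>)"
  proof -
    have "\<gamma> ` D \<subseteq> K" using \<gamma>A A(1) by blast
    from slow[unfolded slow_on_def, rule_format, OF conjI[OF frag conjI[OF lip\<gamma> this]]]
    show thesis using that by (elim exE conjE) blast
  qed
  have "(h \<circ> \<gamma>) 1 - (h \<circ> \<gamma>) 0 \<le> T * (1 - 0)"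
  proof (rule real_subset_sweep[OF cD D' _ _ _ _ E])
    show "(C * (T / \<epsilon>))-lipschitz_on D (h \<circ> \<gamma>)"
    proof (rule lipschitz_on_compose[OF lip\<gamma>])
      have "C-lipschitz_on K h"
        using order_trans[OF h rho_le] C_nonneg by (intro lipschitz_onI) (simp_all add: dist_real_def)
      then show "C-lipschitz_on (\<gamma> ` D) h"
        using lipschitz_on_subset \<gamma>A A(1) by (metis image_subset_iff subsetD)
    qed
    show "\<exists>v. ((h \<circ> \<gamma>) has_real_derivative v) (at t within D) \<and> v \<le> T" if "t \<in> D - E" for t
      using Ed[OF that] eps_pos by auto
    fix s t assume st: "s \<in> D" "t \<in> D" "s < t" "{s<..<t} \<inter> D = {}"
    let ?u = "\<gamma> s" let ?v = "\<gamma> t"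
    have uv: "?u \<in> A" "?v \<in> A" "?u \<in> K" "?v \<in> K" using \<gamma>A st A(1) by auto
    have uvT: "cd_lim ?u ?v = T * (t - s)" using dist_\<gamma>[OF st(1,2)] st(3) by simp
    have Pp: "cd_lim x w = T * p w" for w using T by (simp add: p_def)
    \<comment> \<open>A cheaper gap would have a point between its ends. Maximality puts this point
      into A, although no point of A lies strictly inside the gap.\<close>
    have "\<rho> ?u ?v \<le> cd_lim ?u ?v"
    proof (rule ccontr)
      assume "\<not> ?thesis"
      then obtain z where z: "z \<in> K" "z \<noteq> ?u" "z \<noteq> ?v" "cd_lim ?u z + cd_lim z ?v = cd_lim ?u ?v"
        using between[OF uv(3,4)] by force
      have lt: "cd_lim x ?u < cd_lim x ?v" using T st by (simp add: Pp p\<gamma>)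
      have gap: "cd_lim x w \<le> cd_lim x ?u \<or> cd_lim x ?v \<le> cd_lim x w" if "w \<in> A" for w
      proof -
        have "p w \<in> D" using that by (simp add: D_def)
        then have "p w \<notin> {s<..<t}" using st(4) by blast
        then have "p w \<le> s \<or> t \<le> p w" by auto
        then show ?thesis using T st by (auto simp: Pp p\<gamma>)
      qed
      have gz: "geodesic x y (insert z A)"
        using geodesic_insert[OF g uv(1,2) z(1,4) lt gap] .
      then have zA: "z \<in> A" using max[OF gz] by blast
      have "0 < cd_lim ?u z" "0 < cd_lim z ?v" using cd_lim_pos z uv by auto
      then show False using gap[OF zA] z(4) A(5)[OF uv(1) zA] A(5)[OF zA uv(2)] A(5)[OF uv(1,2)] lt
        by linarith
    qed
    then show "(h \<circ> \<gamma>) t - (h \<circ> \<gamma>) s \<le> T * (t - s)"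
      using h[OF uv(4,3)] uvT rho_sym[of ?u ?v] by auto
  qed (use T in auto)
  then show ?thesis using \<gamma>p[OF A(2)] \<gamma>p[OF A(3)] px by (simp add: T_def)
qed

text \<open>Dini's argument: \<open>cd k\<close> increases to \<open>cd_lim\<close> and is
  C-Lipschitz in each variable uniformly in k, so the pointwise bound becomes uniform up to \<eta>
  on the compact K \<times> K.\<close>

lemma slow_le_cd:
  assumes slow: "slow_on K h \<epsilon>"
    and h: "\<And>u v. u \<in> K \<Longrightarrow> v \<in> K \<Longrightarrow> \<bar>h u - h v\<bar> \<le> \<rho> u v" and e: "0 < \<eta>"
  shows "\<exists>k. \<forall>x\<in>K. \<forall>y\<in>K. h y - h x \<le> cd k x y + \<eta>"
proof (rule ccontr)
  assume "\<not> ?thesis"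
  then have "\<forall>k. \<exists>q. fst q \<in> K \<and> snd q \<in> K \<and> cd k (fst q) (snd q) + \<eta> < h (snd q) - h (fst q)"
    by (metis fst_conv snd_conv not_le)
  then obtain q where "\<forall>k. fst (q k) \<in> K \<and> snd (q k) \<in> K \<and> cd k (fst (q k)) (snd (q k)) + \<eta> < h (snd (q k)) - h (fst (q k))"
    by (rule choice[THEN exE])
  then have q: "\<And>k. q k \<in> K \<times> K" "\<And>k. cd k (fst (q k)) (snd (q k)) + \<eta> < h (snd (q k)) - h (fst (q k))"
    by (auto simp: mem_Times_iff)
  obtain l r where l: "l \<in> K \<times> K" "strict_mono r" "(q \<circ> r) \<longlonglongrightarrow> l"
    using compact_Times[OF compact compact] q(1) unfolding compact_def by metis
  define x where "x = fst l" define y where "y = snd l"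
  have xy: "x \<in> K" "y \<in> K" using l(1) by (auto simp: x_def y_def)
  define X where "X n = fst (q (r n))" for n define Y where "Y n = snd (q (r n))" for n
  have XY: "X n \<in> K" "Y n \<in> K" for n using q(1)[of "r n"] by (auto simp: X_def Y_def mem_Times_iff)
  have X: "X \<longlonglongrightarrow> x" and Y: "Y \<longlonglongrightarrow> y"
    using tendsto_fst[OF l(3)] tendsto_snd[OF l(3)] by (simp_all add: X_def[abs_def] Y_def[abs_def] x_def y_def o_def)
  have hl: "\<bar>h u - h v\<bar> \<le> C * dist u v" if "u \<in> K" "v \<in> K" for u v
    using h[OF that] rho_le[of u v] by linarith
  have "cd j x y + \<eta> \<le> h y - h x" for j
  proof -
    have "(\<lambda>n. h y - h x + 2 * C * (dist y (Y n) + dist x (X n))) \<longlonglongrightarrow> h y - h x + 2 * C * (dist y y + dist x x)"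
      by (intro tendsto_intros X Y)
    then have L: "(\<lambda>n. h y - h x + 2 * C * (dist y (Y n) + dist x (X n))) \<longlonglongrightarrow> h y - h x" by simp
    show ?thesis
    proof (rule LIMSEQ_le_const[OF L], intro exI[of _ j] allI impI)
      fix n assume n: "j \<le> n"
      have jn: "j \<le> r n" using n seq_suble[OF l(2), of n] by simp
      have "cd j x y \<le> cd j (X n) (Y n) + C * (dist x (X n) + dist y (Y n))"
        by (rule cd_lipschitz) (use xy XY in auto)
      moreover have "cd j (X n) (Y n) + \<eta> \<le> h (Y n) - h (X n)"
        using q(2)[of "r n"] cd_mono[OF jn XY(1)[of n] XY(2)[of n]] by (simp add: X_def Y_def less_imp_le order_trans)
      moreover have "h (Y n) - h (X n) \<le> h y - h x + C * (dist x (X n) + dist y (Y n))"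
        using hl[OF xy(1) XY(1)[of n]] hl[OF xy(2) XY(2)[of n]] unfolding distrib_left by linarith
      ultimately show "cd j x y + \<eta> \<le> h y - h x + 2 * C * (dist y (Y n) + dist x (X n))"
        by (simp add: algebra_simps)
    qed
  qed
  then have "cd_lim x y \<le> h y - h x - \<eta>" by (intro cd_lim_leI) (simp add: algebra_simps)
  then show False using slow_le_cd_lim[OF xy slow h] e by simp
qed

text \<open>The infimum is the largest function below h on K that is 1-Lipschitz for
  \<open>cd k\<close>; \<open>slow_le_cd\<close> says precisely that it drops below h by at most
  \<eta>.\<close>

lemma flatten:
  assumes slow: "slow_on K h \<epsilon>"
    and h: "\<And>u v. u \<in> K \<Longrightarrow> v \<in> K \<Longrightarrow> \<bar>h u - h v\<bar> \<le> \<rho> u v" and e: "0 < \<eta>"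
  obtains k h' where "\<And>x. x \<in> K \<Longrightarrow> \<bar>h' x - h x\<bar> \<le> \<eta>"
    "\<And>x y. x \<in> K \<Longrightarrow> y \<in> K \<Longrightarrow> \<bar>h' x - h' y\<bar> \<le> cost k x y"
proof -
  obtain k where k: "\<And>x y. x \<in> K \<Longrightarrow> y \<in> K \<Longrightarrow> h y - h x \<le> cd k x y + \<eta>"
    using slow_le_cd[OF assms] by blast
  define h' where "h' x = (INF y\<in>K. h y + cd k y x)" for x
  have bdd: "bdd_below ((\<lambda>y. h y + cd k y x) ` K)" if "x \<in> K" for x
    using k[OF _ that] by (intro bdd_belowI2[of _ "h x - \<eta>"]) (simp add: algebra_simps)
  have le: "h' x \<le> h y + cd k y x" if "x \<in> K" "y \<in> K" for x y
    unfolding h'_def using bdd[OF that(1)] that(2) by (rule cINF_lower)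
  have ge: "a \<le> h' x" if "x \<in> K" "\<And>y. y \<in> K \<Longrightarrow> a \<le> h y + cd k y x" for a x
    unfolding h'_def using that by (intro cINF_greatest) auto
  have half: "h' x - h' y \<le> cost k x y" if "x \<in> K" "y \<in> K" for x y
  proof -
    have "h' x - cost k x y \<le> h' y"
    proof (rule ge[OF that(2)])
      fix z assume z: "z \<in> K"
      have "cd k y x \<le> cost k x y"
        using chain_dist_le_cost[where c = "cost k" and A = K, OF cost_nonneg that(2,1)] by (simp add: cd_def cost_sym)
      then show "h' x - cost k x y \<le> h z + cd k z y"
        using le[OF that(1) z] cd_triangle[OF z that(2,1), of k] by linarith
    qed
    then show ?thesis by simp
  qed
  show thesis
  proof (rule that)
    fix x assume x: "x \<in> K"
    have "h' x \<le> h x" using le[OF x x] cd_refl[OF x] by simp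
    moreover have "h x - \<eta> \<le> h' x" using k[OF _ x] by (intro ge[OF x]) (simp add: algebra_simps)
    ultimately show "\<bar>h' x - h x\<bar> \<le> \<eta>" using e by simp
    fix y assume y: "y \<in> K"
    show "\<bar>h' x - h' y\<bar> \<le> cost k x y"
      using half[OF x y] half[OF y x] cost_sym[of k x y] by simp
  qed
qed

end

section \<open>Collapsing one component\<close>

lemma slow_on_subset: "slow_on K h \<epsilon> \<Longrightarrow> K' \<subseteq> K \<Longrightarrow> slow_on K' h \<epsilon>"
  unfolding slow_on_def by (meson order_trans)

text \<open>
  McShane's extension with respect to \<open>\<rho>\<close>, clamped between \<open>lo\<close> and \<open>hi\<close>; equal bounds \<open>lo = hi\<close>
  away from \<open>A\<close> localise the perturbation.
\<close>

lemma clamped_extension: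
  fixes \<rho> :: "'a \<Rightarrow> 'a \<Rightarrow> real"
  assumes sym: "\<And>x y. \<rho> x y = \<rho> y x"
    and tri: "\<And>x y z. \<rho> x z \<le> \<rho> x y + \<rho> y z"
    and refl: "\<And>x. \<rho> x x = 0"
    and h: "\<And>x y. x \<in> A \<Longrightarrow> y \<in> A \<Longrightarrow> \<bar>h x - h y\<bar> \<le> \<rho> x y"
    and lo: "\<And>x y. \<bar>lo x - lo y\<bar> \<le> \<rho> x y" and hi: "\<And>x y. \<bar>hi x - hi y\<bar> \<le> \<rho> x y"
    and lohi: "\<And>x. lo x \<le> hi x" and lh: "\<And>x. x \<in> A \<Longrightarrow> lo x \<le> h x \<and> h x \<le> hi x"
  obtains g where "\<And>x y. \<bar>g x - g y\<bar> \<le> \<rho> x y" "\<And>x. lo x \<le> g x \<and> g x \<le> hi x"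
    "\<And>x. x \<in> A \<Longrightarrow> g x = h x"
proof (cases "A = {}")
  case True
  then show thesis using that[of lo] lo lohi by simp
next
  case False
  then obtain a where a: "a \<in> A" by blast
  define m where "m x = (INF y\<in>A. h y + \<rho> y x)" for x
  have bdd: "bdd_below ((\<lambda>y. h y + \<rho> y x) ` A)" for x
  proof (rule bdd_belowI2)
    fix y assume y: "y \<in> A"
    show "h a - \<rho> a x \<le> h y + \<rho> y x"
      using h[OF a y] tri[of a y x] sym[of x y] by linarith
  qed
  have m_le: "m x \<le> h y + \<rho> y x" if "y \<in> A" for x y
    unfolding m_def using bdd that by (rule cINF_lower)
  have m_half: "m x - m z \<le> \<rho> x z" for x z
  proof -
    have "m x - \<rho> x z \<le> m z"
      unfolding m_def[of z]
    proof (rule cINF_greatest[OF False])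
      fix y assume "y \<in> A"
      then show "m x - \<rho> x z \<le> h y + \<rho> y z" using m_le[of y x] tri[of y x z] sym[of x z] by linarith
    qed
    then show ?thesis by simp
  qed
  have m_lip: "\<bar>m x - m z\<bar> \<le> \<rho> x z" for x z
    using m_half[of x z] m_half[of z x] sym[of x z] by linarith
  have mA: "m x = h x" if x: "x \<in> A" for x
  proof (rule antisym)
    show "m x \<le> h x" using m_le[OF x, of x] refl by simp
    show "h x \<le> m x" unfolding m_def
    proof (rule cINF_greatest[OF False])
      fix y assume "y \<in> A"
      then show "h x \<le> h y + \<rho> y x" using h[OF x, of y] sym[of x y] by simp
    qed
  qed
  show thesis
  proof (rule that)
    fix x y
    show "\<bar>max (lo x) (min (hi x) (m x)) - max (lo y) (min (hi y) (m y))\<bar> \<le> \<rho> x y"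
      using lo[of x y] hi[of x y] m_lip[of x y] by linarith
    show "lo x \<le> max (lo x) (min (hi x) (m x)) \<and> max (lo x) (min (hi x) (m x)) \<le> hi x"
      using lohi[of x] by linarith
    show "max (lo x) (min (hi x) (m x)) = h x" if "x \<in> A"
      using mA[OF that] lh[OF that] by linarith
  qed
qed

lemma pigeonhole_small_measure:
  assumes "finite_measure \<mu>" "0 < N" "K \<in> sets \<mu>" "\<And>j. j < N \<Longrightarrow> B j \<in> sets \<mu>"
    "\<And>j. j < N \<Longrightarrow> B j \<subseteq> K" "disjoint_family_on B {..<N}"
  shows "\<exists>j<N. measure \<mu> (B j) \<le> measure \<mu> K / real N"
proof (rule ccontr)
  interpret finite_measure \<mu> by fact
  assume "\<not> ?thesis"
  then have "(\<Sum>j<N. measure \<mu> K / real N) < (\<Sum>j<N. measure \<mu> (B j))"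
    using assms(2) by (intro sum_strict_mono) auto
  also have "\<dots> = measure \<mu> (\<Union>j<N. B j)"
    using assms by (intro finite_measure_finite_Union[symmetric]) auto
  also have "\<dots> \<le> measure \<mu> K"
    using assms by (intro finite_measure_mono) auto
  finally show False using assms(2) by simp
qed

text \<open>After division by s the values are cut into unit cells, and a strip of width 1/N is
  discarded from each. There are N disjoint choices of the strips, so one of them loses at most 1/N
  of the measure. Across a discarded strip the function moves by at least 1/N while its rounding
  moves by 1: hence the factor N at small scales. At large scales the shrinking factor 1 - \<theta>
  absorbs the rounding error.\<close>

lemma collapse_function:
  fixes K :: "'a::metric_space set" and \<rho> :: "'a \<Rightarrow> 'a \<Rightarrow> real"
  assumes K: "compact K"
    and sym: "\<And>x y. \<rho> x y = \<rho> y x"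
    and tri: "\<And>x y z. \<rho> x z \<le> \<rho> x y + \<rho> y z"
    and C: "0 \<le> C" and rho_le: "\<And>x y. \<rho> x y \<le> C * dist x y"
    and lam: "0 < \<kappa>" and rho_lower: "\<And>x y. \<bar>h x - h y\<bar> + \<kappa> * dist x y \<le> \<rho> x y"
    and N: "0 < N" and eps: "0 < \<epsilon>" "real N * \<epsilon> \<le> \<kappa>"
    and slow: "slow_on K h \<epsilon>" and eta: "0 < \<eta>" and sig: "0 < \<sigma>"
    and fin: "finite_measure \<mu>" and sets: "\<And>A. A \<in> sets borel \<Longrightarrow> A \<subseteq> K \<Longrightarrow> A \<in> sets \<mu>"
  obtains h' K' where "K' \<subseteq> K" "compact K'" "measure \<mu> (K - K') \<le> measure \<mu> K / N"
    "finite (h' ` K')" "\<And>x y. \<bar>h' x - h' y\<bar> \<le> \<rho> x y" "\<And>x. \<bar>h' x - h x\<bar> \<le> \<eta>"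
    "\<And>x. (\<And>y. y \<in> K \<Longrightarrow> \<sigma> \<le> dist x y) \<Longrightarrow> h' x = h x"
proof (cases "K = {}")
  case True
  have "\<bar>h x - h y\<bar> \<le> \<rho> x y" for x y
    using rho_lower[of x y] lam mult_nonneg_nonneg[of \<kappa> "dist x y"] by (smt (verit) zero_le_dist)
  then show thesis using that[of "{}" h] eta True by simp
next
  case False
  interpret cheap_jumps K \<rho> C \<epsilon>
  proof
    fix x y :: 'a
    have "1 * \<epsilon> \<le> real N * \<epsilon>" using N eps(1) by (intro mult_right_mono) auto
    then have "\<epsilon> * dist x y \<le> \<kappa> * dist x y" using eps(2) by (intro mult_right_mono) auto
    then show "\<epsilon> * dist x y \<le> \<rho> x y" using rho_lower[of x y] by linarith
  qed (fact K sym tri C rho_le eps(1))+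
  \<comment> \<open>The cut-off \<open>\<psi>\<close> will fall from \<eta>' on K to 0 at distance
    \<sigma>. With \<eta>' \<le> \<kappa> * \<sigma> its slope is at most \<kappa>, so h - \<psi>
    and h + \<psi> still respect \<open>\<rho>\<close>.\<close>
  define \<eta>' where "\<eta>' = min \<eta> (\<kappa> * \<sigma>)"
  have eta': "0 < \<eta>'" "\<eta>' \<le> \<eta>" "\<eta>' \<le> \<kappa> * \<sigma>" using eta lam sig by (auto simp: \<eta>'_def)
  have h_le: "\<bar>h x - h y\<bar> \<le> \<rho> x y" for x y
    using rho_lower[of x y] lam mult_nonneg_nonneg[of \<kappa> "dist x y"] by (smt (verit) zero_le_dist)
  have "\<eta>' / 4 > 0" using eta' by simp
  then obtain k h1 where h1: "\<And>x. x \<in> K \<Longrightarrow> \<bar>h1 x - h x\<bar> \<le> \<eta>' / 4"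
    "\<And>x y. x \<in> K \<Longrightarrow> y \<in> K \<Longrightarrow> \<bar>h1 x - h1 y\<bar> \<le> cost k x y"
    using flatten[OF slow h_le] by metis
  have "C-lipschitz_on UNIV h"
    using order_trans[OF h_le rho_le] C by (intro lipschitz_onI) (simp_all add: dist_real_def)
  then have "continuous_on K h" using lipschitz_on_continuous_on continuous_on_subset by blast
  then have "bounded (h ` K)" using K compact_continuous_image compact_imp_bounded by blast
  then obtain B where B: "0 < B" "\<And>x. x \<in> K \<Longrightarrow> \<bar>h x\<bar> \<le> B" unfolding bounded_pos by auto
  \<comment> \<open>Shrinking \<open>h1\<close> by \<open>1 - \<theta>\<close> leaves room, at scales above \<open>1 / Suc k\<close>, for rounding its values.\<close>
  define \<theta> where "\<theta> = min (1/2) (\<eta>' / (4 * (B + \<eta>')))"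
  have th: "0 < \<theta>" "\<theta> < 1" using B eta' by (auto simp: \<theta>_def)
  have "\<theta> * (B + \<eta>') \<le> \<eta>' / (4 * (B + \<eta>')) * (B + \<eta>')"
    using B eta' by (intro mult_right_mono) (auto simp: \<theta>_def)
  also have "\<dots> = \<eta>' / 4" using B eta' by (simp add: field_simps)
  finally have thB: "\<theta> * (B + \<eta>') \<le> \<eta>' / 4" .
  define h2 where "h2 x = (1 - \<theta>) * h1 x" for x
  have h2h: "\<bar>h2 x - h x\<bar> \<le> \<eta>' / 2" if x: "x \<in> K" for x
  proof -
    have "\<bar>h1 x\<bar> \<le> B + \<eta>'" using h1(1)[OF x] B(2)[OF x] eta'(1) by linarith
    then have "\<bar>\<theta> * h1 x\<bar> \<le> \<theta> * (B + \<eta>')" using th by (simp add: abs_mult)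
    moreover have "h2 x - h x = (h1 x - h x) - \<theta> * h1 x" by (simp add: h2_def algebra_simps)
    ultimately show ?thesis using h1(1)[OF x] thB by linarith
  qed
  have h2d: "\<bar>h2 x - h2 y\<bar> \<le> (1 - \<theta>) * cost k x y" if "x \<in> K" "y \<in> K" for x y
  proof -
    have "h2 x - h2 y = (1 - \<theta>) * (h1 x - h1 y)" by (simp add: h2_def algebra_simps)
    then show ?thesis using mult_left_mono[OF h1(2)[OF that], of "1 - \<theta>"] th by (simp add: abs_mult)
  qed
  \<comment> \<open>The first bound keeps the rounded function close to h. The second gives 4 * s
    \<le> \<open>\<theta> * \<rho> x y\<close> for points more than 1 / Suc k apart, which leaves
    room to move both values by s.\<close>
  define s where "s = min (\<eta>' / 4) (\<theta> * \<kappa> / (4 * Suc k))"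
  have s: "0 < s" "s \<le> \<eta>' / 4" "s \<le> \<theta> * \<kappa> / (4 * Suc k)"
    using eta' th lam unfolding s_def by (simp, (intro min.cobounded1 min.cobounded2)+)
  define u where "u x = h2 x / s" for x
  have u_cont: "continuous_on K u"
  proof -
    have "(C / s)-lipschitz_on K u"
    proof (rule lipschitz_onI)
      fix x y assume xy: "x \<in> K" "y \<in> K"
      have "(1 - \<theta>) * cost k x y \<le> 1 * cost k x y" using th cost_nonneg[of k x y] by (intro mult_right_mono) auto
      then have "\<bar>h2 x - h2 y\<bar> \<le> C * dist x y"
        using h2d[OF xy] cost_le_rho[of k x y] rho_le[of x y] by linarith
      then have "\<bar>h2 x - h2 y\<bar> / s \<le> C * dist x y / s" using s(1) by (intro divide_right_mono) auto
      moreover have "dist (u x) (u y) = \<bar>h2 x - h2 y\<bar> / s"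
        using s(1) by (simp add: u_def dist_real_def diff_divide_distrib[symmetric])
      ultimately show "dist (u x) (u y) \<le> C / s * dist x y" by simp
    qed (use C s in auto)
    then show ?thesis by (rule lipschitz_on_continuous_on)
  qed
  then have "bounded (u ` K)" using K compact_continuous_image compact_imp_bounded by blast
  then obtain U where U: "\<And>x. x \<in> K \<Longrightarrow> \<bar>u x\<bar> \<le> U" unfolding bounded_pos by auto
  define I where "I = {- \<lceil>U\<rceil> - 2 .. \<lceil>U\<rceil> + 2}"
  \<comment> \<open>Modulo 1, \<open>G j\<close> keeps the values of u outside the open strip from
    j/N to (j + 1)/N. The index range I is finite, so \<open>G j\<close> is compact; it reaches 2
    beyond the values of u to allow for the shift of the cells.\<close>
  define G where "G j = (\<Union>i\<in>I. K \<inter> u -` {i + (real j + 1) / N .. i + 1 + real j / N})" for j :: nat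
  have cG: "compact (G j)" for j
  proof -
    have "compact (K \<inter> (K \<inter> u -` {i + (real j + 1) / N .. i + 1 + real j / N}))" for i
      using K continuous_closed_preimage[OF u_cont compact_imp_closed[OF K]] by (intro compact_Int_closed) auto
    then show ?thesis unfolding G_def by (intro compact_UN) (auto simp: I_def)
  qed
  have GK: "G j \<subseteq> K" for j by (auto simp: G_def)
  have slab: "\<lfloor>real N * u x\<rfloor> mod int N = int j" if x: "x \<in> K - G j" and j: "j < N" for x j
  proof (rule ccontr)
    assume ne: "\<lfloor>real N * u x\<rfloor> mod int N \<noteq> int j"
    define q where "q = \<lfloor>real N * u x\<rfloor>"
    \<comment> \<open>The residue of q is counted from j + 1, so q congruent to j means p = N - 1;
      every smaller p places u x in the kept part of cell i.\<close>
    define p where "p = (q - (int j + 1)) mod int N"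
    define i where "i = (q - (int j + 1)) div int N"
    have q: "q = int N * i + p + int j + 1" by (simp add: p_def i_def)
    have p0: "0 \<le> p" "p < int N" using N by (auto simp: p_def)
    have "p \<noteq> int N - 1"
    proof
      assume "p = int N - 1"
      then have "q = int j + (i + 1) * int N" using q by (simp add: algebra_simps)
      then have "q mod int N = int j" using j by simp
      then show False using ne by (simp add: q_def)
    qed
    then have p1: "p \<le> int N - 2" using p0 by simp
    have qr: "real_of_int q = real N * i + p + real j + 1" by (simp add: q)
    have "real_of_int q \<le> real N * u x" "real N * u x < q + 1" by (auto simp: q_def)
    then have lb: "real N * i + real j + 1 \<le> real N * u x" and ub: "real N * u x \<le> real N * i + real N + real j"
      using qr p0 p1 by linarith+
    have lb': "i + (real j + 1) / N \<le> u x" and ub': "u x \<le> i + 1 + real j / N"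
      using lb ub N by (simp_all add: field_simps)
    have j1: "0 \<le> (real j + 1) / N" "(real j + 1) / N \<le> 1" "0 \<le> real j / N" "real j / N \<le> 1" using j by auto
    have "\<bar>u x\<bar> \<le> U" using U x by blast
    moreover have "U \<le> real_of_int \<lceil>U\<rceil>" by simp
    ultimately have "real_of_int i \<le> \<lceil>U\<rceil> + 2" "- \<lceil>U\<rceil> - 2 \<le> real_of_int i"
      using lb' ub' j1 by linarith+
    then have "i \<in> I" unfolding I_def atLeastAtMost_iff by linarith
    then have "x \<in> G j" using lb' ub' x by (auto simp: G_def)
    then show False using x by simp
  qed
  have "\<exists>j<N. measure \<mu> (K - G j) \<le> measure \<mu> K / real N"
  proof (rule pigeonhole_small_measure[where B = "\<lambda>j. K - G j", OF fin N])
    show "K \<in> sets \<mu>" by (rule sets[OF borel_closed[OF compact_imp_closed[OF K]] order_refl])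
    show "K - G j \<in> sets \<mu>" for j
      by (rule sets[OF sets.Diff[OF borel_closed[OF compact_imp_closed[OF K]] borel_closed[OF compact_imp_closed[OF cG]]] Diff_subset])
    show "K - G j \<subseteq> K" for j by (rule Diff_subset)
    show "disjoint_family_on (\<lambda>j. K - G j) {..<N}"
      unfolding disjoint_family_on_def
    proof (intro ballI impI)
      fix a b assume ab: "a \<in> {..<N}" "b \<in> {..<N}" "a \<noteq> b"
      show "(K - G a) \<inter> (K - G b) = {}"
      proof (rule ccontr)
        assume "(K - G a) \<inter> (K - G b) \<noteq> {}"
        then obtain x where "x \<in> K - G a" "x \<in> K - G b" by blast
        then have "int a = int b" using slab[of x a] slab[of x b] ab by simp
        then show False using ab by simp
      qed
    qed
  qed
  then obtain j where j: "j < N" "measure \<mu> (K - G j) \<le> measure \<mu> K / real N" by blast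
  define cell where "cell x = \<lfloor>u x - (real j + 1) / N\<rfloor>" for x
  define h3 where "h3 x = s * (cell x + (real j + 1) / N)" for x
  have cell: "cell x \<in> I" "cell x + (real j + 1) / N \<le> u x" "u x \<le> cell x + 1 + real j / N"
    if xG: "x \<in> G j" for x
  proof -
    obtain i where i: "i \<in> I" "i + (real j + 1) / N \<le> u x" "u x \<le> i + 1 + real j / N"
      using xG by (auto simp: G_def)
    have "(real j + 1) / N = real j / N + 1 / N" by (simp add: add_divide_distrib)
    moreover have "0 < 1 / real N" using N by simp
    ultimately have "cell x = i" unfolding cell_def using i by (intro floor_unique) linarith+
    then show "cell x \<in> I" "cell x + (real j + 1) / N \<le> u x" "u x \<le> cell x + 1 + real j / N" using i by auto
  qed
  have su: "s * u x = h2 x" for x using s by (simp add: u_def)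
  have h32: "\<bar>h3 x - h2 x\<bar> \<le> s" if "x \<in> G j" for x
  proof -
    have "(real j + 1) / N = real j / N + 1 / N" by (simp add: add_divide_distrib)
    moreover have "0 < 1 / real N" using N by simp
    ultimately have "\<bar>cell x + (real j + 1) / N - u x\<bar> \<le> 1" using cell[OF that] by linarith
    then have "s * \<bar>cell x + (real j + 1) / N - u x\<bar> \<le> s * 1" using s by (intro mult_left_mono) auto
    moreover have "h3 x - h2 x = s * (cell x + (real j + 1) / N - u x)"
      by (simp add: h3_def su[symmetric] algebra_simps)
    ultimately show ?thesis using s by (simp add: abs_mult)
  qed
  \<comment> \<open>For cells n apart the values of u differ by at least n - 1 + 1/N, and the
    rounded values by n, which is at most N times as much.\<close>
  have stretch: "h3 y - h3 x \<le> real N * \<bar>h2 y - h2 x\<bar>" if xy: "x \<in> G j" "y \<in> G j" and lt: "cell x < cell y" for x y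
  proof -
    define n where "n = real_of_int (cell y - cell x)"
    have n: "1 \<le> n" using lt by (simp add: n_def)
    have "(n - 1) * 1 \<le> (n - 1) * real N" using n N by (intro mult_left_mono) auto
    then have "n \<le> N * (n - 1 + 1 / N)" using N by (simp add: algebra_simps)
    also have "\<dots> \<le> N * (u y - u x)"
      using cell(3)[OF xy(1)] cell(2)[OF xy(2)] by (intro mult_left_mono) (auto simp: n_def add_divide_distrib)
    finally have "s * n \<le> s * (N * (u y - u x))" using s by (intro mult_left_mono) auto
    also have "\<dots> = N * (h2 y - h2 x)" by (simp add: su[symmetric] algebra_simps)
    also have "\<dots> \<le> N * \<bar>h2 y - h2 x\<bar>" by (intro mult_left_mono) auto
    finally show ?thesis by (simp add: h3_def n_def algebra_simps)
  qed
  have h3_stretch: "\<bar>h3 x - h3 y\<bar> \<le> real N * \<bar>h2 x - h2 y\<bar>" if xy: "x \<in> G j" "y \<in> G j" for x y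
  proof (cases "cell x" "cell y" rule: linorder_cases)
    case less
    then have "h3 x \<le> h3 y" using s by (simp add: h3_def)
    then show ?thesis using stretch[OF xy less] by (simp add: abs_minus_commute)
  next
    case equal
    then show ?thesis by (simp add: h3_def)
  next
    case greater
    then have "h3 y \<le> h3 x" using s by (simp add: h3_def)
    then show ?thesis using stretch[OF xy(2,1) greater] by simp
  qed
  have h3_rho: "\<bar>h3 x - h3 y\<bar> \<le> \<rho> x y" if xy: "x \<in> G j" "y \<in> G j" for x y
  \<comment> \<open>At short distances h2 has slope \<epsilon> and rounding makes it at most N *
    \<epsilon> \<le> \<kappa>. At long distances the increment of h2 stays below
    \<open>\<rho> x y\<close> by at least 4 * s, and rounding adds at most 2 * s.\<close>
  proof (cases "dist x y \<le> 1 / Suc k")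
    case True
    have xK: "x \<in> K" "y \<in> K" using xy GK by auto
    have "cost k x y = \<epsilon> * dist x y" using True by (simp add: cost_def)
    moreover have "(1 - \<theta>) * cost k x y \<le> 1 * cost k x y" using th cost_nonneg[of k x y] by (intro mult_right_mono) auto
    ultimately have "\<bar>h2 x - h2 y\<bar> \<le> \<epsilon> * dist x y" using h2d[OF xK] by linarith
    then have "real N * \<bar>h2 x - h2 y\<bar> \<le> real N * (\<epsilon> * dist x y)" by (intro mult_left_mono) auto
    also have "\<dots> \<le> \<kappa> * dist x y"
      using mult_right_mono[OF eps(2), of "dist x y"] by (simp add: mult.assoc)
    also have "\<dots> \<le> \<rho> x y" using rho_lower[of x y] by linarith
    finally show ?thesis using h3_stretch[OF xy] by linarith
  next
    case False
    have xK: "x \<in> K" "y \<in> K" using xy GK by auto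
    have "\<kappa> * (1 / Suc k) \<le> \<kappa> * dist x y" using False lam by (intro mult_left_mono) auto
    then have "\<kappa> / Suc k \<le> \<rho> x y" using rho_lower[of x y] by simp
    then have "\<theta> * (\<kappa> / Suc k) \<le> \<theta> * \<rho> x y" using th by (intro mult_left_mono) auto
    moreover have "\<theta> * (\<kappa> / Suc k) = 4 * (\<theta> * \<kappa> / (4 * Suc k))" by (simp add: field_simps)
    ultimately have "4 * s \<le> \<theta> * \<rho> x y" using s(3) by linarith
    moreover have "\<bar>h2 x - h2 y\<bar> \<le> \<rho> x y - \<theta> * \<rho> x y"
      using h2d[OF xK] False by (simp add: cost_def algebra_simps)
    ultimately show ?thesis using h32[OF xy(1)] h32[OF xy(2)] s(1) by linarith
  qed
  define \<psi> where "\<psi> x = \<eta>' * max 0 (1 - infdist x K / \<sigma>)" for x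
  have psi0: "0 \<le> \<psi> x" "\<psi> x \<le> \<eta>'" for x
  proof -
    have "0 \<le> infdist x K / \<sigma>" using sig infdist_nonneg[of x K] by simp
    then have "max 0 (1 - infdist x K / \<sigma>) \<le> 1" by simp
    then show "\<psi> x \<le> \<eta>'" unfolding \<psi>_def using mult_left_mono[of "max 0 (1 - infdist x K / \<sigma>)" 1 \<eta>'] eta' by simp
    show "0 \<le> \<psi> x" using eta' by (simp add: \<psi>_def)
  qed
  have psi_lip: "\<bar>\<psi> x - \<psi> y\<bar> \<le> \<kappa> * dist x y" for x y
  proof -
    have "\<bar>infdist x K - infdist y K\<bar> \<le> dist x y"
      using infdist_triangle[of x K y] infdist_triangle[of y K x] by (simp add: dist_commute)
    then have "\<bar>infdist x K - infdist y K\<bar> / \<sigma> \<le> dist x y / \<sigma>" using sig by (intro divide_right_mono) auto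
    moreover have "\<bar>infdist x K / \<sigma> - infdist y K / \<sigma>\<bar> = \<bar>infdist x K - infdist y K\<bar> / \<sigma>"
      using sig by (simp flip: diff_divide_distrib)
    ultimately have A: "\<bar>max 0 (1 - infdist x K / \<sigma>) - max 0 (1 - infdist y K / \<sigma>)\<bar> \<le> dist x y / \<sigma>"
      by linarith
    have "\<bar>\<psi> x - \<psi> y\<bar> = \<eta>' * \<bar>max 0 (1 - infdist x K / \<sigma>) - max 0 (1 - infdist y K / \<sigma>)\<bar>"
      unfolding \<psi>_def right_diff_distrib[symmetric] abs_mult abs_of_pos[OF eta'(1)] by (rule HOL.refl)
    also have "\<dots> \<le> \<kappa> * \<sigma> * (dist x y / \<sigma>)"
      using lam sig by (intro mult_mono[OF eta'(3) A _ abs_ge_zero] mult_nonneg_nonneg less_imp_le)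
    also have "\<dots> = \<kappa> * dist x y" using sig by simp
    finally show ?thesis .
  qed
  have refl: "\<rho> x x = 0" for x
    using rho_le[of x x] rho_lower[of x x] by auto
  have h3h: "\<bar>h3 x - h x\<bar> \<le> \<eta>'" if "x \<in> G j" for x
  proof -
    have "x \<in> K" using that GK by blast
    then show ?thesis using h32[OF that] h2h[of x] s(2) eta'(1) by linarith
  qed
  have psiK: "\<psi> x = \<eta>'" if "x \<in> K" for x using that by (simp add: \<psi>_def)
  obtain g where g: "\<And>x y. \<bar>g x - g y\<bar> \<le> \<rho> x y" "\<And>x. h x - \<psi> x \<le> g x \<and> g x \<le> h x + \<psi> x"
    "\<And>x. x \<in> G j \<Longrightarrow> g x = h3 x"
  proof (rule clamped_extension[of \<rho> "G j" h3 "\<lambda>x. h x - \<psi> x" "\<lambda>x. h x + \<psi> x"])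
    show "\<bar>h x - \<psi> x - (h y - \<psi> y)\<bar> \<le> \<rho> x y" for x y
      using rho_lower[of x y] psi_lip[of x y] by linarith
    show "\<bar>h x + \<psi> x - (h y + \<psi> y)\<bar> \<le> \<rho> x y" for x y
      using rho_lower[of x y] psi_lip[of x y] by linarith
    show "h x - \<psi> x \<le> h x + \<psi> x" for x using psi0[of x] by simp
    show "h x - \<psi> x \<le> h3 x \<and> h3 x \<le> h x + \<psi> x" if "x \<in> G j" for x
    proof -
      have "x \<in> K" using that GK by blast
      then show ?thesis using h3h[OF that] psiK[of x] by linarith
    qed
  next
    show "\<rho> x y = \<rho> y x" for x y by (rule sym)
    show "\<rho> x z \<le> \<rho> x y + \<rho> y z" for x y z by (rule tri)
    show "\<rho> x x = 0" for x by (rule refl)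
    show "\<bar>h3 x - h3 y\<bar> \<le> \<rho> x y" if "x \<in> G j" "y \<in> G j" for x y using that by (rule h3_rho)
    fix g assume "\<And>x y. \<bar>g x - g y\<bar> \<le> \<rho> x y" "\<And>x. h x - \<psi> x \<le> g x \<and> g x \<le> h x + \<psi> x"
      "\<And>x. x \<in> G j \<Longrightarrow> g x = h3 x"
    then show thesis by (rule that)
  qed
  show thesis
  proof (rule that[of "G j" g])
    have "g ` G j \<subseteq> (\<lambda>i. s * (real_of_int i + (real j + 1) / N)) ` I"
      using g(3) cell(1) by (force simp: h3_def)
    then show "finite (g ` G j)" by (rule finite_subset) (simp add: I_def)
    show "\<bar>g x - h x\<bar> \<le> \<eta>" for x using g(2)[of x] psi0[of x] eta' by linarith
  next
    fix x assume "\<And>y. y \<in> K \<Longrightarrow> \<sigma> \<le> dist x y"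
    then have "\<sigma> \<le> infdist x K" unfolding infdist_def using False by (simp add: cINF_greatest)
    then have "\<psi> x = 0" using sig by (simp add: \<psi>_def max_def)
    then show "g x = h x" using g(2)[of x] by simp
  next
    show "G j \<subseteq> K" "compact (G j)" "measure \<mu> (K - G j) \<le> measure \<mu> K / real N"
      by (fact GK cG j(2))+
    show "\<bar>g x - g y\<bar> \<le> \<rho> x y" for x y by (rule g(1))
  qed
qed

section \<open>Collapsing the normal components\<close>

text \<open>By Pythagoras the squared increment of the new map is \<open>q x y\<close> plus the
  squared increment of its component h', so the Lipschitz constant L + \<kappa> holds as soon as h'
  moves by at most \<open>c x y\<close>. As \<open>c\<close> may violate the triangle inequality, h'
  is built for the smaller \<open>\<rho>\<close>.\<close>

lemma collapse_direction:
  fixes f :: "'a::metric_space \<Rightarrow> 'b::real_inner"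
  assumes K: "compact K" and f: "L-lipschitz_on UNIV f" and e: "norm e = 1"
    and lam: "0 < \<kappa>" and N: "0 < N" and eps: "0 < \<epsilon>" "real N * \<epsilon> \<le> \<kappa>"
    and slow: "slow_on K (\<lambda>x. inner e (f x)) \<epsilon>" and eta: "0 < \<eta>" and sig: "0 < \<sigma>"
    and fin: "finite_measure \<mu>" and sets: "\<forall>A\<in>sets borel. A \<subseteq> K \<longrightarrow> A \<in> sets \<mu>"
  shows "\<exists>g K'. K' \<subseteq> K \<and> compact K' \<and> measure \<mu> (K - K') \<le> measure \<mu> K / N \<and>
    finite ((\<lambda>x. inner e (g x)) ` K') \<and> (L + \<kappa>)-lipschitz_on UNIV g \<and>
    (\<forall>x. \<exists>c. g x = f x + c *\<^sub>R e \<and> \<bar>c\<bar> \<le> \<eta>) \<and> (\<forall>x. (\<forall>y\<in>K. \<sigma> \<le> dist x y) \<longrightarrow> g x = f x)"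
proof -
  have L: "0 \<le> L" using f by (rule lipschitz_on_nonneg)
  define h where "h x = inner e (f x)" for x
  define q where "q x y = (norm (f x - f y))\<^sup>2 - (h x - h y)\<^sup>2" for x y
  have hd: "h x - h y = inner e (f x - f y)" for x y by (simp add: h_def inner_diff_right)
  have q0: "0 \<le> q x y" for x y
  proof -
    have "\<bar>h x - h y\<bar> \<le> norm (f x - f y)"
      unfolding hd using Cauchy_Schwarz_ineq2[of e "f x - f y"] e by simp
    then have "(h x - h y)\<^sup>2 \<le> (norm (f x - f y))\<^sup>2" by (simp add: abs_le_square_iff[symmetric])
    then show ?thesis by (simp add: q_def)
  qed
  have qL: "(h x - h y)\<^sup>2 + q x y \<le> (L * dist x y)\<^sup>2" for x y
  proof -
    have "norm (f x - f y) \<le> L * dist x y" using lipschitz_onD[OF f, of x y] by (simp add: dist_norm)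
    then show ?thesis by (simp add: q_def power_mono)
  qed
  \<comment> \<open>\<open>c x y\<close> is the largest increment of the component along \<open>e\<close> that, together with the
    unchanged components, respects the Lipschitz constant \<open>L + \<kappa>\<close>.\<close>
  define c where "c x y = sqrt (((L + \<kappa>) * dist x y)\<^sup>2 - q x y)" for x y
  have hL: "\<bar>h x - h y\<bar> \<le> L * dist x y" for x y
  proof -
    have "(h x - h y)\<^sup>2 \<le> (L * dist x y)\<^sup>2" using qL[of x y] q0[of x y] by linarith
    then show ?thesis using L by (simp add: abs_le_square_iff[symmetric])
  qed
  have c_lower: "\<bar>h x - h y\<bar> + \<kappa> * dist x y \<le> c x y" for x y
    unfolding c_def
  \<comment> \<open>Since h moves by at most L * dist x y, the cross term of the square on the left
    fits into the amount by which the squared bound for L + \<kappa> exceeds the one for L.\<close>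
  proof (rule real_le_rsqrt)
    have "\<bar>h x - h y\<bar> * (\<kappa> * dist x y) \<le> L * dist x y * (\<kappa> * dist x y)"
      using lam hL by (intro mult_right_mono) auto
    then show "(\<bar>h x - h y\<bar> + \<kappa> * dist x y)\<^sup>2 \<le> ((L + \<kappa>) * dist x y)\<^sup>2 - q x y"
      using qL[of x y] by (simp add: power2_eq_square algebra_simps)
  qed
  have c_nonneg: "0 \<le> c x y" for x y
    using c_lower[of x y] lam by (smt (verit) mult_nonneg_nonneg zero_le_dist)
  have c_upper: "c x y \<le> (L + \<kappa>) * dist x y" for x y
  proof -
    have "c x y \<le> sqrt (((L + \<kappa>) * dist x y)\<^sup>2)" unfolding c_def using q0 by (intro real_sqrt_le_mono) simp
    then show ?thesis using L lam by simp
  qed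
  have c_sym: "c x y = c y x" for x y
    by (simp add: c_def q_def dist_commute norm_minus_commute power2_commute)
  define \<rho> where "\<rho> = chain_dist UNIV c"
  have rho_c: "\<rho> x y \<le> c x y" for x y
    unfolding \<rho>_def by (rule chain_dist_le_cost[OF c_nonneg]) auto
  \<comment> \<open>The left side satisfies the triangle inequality, so the margin \<kappa> survives
    the passage from \<open>c\<close> to the smaller \<open>\<rho>\<close>.\<close>
  have rho_ge: "\<bar>h x - h y\<bar> + \<kappa> * dist x y \<le> \<rho> x y" for x y
    unfolding \<rho>_def
  proof (rule chain_dist_geI[OF c_nonneg])
    fix s assume "chain UNIV c x y s"
    then show "\<bar>h x - h y\<bar> + \<kappa> * dist x y \<le> s"
    proof (rule chain_lower[where q = "\<lambda>x y. \<bar>h x - h y\<bar> + \<kappa> * dist x y", rotated 3])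
      fix x y z :: 'a
      have "\<kappa> * dist x z \<le> \<kappa> * dist x y + \<kappa> * dist y z"
        using mult_left_mono[OF dist_triangle[of x z y], of \<kappa>] lam by (simp add: distrib_left)
      then show "\<bar>h x - h z\<bar> + \<kappa> * dist x z \<le> \<bar>h x - h y\<bar> + \<kappa> * dist x y + (\<bar>h y - h z\<bar> + \<kappa> * dist y z)"
        by linarith
    qed (simp_all add: c_lower)
  qed auto
  have slow': "slow_on K h \<epsilon>" using slow by (simp add: h_def[abs_def])
  obtain h' K' where h': "K' \<subseteq> K" "compact K'" "measure \<mu> (K - K') \<le> measure \<mu> K / N"
    "finite (h' ` K')" "\<And>x y. \<bar>h' x - h' y\<bar> \<le> \<rho> x y" "\<And>x. \<bar>h' x - h x\<bar> \<le> \<eta>"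
    "\<And>x. (\<And>y. y \<in> K \<Longrightarrow> \<sigma> \<le> dist x y) \<Longrightarrow> h' x = h x"
  proof (rule collapse_function[OF K _ _ _ _ lam rho_ge N eps slow' eta sig fin sets[rule_format]])
    show "\<rho> x y = \<rho> y x" for x y
      unfolding \<rho>_def by (rule chain_dist_commute) (rule c_sym)
    show "\<rho> x z \<le> \<rho> x y + \<rho> y z" for x y z
      unfolding \<rho>_def by (rule chain_dist_triangle[OF c_nonneg]) auto
    show "\<rho> x y \<le> (L + \<kappa>) * dist x y" for x y using rho_c[of x y] c_upper[of x y] by linarith
    show "0 \<le> L + \<kappa>" using L lam by simp
  qed auto
  define g where "g x = f x + (h' x - h x) *\<^sub>R e" for x
  have ee: "inner e e = 1" using e by (simp add: norm_eq_1)
  have expand: "(norm (v + t *\<^sub>R e))\<^sup>2 = (norm v)\<^sup>2 + 2 * t * inner e v + t\<^sup>2" for v t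
    unfolding power2_norm_eq_inner
    by (simp add: inner_add_left inner_add_right ee inner_commute[of v e] power2_eq_square algebra_simps)
  have eg: "inner e (g x) = h' x" for x
    by (simp add: g_def inner_add_right ee h_def)
  show ?thesis
  proof (intro exI[of _ g] exI[of _ K'] conjI allI impI)
    show "finite ((\<lambda>x. inner e (g x)) ` K')" using h'(4) by (simp add: eg)
    show "(L + \<kappa>)-lipschitz_on UNIV g"
    proof (rule lipschitz_onI)
      fix x y :: 'a
      define a where "a = h x - h y"
      define b where "b = h' x - h' y"
      have "g x - g y = (f x - f y) + (b - a) *\<^sub>R e"
        by (simp add: g_def a_def b_def algebra_simps)
      then have "(norm (g x - g y))\<^sup>2 = (norm (f x - f y))\<^sup>2 + 2 * (b - a) * a + (b - a)\<^sup>2"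
        using expand[of "f x - f y" "b - a"] hd[of x y] unfolding a_def by simp
      also have "\<dots> = q x y + b\<^sup>2" by (simp add: q_def a_def[symmetric] power2_eq_square algebra_simps)
      also have "b\<^sup>2 \<le> (c x y)\<^sup>2"
        using h'(5)[of x y] rho_c[of x y] c_nonneg[of x y] unfolding b_def[symmetric]
        by (simp add: abs_le_square_iff[symmetric])
      also have "(c x y)\<^sup>2 = ((L + \<kappa>) * dist x y)\<^sup>2 - q x y"
      proof -
        have "q x y \<le> (L * dist x y)\<^sup>2" using qL[of x y] by (smt (verit) zero_le_power2)
        also have "\<dots> \<le> ((L + \<kappa>) * dist x y)\<^sup>2" using L lam by (intro power_mono mult_right_mono) auto
        finally show ?thesis by (simp add: c_def)
      qed
      finally have "(norm (g x - g y))\<^sup>2 \<le> ((L + \<kappa>) * dist x y)\<^sup>2" by simp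
      then have "norm (g x - g y) \<le> (L + \<kappa>) * dist x y"
        by (rule power2_le_imp_le) (intro mult_nonneg_nonneg add_nonneg_nonneg L less_imp_le[OF lam] zero_le_dist)
      then show "dist (g x) (g y) \<le> (L + \<kappa>) * dist x y" by (simp only: dist_norm[of "g x" "g y"])
    next
      show "0 \<le> L + \<kappa>" using L lam by simp
    qed
    fix x
    show "\<exists>c. g x = f x + c *\<^sub>R e \<and> \<bar>c\<bar> \<le> \<eta>"
      by (rule exI[of _ "h' x - h x"]) (simp add: g_def h'(6))
    show "g x = f x" if far: "\<forall>y\<in>K. \<sigma> \<le> dist x y"
      using h'(7)[of x] far by (simp add: g_def)
  qed (fact h'(1-3))+
qed

text \<open>Each step moves the map along one direction orthogonal to the others, so finished
  components keep their finite range and, by the last clause, the components still to come keep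
  their slowness. Every direction adds \<kappa> to the Lipschitz constant and loses at most a
  fraction 1/N of the measure of K.\<close>

lemma collapse_directions:
  fixes f :: "'a::metric_space \<Rightarrow> 'b::real_inner"
  assumes E: "finite E" "pairwise orthogonal E" "\<forall>e\<in>E. norm e = 1"
    and K: "compact K" and f: "L-lipschitz_on UNIV f"
    and lam: "0 < \<kappa>" and N: "0 < N" and eps: "0 < \<epsilon>" "real N * \<epsilon> \<le> \<kappa>"
    and slow: "\<forall>e\<in>E. slow_on K (\<lambda>x. inner e (f x)) \<epsilon>" and eta: "0 < \<eta>" and sig: "0 < \<sigma>"
    and fin: "finite_measure \<mu>" and sets: "\<forall>A\<in>sets borel. A \<subseteq> K \<longrightarrow> A \<in> sets \<mu>"
  shows "\<exists>g K'. K' \<subseteq> K \<and> compact K' \<and> measure \<mu> (K - K') \<le> real (card E) * (measure \<mu> K / N) \<and>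
    (\<forall>e\<in>E. finite ((\<lambda>x. inner e (g x)) ` K')) \<and> (L + real (card E) * \<kappa>)-lipschitz_on UNIV g \<and>
    (\<forall>x. norm (g x - f x) \<le> real (card E) * \<eta>) \<and> (\<forall>x. (\<forall>y\<in>K. \<sigma> \<le> dist x y) \<longrightarrow> g x = f x) \<and>
    (\<forall>v. (\<forall>e\<in>E. inner v e = 0) \<longrightarrow> (\<forall>x. inner v (g x) = inner v (f x)))"
  using E slow
proof (induction E rule: finite_induct)
  case empty
  then show ?case using K f by (intro exI[of _ f] exI[of _ K]) auto
next
  case (insert e E)
  interpret finite_measure \<mu> by (rule fin)
  have p: "\<forall>e\<in>E. norm e = 1" "\<forall>e\<in>E. slow_on K (\<lambda>x. inner e (f x)) \<epsilon>"
    using insert.prems(2,3) by simp_all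
  have "pairwise orthogonal E" using insert.prems(1) by (rule pairwise_subset) auto
  from insert.IH[OF this p(1,2)] obtain g K' where g0: "K' \<subseteq> K" "compact K'" "measure \<mu> (K - K') \<le> real (card E) * (measure \<mu> K / N)"
    "\<forall>e\<in>E. finite ((\<lambda>x. inner e (g x)) ` K')" "(L + real (card E) * \<kappa>)-lipschitz_on UNIV g"
    "\<forall>x. norm (g x - f x) \<le> real (card E) * \<eta>" "\<forall>x. (\<forall>y\<in>K. \<sigma> \<le> dist x y) \<longrightarrow> g x = f x"
    "\<forall>v. (\<forall>e\<in>E. inner v e = 0) \<longrightarrow> (\<forall>x. inner v (g x) = inner v (f x))"
    by (elim exE conjE) (rule that)
  note g = g0(1-3) g0(4)[rule_format] g0(5) g0(6)[rule_format] g0(7)[THEN spec, THEN mp] g0(8)[THEN spec, THEN mp, THEN spec]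
  have orth: "inner e e' = 0" if "e' \<in> E" for e'
    using insert.prems(1) that insert.hyps by (auto simp: pairwise_insert orthogonal_def)
  have ne: "norm e = 1" using insert.prems(2) by simp
  have "inner e (g x) = inner e (f x)" for x using g(8) orth by blast
  then have slow': "slow_on K' (\<lambda>x. inner e (g x)) \<epsilon>"
    using slow_on_subset[OF insert.prems(3)[rule_format, OF insertI1] g(1)] by simp
  have sets': "\<forall>A\<in>sets borel. A \<subseteq> K' \<longrightarrow> A \<in> sets \<mu>" using sets g(1) by blast
  from collapse_direction[OF g(2,5) ne lam N eps slow' eta sig fin sets']
  obtain g' K'' where g0': "K'' \<subseteq> K'" "compact K''" "measure \<mu> (K' - K'') \<le> measure \<mu> K' / N"
    "finite ((\<lambda>x. inner e (g' x)) ` K'')" "(L + real (card E) * \<kappa> + \<kappa>)-lipschitz_on UNIV g'"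
    "\<forall>x. \<exists>c. g' x = g x + c *\<^sub>R e \<and> \<bar>c\<bar> \<le> \<eta>"
    "\<forall>x. (\<forall>y\<in>K'. \<sigma> \<le> dist x y) \<longrightarrow> g' x = g x"
    by (elim exE conjE) (rule that)
  note g' = g0'(1-5) g0'(6)[rule_format] g0'(7)[THEN spec, THEN mp]
  have card: "real (card (insert e E)) = card E + 1" using insert.hyps by simp
  have inner_g': "inner v (g' x) = inner v (g x)" if "inner v e = 0" for v x
  proof -
    obtain c where "g' x = g x + c *\<^sub>R e" using g'(6) by blast
    then show ?thesis using that by (simp add: inner_add_right)
  qed
  have KS: "K \<in> sets \<mu>" "K' \<in> sets \<mu>" "K'' \<in> sets \<mu>"
    using sets[rule_format, OF borel_closed[OF compact_imp_closed]] K g(1,2) g'(1,2) by blast+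
  show ?case
  proof (intro exI[of _ g'] exI[of _ K''] conjI ballI allI impI)
    show "K'' \<subseteq> K" "compact K''" using g g' by auto
    have "measure \<mu> (K - K'') = measure \<mu> ((K - K') \<union> (K' - K''))"
      using g(1) g'(1) by (intro arg_cong[of _ _ "measure \<mu>"]) auto
    also have "\<dots> \<le> measure \<mu> (K - K') + measure \<mu> (K' - K'')"
      using KS by (intro measure_Un_le) auto
    also have "\<dots> \<le> real (card E) * (measure \<mu> K / N) + measure \<mu> K / N"
    proof (rule add_mono[OF g(3)])
      have "measure \<mu> K' \<le> measure \<mu> K" using g(1) KS by (intro finite_measure_mono) auto
      then show "measure \<mu> (K' - K'') \<le> measure \<mu> K / N"
        using g'(3) divide_right_mono[of "measure \<mu> K'" "measure \<mu> K" "real N"] by linarith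
    qed
    finally show "measure \<mu> (K - K'') \<le> real (card (insert e E)) * (measure \<mu> K / N)"
      unfolding card by (simp add: distrib_right add_divide_distrib add.commute)
    show "(L + real (card (insert e E)) * \<kappa>)-lipschitz_on UNIV g'"
      unfolding card using g'(5) by (simp add: algebra_simps)
    fix x
    obtain c where c: "g' x = g x + c *\<^sub>R e" "\<bar>c\<bar> \<le> \<eta>" using g'(6) by blast
    have "norm (g' x - f x) \<le> norm (g x - f x) + norm (c *\<^sub>R e)"
      using norm_triangle_ineq[of "g x - f x" "c *\<^sub>R e"] by (simp add: c(1) algebra_simps)
    then show "norm (g' x - f x) \<le> real (card (insert e E)) * \<eta>"
      unfolding card using g(6)[of x] c(2) ne by (simp add: distrib_right)
    show "g' x = f x" if "\<forall>y\<in>K. \<sigma> \<le> dist x y"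
      using g(7)[OF that] g'(7)[of x] that g(1) by auto
  next
    fix v x assume v: "\<forall>e\<in>insert e E. inner v e = 0"
    then show "inner v (g' x) = inner v (f x)" using inner_g'[of v x] g(8)[of v x] by simp
  next
    fix a assume a: "a \<in> insert e E"
    show "finite ((\<lambda>x. inner a (g' x)) ` K'')"
    proof (cases "a = e")
      case False
      then have aE: "a \<in> E" using a by simp
      then have "inner a (g' x) = inner a (g x)" for x using inner_g' orth[OF aE] by (simp add: inner_commute)
      then have "(\<lambda>x. inner a (g' x)) ` K'' \<subseteq> (\<lambda>x. inner a (g x)) ` K'" using g'(1) by auto
      then show ?thesis using g(4)[OF aE] finite_subset by blast
    qed (use g'(4) in simp)
  qed
qed

section \<open>Hausdorff dimension and ball covers\<close>

text \<open>A finite form of Hausdorff content at a bounded scale. Finitely many open balls that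
  cover a compact image also cover the image under nearby maps, which makes the resulting condition
  on maps open.\<close>

definition ball_cover :: "real \<Rightarrow> real \<Rightarrow> 'b::metric_space set \<Rightarrow> bool"
  where "ball_cover s e A \<longleftrightarrow> (\<exists>P :: ('b \<times> real) list.
    (\<forall>p\<in>set P. 0 < snd p \<and> 2 * snd p \<le> e) \<and> A \<subseteq> (\<Union>p\<in>set P. ball (fst p) (snd p)) \<and>
    (\<Sum>p\<leftarrow>P. (2 * snd p) powr s) \<le> e)"

text \<open>The limsup set is covered by every tail of the covers. From some index on the exponents
  lie below t, and the tails of the geometric bounds tend to 0.\<close>

lemma hausdorff_null_of_ball_covers:
  fixes A :: "nat \<Rightarrow> 'b::metric_space set"
  assumes cover: "\<And>n. ball_cover (D + 1 / Suc n) ((1/2) ^ n) (A n)" and D: "0 \<le> D" and t: "D < t"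
  shows "hausdorff_measure t (\<Inter>m. \<Union>n\<in>{m..}. A n) = 0"
proof -
  let ?A = "\<Inter>m. \<Union>n\<in>{m..}. A n"
  have pre: "hausdorff_premeasure t \<delta> ?A \<le> ennreal e" if d: "0 < \<delta>" and e: "0 < e" for \<delta> e
  proof -
    obtain m1 where m1: "1 / real (Suc m1) < t - D" using nat_approx_posE[of "t - D"] t by auto
    \<comment> \<open>The bound 1 on the diameters makes their powers decrease in the exponent; e /
      2 is for the geometric tail 2 * (1/2) ^ M.\<close>
    have pos: "0 < min \<delta> (min 1 (e / 2))" using d e by simp
    then obtain m2 where m2: "(1/2) ^ m2 < min \<delta> (min 1 (e / 2))"
      using real_arch_pow_inv[of "min \<delta> (min 1 (e / 2))" "1/2"] by auto
    define M where "M = max m1 m2"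
    have "1 / real (Suc M) \<le> 1 / real (Suc m1)" by (simp add: M_def frac_le)
    then have M1: "1 / real (Suc M) < t - D" using m1 by linarith
    have "(1/2::real) ^ M \<le> (1/2) ^ m2" by (rule power_decreasing) (auto simp: M_def)
    then have M2: "(1/2) ^ M < min \<delta> (min 1 (e / 2))" using m2 by linarith
    define s where "s n = D + 1 / Suc (n + M)" for n
    have s: "s n \<le> t" for n
    proof -
      have "1 / real (Suc (n + M)) \<le> 1 / real (Suc M)" by (simp add: frac_le)
      then show ?thesis using M1 by (simp add: s_def)
    qed
    define Q where "Q n P \<longleftrightarrow> (\<forall>p\<in>set P. 0 < snd p \<and> 2 * snd p \<le> (1/2) ^ (n + M)) \<and>
      A (n + M) \<subseteq> (\<Union>p\<in>set P. ball (fst p) (snd p)) \<and> (\<Sum>p\<leftarrow>P. (2 * snd p) powr s n) \<le> (1/2) ^ (n + M)"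
      for n and P :: "('b \<times> real) list"
    define P where "P n = (SOME P. Q n P)" for n
    have "\<exists>P. Q n P" for n
      using cover[of "n + M"] unfolding ball_cover_def s_def Q_def .
    then have "Q n (P n)" for n unfolding P_def by (rule someI_ex)
    then have P: "\<And>n p. p \<in> set (P n) \<Longrightarrow> 0 < snd p \<and> 2 * snd p \<le> (1/2) ^ (n + M)"
      "\<And>n. A (n + M) \<subseteq> (\<Union>p\<in>set (P n). ball (fst p) (snd p))"
      "\<And>n. (\<Sum>p\<leftarrow>P n. (2 * snd p) powr s n) \<le> (1/2) ^ (n + M)" unfolding Q_def by blast+
    \<comment> \<open>The lists are padded with empty sets, for which \<open>diameter_power\<close>
      is 0, so that \<open>prod_decode\<close> can turn the double family into one sequence.\<close>
    define U where "U q = (if snd q < length (P (fst q)) then ball (fst (P (fst q) ! snd q)) (snd (P (fst q) ! snd q)) else {})" for q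
    define f where "f q = diameter_power t (U q)" for q
    have small: "2 * snd p \<le> \<delta>" "2 * snd p \<le> 1" "0 < snd p" if "p \<in> set (P n)" for p n
    proof -
      have "(1/2::real) ^ (n + M) \<le> (1/2) ^ M" by (rule power_decreasing) auto
      then show "2 * snd p \<le> \<delta>" "2 * snd p \<le> 1" "0 < snd p" using P(1)[OF that] M2 by linarith+
    qed
    have diam: "diameter (ball x r) \<le> 2 * r" if "0 < r" for x :: 'b and r
    proof -
      have "dist (fst q) (snd q) \<le> 2 * r" if "q \<in> ball x r \<times> ball x r" for q
        using that dist_triangle[of "fst q" "snd q" x] by (auto simp: dist_commute)
      then show ?thesis
        using that unfolding diameter_def by (auto intro!: cSUP_least)
    qed
    have row: "suminf (\<lambda>i. f (n, i)) \<le> ennreal ((1/2) ^ (n + M))" for n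
    proof -
      have "suminf (\<lambda>i. f (n, i)) = (\<Sum>i<length (P n). f (n, i))"
        by (rule suminf_finite) (auto simp: f_def U_def diameter_power_def)
      also have "\<dots> \<le> (\<Sum>i<length (P n). ennreal ((2 * snd (P n ! i)) powr s n))"
      proof (rule sum_mono)
        fix i assume "i \<in> {..<length (P n)}"
        then have i: "i < length (P n)" "P n ! i \<in> set (P n)" by auto
        let ?r = "snd (P n ! i)" and ?x = "fst (P n ! i)"
        note r = small[OF i(2)]
        have "f (n, i) = diameter_power t (ball ?x ?r)" using i by (simp add: f_def U_def)
        also have "\<dots> \<le> ennreal (diameter (ball ?x ?r) powr t)"
          using t D by (simp add: diameter_power_def)
        also have "\<dots> \<le> ennreal ((2 * ?r) powr t)"
          using diam[OF r(3)] t D by (intro ennreal_leI powr_mono2) (auto intro: diameter_ge_0)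
        also have "\<dots> \<le> ennreal ((2 * ?r) powr s n)"
          using r s[of n] by (intro ennreal_leI powr_mono') auto
        finally show "f (n, i) \<le> ennreal ((2 * ?r) powr s n)" .
      qed
      also have "\<dots> = ennreal (\<Sum>i<length (P n). (2 * snd (P n ! i)) powr s n)"
        by (intro sum_ennreal) auto
      also have "(\<Sum>i<length (P n). (2 * snd (P n ! i)) powr s n) = (\<Sum>p\<leftarrow>P n. (2 * snd p) powr s n)"
        by (simp add: sum_list_sum_nth atLeast0LessThan)
      also have "ennreal \<dots> \<le> ennreal ((1/2) ^ (n + M))" by (intro ennreal_leI P(3))
      finally show ?thesis .
    qed
    have half: "(\<lambda>n. (1/2) ^ (n + M)) sums (2 * (1/2) ^ M :: real)"
      using sums_mult2[OF geometric_sums[of "1/2::real"], of "(1/2) ^ M"] by (simp add: power_add)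
    have "hausdorff_premeasure t \<delta> ?A \<le> suminf (\<lambda>i. diameter_power t (U (prod_decode i)))"
      unfolding hausdorff_premeasure_def
    proof (rule INF_lower, intro CollectI conjI allI)
      show "?A \<subseteq> (\<Union>i. U (prod_decode i))"
      proof
        fix x assume "x \<in> ?A"
        then obtain k where "M \<le> k" "x \<in> A k" by auto
        then have "x \<in> A ((k - M) + M)" by simp
        then obtain p where p: "p \<in> set (P (k - M))" "x \<in> ball (fst p) (snd p)" using P(2) by blast
        then obtain i where "i < length (P (k - M))" "P (k - M) ! i = p" by (auto simp: in_set_conv_nth)
        then have "x \<in> U (k - M, i)" using p(2) by (simp add: U_def)
        then have "x \<in> U (prod_decode (prod_encode (k - M, i)))" by simp
        then show "x \<in> (\<Union>i. U (prod_decode i))" by blast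
      qed
      fix i
      show "bounded (U (prod_decode i))" by (simp add: U_def)
      show "diameter (U (prod_decode i)) \<le> \<delta>"
      proof (cases "snd (prod_decode i) < length (P (fst (prod_decode i)))")
        case True
        then have "P (fst (prod_decode i)) ! snd (prod_decode i) \<in> set (P (fst (prod_decode i)))" by simp
        from small[OF this] diam[OF small(3)[OF this]] show ?thesis
          using True by (auto simp: U_def intro: order_trans)
      qed (use d in \<open>simp add: U_def\<close>)
    qed
    also have "\<dots> = suminf (\<lambda>n. suminf (\<lambda>i. f (n, i)))"
      unfolding f_def[symmetric] by (rule suminf_ennreal_2dimen) (rule refl)
    also have "\<dots> \<le> suminf (\<lambda>n. ennreal ((1/2) ^ (n + M)))"
      by (intro suminf_le row) auto
    also have "\<dots> = ennreal (2 * (1/2) ^ M)" by (rule suminf_ennreal_eq[OF _ half]) simp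
    also have "\<dots> \<le> ennreal e" using M2 by (intro ennreal_leI) simp
    finally show ?thesis .
  qed
  have "hausdorff_premeasure t \<delta> ?A = 0" if "0 < \<delta>" for \<delta>
  proof -
    have "hausdorff_premeasure t \<delta> ?A \<le> 0"
      by (rule ennreal_le_epsilon) (use pre[OF that] in simp)
    then show ?thesis by simp
  qed
  then show ?thesis unfolding hausdorff_measure_def by simp
qed

lemma hausdorff_measure_mono: "A \<subseteq> B \<Longrightarrow> hausdorff_measure t A \<le> hausdorff_measure t B"
  unfolding hausdorff_measure_def hausdorff_premeasure_def
  by (intro SUP_mono' INF_superset_mono) auto

lemma hausdorff_dim_leI:
  assumes D: "0 \<le> D" and null: "\<And>t. D < t \<Longrightarrow> hausdorff_measure t A = 0"
  shows "hausdorff_dim A \<le> ennreal D"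
proof (rule ennreal_le_epsilon)
  fix e :: real assume e: "0 < e"
  have "hausdorff_dim A \<le> ennreal (D + e)"
    unfolding hausdorff_dim_def using D e null[of "D + e"] by (intro INF_lower) auto
  then show "hausdorff_dim A \<le> ennreal D + ennreal e" using D e by (simp add: ennreal_plus)
qed

text \<open>Box counting: with finitely many values of the E-coordinates, A meets at most a constant
  times M^d cells of mesh 1/M in the remaining coordinates. Balls of radius of order 1/M then give a
  sum of order M^(d - s), which tends to 0.\<close>

lemma slices_ball_cover:
  fixes A :: "'b::euclidean_space set"
  assumes E: "finite E" and B: "finite B" "card B \<le> d"
    and orth: "pairwise orthogonal (E \<union> B)" and unit: "\<And>b. b \<in> E \<union> B \<Longrightarrow> norm b = 1"
    and span: "span (E \<union> B) = UNIV"
    and bdd: "bounded A" and slices: "\<And>e. e \<in> E \<Longrightarrow> finite ((\<lambda>z. inner e z) ` A)"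
    and s: "real d < s" and e: "0 < \<epsilon>"
  shows "ball_cover s \<epsilon> A"
proof -
  obtain R where R: "0 < R" "\<And>z. z \<in> A \<Longrightarrow> norm z \<le> R" using bdd unfolding bounded_pos by blast
  define Z where "Z = PiE E (\<lambda>e. (\<lambda>z. inner e z) ` A)"
  have Z: "finite Z" unfolding Z_def using E slices by (intro finite_PiE) auto
  \<comment> \<open>The part of the final bound that is independent of M: a bound for the number of
    slices, the cell count M * (2 * R + 3) per coordinate without its factor M, and the numerator of
    the diameter 2 * r.\<close>
  define c where "c = real (card Z) * (2 * R + 3) ^ d * (2 * (real d + 1)) powr s"
  have c: "0 \<le> c" using R by (simp add: c_def)
  have "((\<lambda>x::real. c * x powr (- (s - real d))) \<longlongrightarrow> 0) at_top"
    using s by (intro tendsto_mult_right_zero tendsto_neg_powr filterlim_ident) auto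
  then have "\<forall>\<^sub>F x in at_top. c * x powr (- (s - real d)) < \<epsilon>" using e by (rule order_tendstoD)
  moreover have "\<forall>\<^sub>F x::real in at_top. max 1 (2 * (real d + 1) / \<epsilon>) \<le> x" by (rule eventually_ge_at_top)
  ultimately have "\<forall>\<^sub>F x in at_top. c * x powr (- (s - real d)) < \<epsilon> \<and> max 1 (2 * (real d + 1) / \<epsilon>) \<le> x"
    by eventually_elim simp
  then obtain M where M: "c * M powr (- (s - real d)) < \<epsilon>" "1 \<le> M" "2 * (real d + 1) / \<epsilon> \<le> M"
    using eventually_happens'[OF trivial_limit_at_top_linorder] by fastforce
  \<comment> \<open>Points with equal keys differ by at most 1/M in at most d coordinates. The extra
    1 gives the strict inequality for open balls and a positive radius when d = 0.\<close>
  define r where "r = (real d + 1) / M"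
  have r: "0 < r" "2 * r \<le> \<epsilon>" using M e by (auto simp: r_def field_simps)
  define W where "W = {- \<lceil>M * R\<rceil> .. \<lceil>M * R\<rceil>}"
  define key where "key z = (restrict (\<lambda>e. inner e z) E, restrict (\<lambda>b. \<lfloor>M * inner b z\<rfloor>) B)" for z
  have MR: "0 \<le> M * R" using R M by simp
  have Wb: "\<lfloor>M * inner b z\<rfloor> \<in> W" if "z \<in> A" "b \<in> B" for z b
  proof -
    have "\<bar>inner b z\<bar> \<le> R"
      using Cauchy_Schwarz_ineq2[of b z] unit[of b] that R(2)[of z] by simp
    then have "M * \<bar>inner b z\<bar> \<le> M * R" using M by (intro mult_left_mono) auto
    then have "\<bar>M * inner b z\<bar> \<le> M * R" using M by (simp add: abs_mult)
    then have "- (M * R) \<le> M * inner b z" "M * inner b z \<le> M * R" by linarith+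
    then show ?thesis unfolding W_def by (simp add: le_floor_iff floor_le_iff) linarith
  qed
  have keyA: "key ` A \<subseteq> Z \<times> PiE B (\<lambda>_. W)"
    using Wb by (auto simp: key_def Z_def)
  have fin: "finite (Z \<times> PiE B (\<lambda>_. W))" using Z B(1) by (auto simp: W_def intro!: finite_PiE)
  have "card (key ` A) \<le> card Z * card W ^ card B"
    using card_mono[OF fin keyA] B(1) by (simp add: card_cartesian_product card_PiE)
  also have "\<dots> \<le> card Z * card W ^ d"
  proof -
    have "0 \<in> W" using MR by (simp add: W_def)
    then have "1 \<le> card W" using card_gt_0_iff[of W] by (auto simp: W_def Suc_le_eq)
    then show ?thesis using B(2) by (intro mult_left_mono power_increasing) auto
  qed
  finally have cardk: "card (key ` A) \<le> card Z * card W ^ d" .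
  have cW: "real (card W) \<le> M * (2 * R + 3)"
  proof -
    have "0 \<le> \<lceil>M * R\<rceil>" using MR by simp
    then have "real (card W) = 2 * \<lceil>M * R\<rceil> + 1" by (simp add: W_def)
    also have "\<dots> = 2 * real_of_int \<lceil>M * R\<rceil> + 1" by simp
    also have "\<dots> \<le> 2 * (M * R + 1) + 1" by (intro add_right_mono mult_left_mono of_int_ceiling_le_add_one) simp
    also have "\<dots> \<le> M * (2 * R + 3)" using M(2) by (simp add: algebra_simps)
    finally show ?thesis .
  qed
  have count: "real (card (key ` A)) * (2 * r) powr s \<le> \<epsilon>"
  proof -
    have "real (card (key ` A)) \<le> real (card Z * card W ^ d)" using cardk by (rule of_nat_mono)
    also have "\<dots> = real (card Z) * real (card W) ^ d" by simp
    also have "\<dots> \<le> real (card Z) * (M * (2 * R + 3)) ^ d" using cW by (intro mult_left_mono power_mono) auto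
    finally have 1: "real (card (key ` A)) \<le> real (card Z) * (M * (2 * R + 3)) ^ d" .
    have 2: "(2 * r) powr s = (2 * (real d + 1)) powr s * M powr (- s)"
    proof -
      have "2 * r = 2 * (real d + 1) / M" by (simp add: r_def)
      then have "(2 * r) powr s = (2 * (real d + 1)) powr s / M powr s" using M by (simp only: powr_divide)
      then show ?thesis by (simp add: powr_minus divide_inverse)
    qed
    have 3: "M ^ d * M powr (- s) = M powr (- (s - real d))"
      using M by (simp add: powr_realpow[symmetric] powr_add[symmetric])
    have "real (card (key ` A)) * (2 * r) powr s \<le> real (card Z) * (M * (2 * R + 3)) ^ d * (2 * r) powr s"
      using 1 by (rule mult_right_mono) simp
    also have "\<dots> = c * (M ^ d * M powr (- s))"
      unfolding 2 by (simp add: c_def power_mult_distrib)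
    also have "\<dots> = c * M powr (- (s - real d))" unfolding 3 ..
    finally show ?thesis using M(1) by linarith
  qed
  have close: "dist z z' < r" if zz: "z \<in> A" "z' \<in> A" "key z = key z'" for z z'
  proof -
    have eqE: "inner b (z - z') = 0" if "b \<in> E" for b
    proof -
      have "restrict (\<lambda>e. inner e z) E b = restrict (\<lambda>e. inner e z') E b" using zz(3) by (simp add: key_def)
      then show ?thesis using that by (simp add: inner_diff_right)
    qed
    have leB: "\<bar>inner b (z - z')\<bar> \<le> 1 / M" if "b \<in> B" for b
    proof -
      have "restrict (\<lambda>b. \<lfloor>M * inner b z\<rfloor>) B b = restrict (\<lambda>b. \<lfloor>M * inner b z'\<rfloor>) B b"
        using zz(3) by (simp add: key_def)
      then have "\<lfloor>M * inner b z\<rfloor> = \<lfloor>M * inner b z'\<rfloor>" using that by simp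
      then have "\<bar>M * inner b z - M * inner b z'\<bar> \<le> 1" by linarith
      then have "M * \<bar>inner b (z - z')\<bar> \<le> 1" using M by (simp add: inner_diff_right abs_mult flip: right_diff_distrib)
      then show ?thesis using M by (simp add: field_simps)
    qed
    have "z - z' = (\<Sum>b\<in>E \<union> B. inner (z - z') b *\<^sub>R b)"
      using orthonormal_basis_expand[of "E \<union> B" "z - z'"] orth unit span E B(1) by auto
    then have "norm (z - z') \<le> (\<Sum>b\<in>E \<union> B. norm (inner (z - z') b *\<^sub>R b))" using norm_sum by metis
    also have "\<dots> = (\<Sum>b\<in>E \<union> B. \<bar>inner b (z - z')\<bar>)"
      using unit by (intro sum.cong) (auto simp: inner_commute)
    also have "\<dots> = (\<Sum>b\<in>B - E. \<bar>inner b (z - z')\<bar>)"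
      using E B(1) eqE by (intro sum.mono_neutral_right) auto
    also have "\<dots> \<le> (\<Sum>b\<in>B - E. 1 / M)" using leB by (intro sum_mono) auto
    also have "\<dots> = card (B - E) / M" by simp
    also have "\<dots> \<le> real d / M"
      using M B card_mono[OF B(1), of "B - E"] by (intro divide_right_mono) auto
    also have "\<dots> < r" using M by (simp add: r_def divide_strict_right_mono)
    finally show ?thesis by (simp add: dist_norm)
  qed
  define rep where "rep = inv_into A key"
  have finK: "finite (key ` A)" using fin keyA finite_subset by blast
  then obtain ks where ks: "set ks = key ` A" "distinct ks" using finite_distinct_list by blast
  show ?thesis
    unfolding ball_cover_def
  proof (intro exI[of _ "map (\<lambda>k. (rep k, r)) ks"] conjI ballI)
    show "0 < snd p" "2 * snd p \<le> \<epsilon>" if "p \<in> set (map (\<lambda>k. (rep k, r)) ks)" for p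
      using that r by auto
    show "A \<subseteq> (\<Union>p\<in>set (map (\<lambda>k. (rep k, r)) ks). ball (fst p) (snd p))"
    proof
      fix z assume z: "z \<in> A"
      then have k: "key z \<in> key ` A" by simp
      have "rep (key z) \<in> A" "key (rep (key z)) = key z"
        unfolding rep_def using k by (auto intro: inv_into_into f_inv_into_f)
      then have "z \<in> ball (rep (key z)) r" using close[of "rep (key z)" z] z by simp
      then show "z \<in> (\<Union>p\<in>set (map (\<lambda>k. (rep k, r)) ks). ball (fst p) (snd p))"
        using k ks(1) by (intro UN_I[of "(rep (key z), r)"]) auto
    qed
    have "(\<Sum>p\<leftarrow>map (\<lambda>k. (rep k, r)) ks. (2 * snd p) powr s) = real (length ks) * (2 * r) powr s"
      by (simp add: o_def sum_list_triv)
    also have "length ks = card (key ` A)" using ks distinct_card by metis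
    finally show "(\<Sum>p\<leftarrow>map (\<lambda>k. (rep k, r)) ks. (2 * snd p) powr s) \<le> \<epsilon>" using count by simp
  qed
qed

section \<open>Tightness\<close>

text \<open>The sets with such a sandwich form a sigma-algebra. An open set belongs to it as the
  increasing union of the closed sets of points at distance at least 1 / Suc n from its
  complement.\<close>

lemma finite_borel_closed_open_approx:
  fixes \<nu> :: "'a::metric_space measure"
  assumes fin: "finite_measure \<nu>" and sets: "sets \<nu> = sets borel" and B: "B \<in> sets borel" and e: "0 < e"
  shows "\<exists>F G. closed F \<and> open G \<and> F \<subseteq> B \<and> B \<subseteq> G \<and> measure \<nu> (G - F) < e"
proof -
  interpret finite_measure \<nu> by (rule fin)
  have meas: "closed A \<Longrightarrow> A \<in> sets \<nu>" "open A \<Longrightarrow> A \<in> sets \<nu>" for A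
    by (simp_all add: sets)
  have "B \<in> sigma_sets UNIV {G :: 'a set. open G}" using B by (simp add: borel_def)
  then show ?thesis using e
  proof (induction arbitrary: e rule: sigma_sets.induct)
    case (Basic G)
    then have G: "open G" by simp
    show ?case
    proof (cases "G = UNIV")
      \<comment> \<open>Here the complement is empty and \<open>infdist\<close> to the empty set is
        0, so the sets F n of the other case would be empty.\<close>
      case True
      then show ?thesis using Basic by (intro exI[of _ UNIV]) auto
    next
      case False
      define F where "F n = {x. 1 / Suc n \<le> infdist x (- G)}" for n
      have cF: "closed (F n)" for n
        unfolding F_def by (intro closed_Collect_le continuous_intros)
      have inc: "incseq F"
      proof (rule incseq_SucI)
        fix n
        have "1 / real (Suc (Suc n)) \<le> 1 / Suc n" by (simp add: frac_le)
        then show "F n \<subseteq> F (Suc n)" unfolding F_def by (auto intro: order_trans)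
      qed
      have un: "(\<Union>n. F n) = G"
      proof
        show "(\<Union>n. F n) \<subseteq> G"
        proof
          fix x assume "x \<in> (\<Union>n. F n)"
          then obtain n where n: "1 / real (Suc n) \<le> infdist x (- G)" by (auto simp: F_def)
          have "0 < 1 / real (Suc n)" by simp
          then have "0 < infdist x (- G)" using n by linarith
          then show "x \<in> G" by (metis ComplI infdist_zero less_irrefl)
        qed
        show "G \<subseteq> (\<Union>n. F n)"
        proof
          fix x assume x: "x \<in> G"
          have "closed (- G)" "- G \<noteq> {}" using G False by auto
          then have "0 < infdist x (- G)" using x by (simp add: infdist_pos_not_in_closed)
          then obtain n where "1 / real (Suc n) < infdist x (- G)" using nat_approx_posE by blast
          then show "x \<in> (\<Union>n. F n)" by (auto simp: F_def intro: less_imp_le)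
        qed
      qed
      have "(\<lambda>n. measure \<nu> (F n)) \<longlonglongrightarrow> measure \<nu> G"
        using finite_Lim_measure_incseq[of F] inc meas(1)[OF cF] un by auto
      then have "\<forall>\<^sub>F n in sequentially. measure \<nu> G - e < measure \<nu> (F n)"
        using Basic.prems by (intro order_tendstoD) auto
      then obtain n where n: "measure \<nu> G - e < measure \<nu> (F n)"
        using eventually_happens'[OF sequentially_bot] by blast
      have "F n \<subseteq> G" using un by blast
      moreover from this have "measure \<nu> (G - F n) = measure \<nu> G - measure \<nu> (F n)"
        using meas(1)[OF cF] meas(2)[OF G] by (intro finite_measure_Diff) auto
      ultimately show ?thesis using n cF G by (intro exI[of _ "F n"] exI[of _ G]) auto
    qed
  next
    case Empty
    then show ?case by (intro exI[of _ "{}"]) auto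
  next
    case (Compl A)
    then obtain F G where FG: "closed F" "open G" "F \<subseteq> A" "A \<subseteq> G" "measure \<nu> (G - F) < e"
      using Compl.IH[OF Compl.prems] by (elim exE conjE)
    have "- F - - G = G - F" by auto
    then show ?case using FG by (intro exI[of _ "- G"] exI[of _ "- F"]) (auto simp: Compl_eq_Diff_UNIV)
  next
    case (Union A)
    define a where "a n = e / 2 * (1/2) ^ Suc n" for n
    have a: "0 < a n" for n using Union.prems by (simp add: a_def)
    have "\<exists>F G. closed F \<and> open G \<and> F \<subseteq> A n \<and> A n \<subseteq> G \<and> measure \<nu> (G - F) < a n" for n
      using Union.IH[OF a] .
    then obtain F G where FG: "\<And>n. closed (F n)" "\<And>n. open (G n)" "\<And>n. F n \<subseteq> A n" "\<And>n. A n \<subseteq> G n"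
      "\<And>n. measure \<nu> (G n - F n) < a n" by metis
    have asum: "a sums (e / 2)"
      using sums_mult[OF power_half_series, of "e / 2"] by (simp only: a_def[abs_def] mult_1_right)
    have mGF: "G n - F n \<in> sets \<nu>" for n using FG meas by (meson sets.Diff)
    have summ: "summable (\<lambda>n. measure \<nu> (G n - F n))"
      by (rule summable_comparison_test[OF _ sums_summable[OF asum]]) (use FG(5) in \<open>auto intro!: less_imp_le\<close>)
    \<comment> \<open>The union of all F n need not be closed. A finite partial union is, at the
      price of the second half of e.\<close>
    define H where "H n = (\<Union>i\<le>n. F i)" for n
    have cH: "closed (H n)" for n unfolding H_def using FG(1) by (intro closed_UN) auto
    have incH: "incseq H" unfolding H_def by (rule incseq_SucI) (auto simp: atMost_Suc)
    have unH: "(\<Union>n. H n) = (\<Union>n. F n)" unfolding H_def by auto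
    have "measure \<nu> ((\<Union>n. G n) - (\<Union>n. F n)) \<le> measure \<nu> (\<Union>n. G n - F n)"
      using mGF by (intro finite_measure_mono) auto
    also have "\<dots> \<le> suminf (\<lambda>n. measure \<nu> (G n - F n))"
      using mGF summ by (intro finite_measure_subadditive_countably) auto
    also have "\<dots> \<le> suminf a"
      using summ sums_summable[OF asum] FG(5) by (intro suminf_le) (auto intro: less_imp_le)
    also have "suminf a = e / 2" using asum by (rule sums_unique[symmetric])
    finally have 1: "measure \<nu> ((\<Union>n. G n) - (\<Union>n. F n)) \<le> e / 2" .
    have "(\<lambda>n. measure \<nu> (H n)) \<longlonglongrightarrow> measure \<nu> (\<Union>n. F n)"
      using finite_Lim_measure_incseq[of H] incH meas(1)[OF cH] unH by auto
    then have "\<forall>\<^sub>F n in sequentially. measure \<nu> (\<Union>n. F n) - e / 2 < measure \<nu> (H n)"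
      using Union.prems by (intro order_tendstoD) auto
    then obtain n where n: "measure \<nu> (\<Union>n. F n) - e / 2 < measure \<nu> (H n)"
      using eventually_happens'[OF sequentially_bot] by blast
    have mF: "(\<Union>n. F n) \<in> sets \<nu>" using FG(1) meas by blast
    have mG: "(\<Union>n. G n) \<in> sets \<nu>" using FG(2) meas by blast
    have sub: "H n \<subseteq> (\<Union>n. F n)" unfolding H_def by auto
    have FGs: "(\<Union>n. F n) \<subseteq> (\<Union>n. G n)" using FG(3,4) by blast
    have "measure \<nu> ((\<Union>n. G n) - H n) = measure \<nu> (\<Union>n. G n) - measure \<nu> (H n)"
      using sub FGs meas(1)[OF cH] mG by (intro finite_measure_Diff) auto
    moreover have "measure \<nu> ((\<Union>n. G n) - (\<Union>n. F n)) = measure \<nu> (\<Union>n. G n) - measure \<nu> (\<Union>n. F n)"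
      using FGs mF mG by (intro finite_measure_Diff) auto
    ultimately have "measure \<nu> ((\<Union>n. G n) - H n) < e" using 1 n by linarith
    moreover have "H n \<subseteq> (\<Union>n. A n)" "(\<Union>n. A n) \<subseteq> (\<Union>n. G n)" by (use sub FG(3) in blast, use FG(4) in blast)
    ultimately show ?case using cH[of n] FG(2) by (intro exI[of _ "H n"] exI[of _ "\<Union>n. G n"]) auto
  qed
qed

text \<open>Ulam's tightness argument: separability of S yields totally bounded closed sets of
  nearly full measure, and completeness of the space makes them compact.\<close>

lemma compact_approx:
  fixes S :: "'a::complete_space set"
  assumes S: "S \<in> sets borel" and sep: "separable_space (top_of_set S)"
    and fin: "finite_measure \<mu>" and sets: "sets \<mu> = sets (restrict_space borel S)"
    and A: "A \<in> sets \<mu>" and e: "0 < e"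
  shows "\<exists>K. compact K \<and> K \<subseteq> A \<and> measure \<mu> (A - K) < e"
proof -
  interpret finite_measure \<mu> by (rule fin)
  have space: "space \<mu> = S" using sets_eq_imp_space_eq[OF sets] S by (simp add: space_restrict_space)
  \<comment> \<open>The measure is moved to the whole space, where closed sets are complete; S
    itself may be neither closed nor complete.\<close>
  define \<nu> where "\<nu> = distr \<mu> borel (\<lambda>x. x)"
  have id: "(\<lambda>x. x) \<in> \<mu> \<rightarrow>\<^sub>M borel"
  proof -
    have "(\<lambda>x. x) \<in> restrict_space borel S \<rightarrow>\<^sub>M borel" by (intro measurable_restrict_space1) auto
    then show ?thesis using measurable_cong_sets[OF sets refl] by blast
  qed
  interpret N: finite_measure \<nu> unfolding \<nu>_def using id by (rule finite_measure_distr)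
  have setsN: "sets \<nu> = sets borel" by (simp add: \<nu>_def)
  have N: "measure \<nu> B = measure \<mu> (B \<inter> S)" if "B \<in> sets borel" for B
    unfolding \<nu>_def using id that by (simp add: measure_distr space)
  obtain C where C: "countable C" "C \<subseteq> S" "S \<subseteq> closure C"
    using sep unfolding separable_space_def
    by (auto simp: closure_of_subtopology_subset closure_of_subtopology Int_absorb1)
  have AS: "A \<subseteq> S" using A sets.sets_into_space space by blast
  have Ab: "A \<in> sets borel" using A S unfolding sets by (auto simp: sets_restrict_space)
  show ?thesis
  proof (cases "C = {}")
    case True
    then have "A = {}" using AS C by auto
    then show ?thesis using e by (intro exI[of _ "{}"]) auto
  next
    case False
    define c where "c = from_nat_into C"
    have rc: "range c = C" unfolding c_def using False C(1) by (rule range_from_nat_into)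
    define U where "U n k = (\<Union>i\<le>k. cball (c i) (1 / Suc n))" for n k
    have cU: "closed (U n k)" for n k unfolding U_def by (intro closed_UN) auto
    have "\<exists>k. measure \<nu> (- U n k) < e / 2 * (1/2) ^ Suc n" for n
    proof -
      have inc: "incseq (U n)" unfolding U_def by (rule incseq_SucI) (auto simp: atMost_Suc)
      have "S \<subseteq> (\<Union>k. U n k)"
      proof
        fix x assume "x \<in> S"
        then have "x \<in> closure C" using C by blast
        then obtain y where "y \<in> C" "dist y x < 1 / Suc n"
          unfolding closure_approachable by (metis of_nat_0_less_iff zero_less_Suc zero_less_divide_1_iff)
        moreover from this obtain i where "y = c i" using rc by auto
        ultimately have "x \<in> U n i" unfolding U_def by (auto intro: less_imp_le)
        then show "x \<in> (\<Union>k. U n k)" by blast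
      qed
      then have "- (\<Union>k. U n k) \<inter> S = {}" by blast
      moreover have Ub: "(\<Union>k. U n k) \<in> sets borel" using cU by (intro sets.countable_UN) auto
      ultimately have 0: "measure \<nu> (- (\<Union>k. U n k)) = 0" by (subst N[OF borel_comp[OF Ub]]) simp
      have mU: "range (U n) \<subseteq> sets \<nu>" using cU setsN by auto
      have "(\<lambda>k. measure \<nu> (U n k)) \<longlonglongrightarrow> measure \<nu> (\<Union>k. U n k)"
        by (rule N.finite_Lim_measure_incseq[OF mU inc])
      then have "\<forall>\<^sub>F k in sequentially. measure \<nu> (\<Union>k. U n k) - e / 2 * (1/2) ^ Suc n < measure \<nu> (U n k)"
        using e by (intro order_tendstoD) auto
      then obtain k where k: "measure \<nu> (\<Union>k. U n k) - e / 2 * (1/2) ^ Suc n < measure \<nu> (U n k)"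
        using eventually_happens'[OF sequentially_bot] by blast
      have sp: "space \<nu> = UNIV" by (simp add: \<nu>_def)
      have "measure \<nu> (- U n k) = measure \<nu> UNIV - measure \<nu> (U n k)"
        using N.finite_measure_compl[of "U n k"] mU sp by (auto simp: Compl_eq_Diff_UNIV)
      moreover have "measure \<nu> (- (\<Union>k. U n k)) = measure \<nu> UNIV - measure \<nu> (\<Union>k. U n k)"
        using N.finite_measure_compl[of "\<Union>k. U n k"] Ub setsN sp by (auto simp: Compl_eq_Diff_UNIV)
      ultimately show ?thesis using k 0 by (intro exI[of _ k]) linarith
    qed
    then obtain k where k: "\<And>n. measure \<nu> (- U n (k n)) < e / 2 * (1/2) ^ Suc n" by metis
    define T where "T = (\<Inter>n. U n (k n))"
    have cT: "closed T" unfolding T_def using cU by auto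
    have mT: "- U n (k n) \<in> sets \<nu>" for n using cU setsN by (auto intro: borel_comp)
    have asum: "(\<lambda>n. e / 2 * (1/2) ^ Suc n) sums (e / 2)"
      using sums_mult[OF power_half_series, of "e / 2"] by (simp only: mult_1_right)
    have summ: "summable (\<lambda>n. measure \<nu> (- U n (k n)))"
      by (rule summable_comparison_test[OF _ sums_summable[OF asum]]) (use k in \<open>auto intro!: less_imp_le simp del: power_Suc\<close>)
    have "measure \<nu> (- T) = measure \<nu> (\<Union>n. - U n (k n))" by (simp add: T_def)
    also have "\<dots> \<le> suminf (\<lambda>n. measure \<nu> (- U n (k n)))"
      using mT summ by (intro N.finite_measure_subadditive_countably) auto
    also have "\<dots> \<le> suminf (\<lambda>n. e / 2 * (1/2) ^ Suc n)"
      using summ sums_summable[OF asum] less_imp_le[OF k] by (intro suminf_le)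
    also have "\<dots> = e / 2" using asum by (rule sums_unique[symmetric])
    finally have T: "measure \<nu> (- T) \<le> e / 2" .
    obtain F G where F: "closed F" "open G" "F \<subseteq> A" "A \<subseteq> G" "measure \<nu> (G - F) < e / 2"
      using finite_borel_closed_open_approx[OF N.finite_measure_axioms setsN Ab, of "e / 2"] e by auto
    have "compact (F \<inter> T)"
      unfolding compact_eq_totally_bounded
    proof (intro conjI allI impI)
      show "complete (F \<inter> T)" using F(1) cT by (simp add: complete_eq_closed closed_Int)
      fix r :: real assume "0 < r"
      then obtain n where n: "1 / real (Suc n) < r" using nat_approx_posE by blast
      have "F \<inter> T \<subseteq> U n (k n)" unfolding T_def by blast
      also have "\<dots> \<subseteq> (\<Union>x\<in>c ` {..k n}. ball x r)" unfolding U_def using n by (auto intro: le_less_trans)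
      finally show "\<exists>K. finite K \<and> F \<inter> T \<subseteq> (\<Union>x\<in>K. ball x r)" by (intro exI[of _ "c ` {..k n}"]) auto
    qed
    moreover have "measure \<mu> (A - F \<inter> T) < e"
    proof -
      have bF: "F \<in> sets borel" "G \<in> sets borel" "T \<in> sets borel" using F cT by auto
      have "measure \<mu> (A - F \<inter> T) = measure \<nu> (A - F \<inter> T)"
        using N[of "A - F \<inter> T"] Ab bF AS by (simp add: Int_absorb2 Diff_subset_conv le_supI2)
      also have "\<dots> \<le> measure \<nu> ((G - F) \<union> (- T))"
        using F bF setsN by (intro N.finite_measure_mono) auto
      also have "\<dots> \<le> measure \<nu> (G - F) + measure \<nu> (- T)"
        using bF setsN by (intro measure_Un_le) auto
      finally show ?thesis using T F(5) by linarith
    qed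
    ultimately show ?thesis using F(3) by (intro exI[of _ "F \<inter> T"]) auto
  qed
qed

section \<open>Pieces with a nearly constant tangent field\<close>

lemma inner_single_poly_mapping:
  "inner (Poly_Mapping.single k (1::real)) w = Poly_Mapping.lookup w k"
  by (simp add: inner_poly_mapping_def lookup_single)

text \<open>For injective \<open>ix\<close> an isometric copy of \<open>real ^ 'm\<close> in the
  sequence space; \<open>vec_coords ix\<close> is its adjoint and left inverse.\<close>

definition vec_embed :: "('m::finite \<Rightarrow> nat) \<Rightarrow> real ^ 'm \<Rightarrow> (nat \<Rightarrow>\<^sub>0 real)"
  where "vec_embed ix v = (\<Sum>i\<in>UNIV. (v $ i) *\<^sub>R Poly_Mapping.single (ix i) 1)"

definition vec_coords :: "('m::finite \<Rightarrow> nat) \<Rightarrow> (nat \<Rightarrow>\<^sub>0 real) \<Rightarrow> real ^ 'm"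
  where "vec_coords ix w = (\<chi> i. Poly_Mapping.lookup w (ix i))"

lemma inner_embed: "inner (vec_embed ix v) w = inner v (vec_coords ix w)"
  by (simp add: vec_embed_def vec_coords_def inner_sum_left inner_single_poly_mapping inner_vec_def)

lemma coords_embed:
  assumes "inj ix"
  shows "vec_coords ix (vec_embed ix v) = v"
proof (rule vec_eq_iff[THEN iffD2], rule allI)
  fix j
  have "Poly_Mapping.lookup (vec_embed ix v) (ix j) = (\<Sum>i\<in>UNIV. if i = j then v $ j else 0)"
    unfolding vec_embed_def lookup_sum using assms
    by (intro sum.cong) (auto simp: lookup_scaleR lookup_single when_def inj_eq)
  then show "vec_coords ix (vec_embed ix v) $ j = v $ j" by (simp add: vec_coords_def)
qed

lemma linear_embed: "linear (vec_embed ix)"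
  by (rule linearI) (simp_all add: vec_embed_def scaleR_add_left sum.distrib scaleR_sum_right)

lemma linear_coords: "linear (vec_coords ix)"
  by (rule linearI) (simp_all add: vec_coords_def vec_eq_iff lookup_add lookup_scaleR)

lemma inner_embed_embed: "inj ix \<Longrightarrow> inner (vec_embed ix v) (vec_embed ix w) = inner v w"
  by (simp add: inner_embed coords_embed)

lemma norm_embed: "inj ix \<Longrightarrow> norm (vec_embed ix v) = norm v"
  by (simp add: norm_eq_sqrt_inner inner_embed_embed)

lemma embed_in_euclidean:
  assumes "\<And>i. ix i < n"
  shows "vec_embed ix v \<in> euclidean n"
  unfolding euclidean_def
proof (intro CollectI allI impI)
  fix k assume "n \<le> k"
  then have "ix i \<noteq> k" for i using assms[of i] by auto
  then show "Poly_Mapping.lookup (vec_embed ix v) k = 0"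
    by (simp add: vec_embed_def lookup_sum lookup_scaleR lookup_single)
qed

text \<open>The distance from a unit vector to V is the sine of its angle with V, so its squared
  cosine with any v in V is at most 1 - r^2. Comparison with the nearest point on the line through v
  is enough.\<close>

lemma infdist_ge_imp_inner_le:
  fixes a v :: "'a::real_inner"
  assumes V: "subspace V" "v \<in> V" and a: "norm a = 1" and r: "0 \<le> r" "r \<le> infdist a V"
  shows "(inner a v)\<^sup>2 \<le> (1 - r\<^sup>2) * (norm v)\<^sup>2"
proof (cases "v = 0")
  case False
  define t where "t = inner a v / (norm v)\<^sup>2"
  have t: "t * (norm v)\<^sup>2 = inner a v" using False by (simp add: t_def)
  have "t *\<^sub>R v \<in> V" using V by (simp add: subspace_scale)
  then have "r \<le> dist a (t *\<^sub>R v)" using r(2) infdist_le order_trans by blast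
  then have "r\<^sup>2 \<le> (norm (a - t *\<^sub>R v))\<^sup>2" using r(1) by (simp add: dist_norm power_mono)
  also have "\<dots> = 1 - 2 * t * inner a v + t * (t * (norm v)\<^sup>2)"
    using a unfolding power2_norm_eq_inner
    by (simp add: inner_diff_left inner_diff_right inner_commute norm_eq_1 algebra_simps power2_eq_square)
  also have "\<dots> = 1 - t * inner a v" unfolding t by simp
  finally have "r\<^sup>2 * (norm v)\<^sup>2 \<le> (1 - t * inner a v) * (norm v)\<^sup>2" by (rule mult_right_mono) simp
  also have "\<dots> = (norm v)\<^sup>2 - inner a v * (t * (norm v)\<^sup>2)" by (simp add: algebra_simps)
  also have "\<dots> = (norm v)\<^sup>2 - (inner a v)\<^sup>2" unfolding t by (simp add: power2_eq_square)
  finally show ?thesis by (simp add: algebra_simps)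
qed simp

lemma norm_vector_derivative_le:
  assumes "C-lipschitz_on D g" "(g has_vector_derivative v) (at t within D)" "t \<in> D"
    and nt: "at t within D \<noteq> bot"
  shows "norm v \<le> C"
proof (rule field_le_epsilon)
  fix e :: real assume e: "0 < e"
  obtain d where d: "0 < d"
    and dd: "\<And>s. s \<in> D \<Longrightarrow> norm (s - t) < d \<Longrightarrow> norm (g s - g t - (s - t) *\<^sub>R v) \<le> e * norm (s - t)"
    using assms(2) e unfolding has_vector_derivative_def has_derivative_within_alt by blast
  have "t islimpt D" using nt by (simp add: trivial_limit_within)
  then obtain s where s: "s \<in> D" "s \<noteq> t" "dist s t < d" using d unfolding islimpt_approachable by blast
  have "norm ((s - t) *\<^sub>R v) \<le> norm (g s - g t) + norm (g s - g t - (s - t) *\<^sub>R v)"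
    using norm_triangle_ineq4[of "g s - g t" "g s - g t - (s - t) *\<^sub>R v"] by simp
  also have "\<dots> \<le> C * \<bar>s - t\<bar> + e * \<bar>s - t\<bar>"
    using lipschitz_onD[OF assms(1) s(1) assms(3)] dd[OF s(1)] s(3)
    by (intro add_mono) (auto simp: dist_norm)
  finally have "\<bar>s - t\<bar> * norm v \<le> \<bar>s - t\<bar> * (C + e)"
    unfolding norm_scaleR real_norm_def by (simp add: algebra_simps)
  then show "norm v \<le> C + e" using s(2) by simp
qed

text \<open>\<open>grassmannian_dist\<close> is the supremum of differences of such distances over
  the unit ball, so \<open>infdist a V\<close> is 1-Lipschitz in V and the set is open.\<close>

lemma grassmannian_infdist_measurable:
  assumes a: "norm a \<le> 1"
  shows "{V \<in> grassmannian n d. infdist a V < b} \<in> sets (grassmannian_borel n d)"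
proof -
  let ?U = "{V \<in> grassmannian n d. infdist a V < b}"
  have "openin (grassmannian.mtopology n d) ?U"
    unfolding grassmannian.openin_mtopology
  proof (intro conjI allI impI)
    fix V assume V: "V \<in> ?U"
    show "\<exists>r>0. grassmannian.mball n d V r \<subseteq> ?U"
    proof (intro exI[of _ "b - infdist a V"] conjI subsetI)
      show "0 < b - infdist a V" using V by simp
      fix W assume W: "W \<in> grassmannian.mball n d V (b - infdist a V)"
      then have "grassmannian_dist V W < b - infdist a V" "W \<in> grassmannian n d"
        by (auto simp: grassmannian.in_mball)
      moreover have "\<bar>infdist a V - infdist a W\<bar> \<le> grassmannian_dist V W"
        using a by (intro grassmannian_dist_upper) simp
      ultimately show "W \<in> ?U" by auto
    qed
  qed auto
  moreover have "{U. openin (grassmannian.mtopology n d) U} \<subseteq> Pow (grassmannian n d)"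
    using openin_subset[of "grassmannian.mtopology n d"] by (auto simp: grassmannian.topspace_mtopology)
  ultimately show ?thesis unfolding grassmannian_borel_def by (subst sets_measure_of) auto
qed

lemma orthonormal_split:
  fixes V :: "'b::euclidean_space set"
  assumes V: "subspace V"
  shows "\<exists>E B. finite E \<and> finite B \<and> card B = dim V \<and> card E \<le> DIM('b) \<and>
    pairwise orthogonal (E \<union> B) \<and> (\<forall>b\<in>E \<union> B. norm b = 1) \<and> span (E \<union> B) = UNIV \<and>
    (\<forall>e\<in>E. \<forall>v\<in>V. inner e v = 0)"
proof -
  obtain B where B: "B \<subseteq> V" "pairwise orthogonal B" "\<And>b. b \<in> B \<Longrightarrow> norm b = 1"
    "independent B" "card B = dim V" "span B = V"
    using orthonormal_basis_subspace[OF V] by metis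
  define W where "W = {w. \<forall>v\<in>V. orthogonal v w}"
  have W: "subspace W" unfolding W_def by (rule subspace_orthogonal_to_vectors)
  obtain E where E: "E \<subseteq> W" "pairwise orthogonal E" "\<And>b. b \<in> E \<Longrightarrow> norm b = 1"
    "independent E" "card E = dim W" "span E = W"
    using orthonormal_basis_subspace[OF W] by metis
  have EV: "inner e v = 0" if "e \<in> E" "v \<in> V" for e v
    using E(1) that by (auto simp: W_def orthogonal_def inner_commute)
  show ?thesis
  proof (rule exI[of _ E], rule exI[of _ B], intro conjI ballI)
    show "finite E" "finite B" using E(4) B(4) independent_imp_finite by auto
    show "card B = dim V" by fact
    show "card E \<le> DIM('b)" using E(5) dim_subset_UNIV[of W] by simp
    have "orthogonal x y" if "x \<in> E" "y \<in> B" for x y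
      using EV[of x y] that B(1) by (auto simp: orthogonal_def)
    then show "pairwise orthogonal (E \<union> B)"
      using E(2) B(2) unfolding pairwise_def by (metis Un_iff orthogonal_commute)
    show "norm b = 1" if "b \<in> E \<union> B" for b using that E(3) B(3) by blast
    show "span (E \<union> B) = UNIV"
    proof (intro equalityI subsetI UNIV_I)
      fix x
      obtain y z where yz: "y \<in> span V" "\<And>w. w \<in> span V \<Longrightarrow> orthogonal z w" "x = y + z"
        using orthogonal_subspace_decomp_exists[of V x] by metis
      have "z \<in> W" using yz(2) by (auto simp: W_def orthogonal_commute span_base)
      then have "z \<in> span E" "y \<in> span B" using E(6) B(6) yz(1) V by (auto simp: span_eq_iff[THEN iffD2])
      then show "x \<in> span (E \<union> B)"
        unfolding yz(3) by (meson span_add span_mono subsetD sup_ge1 sup_ge2)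
    qed
  qed (fact EV)
qed

text \<open>Points are sorted by the quantised distances from a finite net of directions to their
  tangent spaces. A direction normal at one point of a class is then nearly normal at all of them,
  and derivatives along fragments, which lie in the tangent spaces, have a small component along
  it.\<close>

lemma slow_partition:
  fixes S :: "'a::metric_space set" and f :: "'a \<Rightarrow> real ^ 'm"
  assumes S: "S \<in> sets borel" and adm: "admits_weak_tangent_field d S"
    and f: "1-lipschitz_on UNIV f" and eps: "0 < \<epsilon>"
  obtains \<P> where "finite \<P>" "disjoint \<P>" "\<Union>\<P> = S" "\<P> \<subseteq> sets borel"
    "\<And>Q. Q \<in> \<P> \<Longrightarrow> \<exists>E B. finite E \<and> finite B \<and> card B \<le> d \<and> card E \<le> CARD('m) \<and>
      pairwise orthogonal (E \<union> B) \<and> (\<forall>b\<in>E \<union> B. norm b = 1) \<and> span (E \<union> B) = UNIV \<and>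
      (\<forall>e\<in>E. slow_on Q (\<lambda>x. inner e (f x)) \<epsilon>)"
proof -
  \<comment> \<open>Admitting a field concerns only n \<ge> d, and the coordinates of f must fit as
    well.\<close>
  define n where "n = max d CARD('m)"
  obtain ix :: "'m \<Rightarrow> nat" where bij: "bij_betw ix UNIV {0..<CARD('m)}"
    using ex_bij_betw_finite_nat[of "UNIV :: 'm set"] by auto
  then have inj: "inj ix" by (simp add: bij_betw_def)
  have ix: "ix i < n" for i using bij_betwE[OF bij] by (simp add: n_def less_max_iff_disj)
  define J where "J = vec_embed ix"
  have J: "linear J" "\<And>v. norm (J v) = norm v" "\<And>v w. inner (J v) (J w) = inner v w"
    "\<And>v w. inner (J v) w = inner v (vec_coords ix w)"
    unfolding J_def by (rule linear_embed norm_embed[OF inj] inner_embed_embed[OF inj] inner_embed)+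
  define F where "F = J \<circ> f"
  have Fl: "1-lipschitz_on UNIV F"
  proof (rule lipschitz_onI)
    fix x y
    have "norm (J (f x) - J (f y)) = norm (f x - f y)" by (simp add: linear_diff[OF J(1), symmetric] J(2))
    then show "dist (F x) (F y) \<le> 1 * dist x y"
      using lipschitz_onD[OF f, of x y] by (simp add: F_def dist_norm)
  qed simp
  have "range F \<subseteq> euclidean n" by (auto simp: F_def J_def embed_in_euclidean ix)
  then obtain \<tau> where tau: "weak_tangent_field n d S F \<tau>"
    using adm Fl unfolding admits_weak_tangent_field_def n_def by (metis max.cobounded1)
  have tm: "\<tau> \<in> restrict_space borel S \<rightarrow>\<^sub>M grassmannian_borel n d"
    using tau by (simp add: weak_tangent_field_def)
  have spG: "space (grassmannian_borel n d) = grassmannian n d"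
    unfolding grassmannian_borel_def
    using openin_subset[of "grassmannian.mtopology n d"] 
    by (intro space_measure_of) (auto simp: grassmannian.topspace_mtopology)
  have tG: "\<tau> x \<in> grassmannian n d" if "x \<in> S" for x
    using measurable_space[OF tm, of x] that by (simp add: spG space_restrict_space)
  \<comment> \<open>Within a class \<open>J e\<close> keeps distance at least 1 - 3 * \<delta> from
    the tangent spaces, so the squared cosine is at most 6 * \<delta> \<le> \<epsilon>^2. The cap
    1/3 keeps 1 - 3 * \<delta> nonnegative.\<close>
  define \<delta> where "\<delta> = min (\<epsilon>\<^sup>2 / 6) (1/3)"
  have delta: "0 < \<delta>" "6 * \<delta> \<le> \<epsilon>\<^sup>2" "3 * \<delta> \<le> 1" using eps by (auto simp: \<delta>_def)
  obtain W where W: "W \<subseteq> cball (0::real ^ 'm) 1" "finite W" "cball 0 1 \<subseteq> (\<Union>w\<in>W. ball w \<delta>)"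
  proof (rule compactE_image[OF compact_cball, of "cball 0 1" "\<lambda>w. ball w \<delta>" "0 :: real ^ 'm" 1])
    show "cball (0::real ^ 'm) 1 \<subseteq> (\<Union>w\<in>cball 0 1. ball w \<delta>)" using delta(1) by force
  qed auto
  \<comment> \<open>Only the distances of \<open>\<tau> x\<close> to a finite net of directions matter, so no compactness of the
    Grassmannian is needed.\<close>
  define key where "key x = restrict (\<lambda>w. \<lfloor>infdist (J w) (\<tau> x) / \<delta>\<rfloor>) W" for x
  have keyS: "key ` S \<subseteq> PiE W (\<lambda>_. {0..\<lceil>1 / \<delta>\<rceil>})"
  proof (rule image_subsetI, rule PiE_I)
    fix x w assume x: "x \<in> S" and w: "w \<in> W"
    have "0 \<in> \<tau> x" using tG[OF x] by (simp add: grassmannian_def subspace_0)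
    then have "infdist (J w) (\<tau> x) \<le> dist (J w) 0" by (rule infdist_le)
    also have "\<dots> \<le> 1" using w W(1) by (auto simp: J(2))
    finally have "infdist (J w) (\<tau> x) / \<delta> \<le> 1 / \<delta>" using delta(1) by (simp add: divide_right_mono)
    moreover have "0 \<le> infdist (J w) (\<tau> x) / \<delta>" using delta(1) infdist_nonneg[of "J w" "\<tau> x"] by simp
    ultimately show "key x w \<in> {0..\<lceil>1 / \<delta>\<rceil>}"
      using w by (simp add: key_def) linarith
  qed (auto simp: key_def)
  have finK: "finite (key ` S)" using finite_subset[OF keyS] W(2) by (simp add: finite_PiE)
  define \<P> where "\<P> = (\<lambda>k. {x \<in> S. key x = k}) ` (key ` S)"
  have borel: "{x \<in> S. infdist (J w) (\<tau> x) < b} \<in> sets borel" if "w \<in> W" for w b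
  proof -
    have "norm (J w) \<le> 1" using that W(1) by (auto simp: J(2))
    then have "\<tau> -` {V \<in> grassmannian n d. infdist (J w) V < b} \<inter> space (restrict_space borel S) \<in> sets (restrict_space borel S)"
      using tm grassmannian_infdist_measurable measurable_sets by blast
    moreover have "\<tau> -` {V \<in> grassmannian n d. infdist (J w) V < b} \<inter> space (restrict_space borel S) = {x \<in> S. infdist (J w) (\<tau> x) < b}"
      using tG by (auto simp: space_restrict_space)
    ultimately show ?thesis using S by (simp add: sets_restrict_space_iff)
  qed
  show thesis
  proof (rule that[of \<P>])
    show "finite \<P>" unfolding \<P>_def using finK by simp
    show "disjoint \<P>" unfolding \<P>_def disjoint_def by auto
    show "\<Union>\<P> = S" unfolding \<P>_def by auto
    show "\<P> \<subseteq> sets borel"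
    proof
      fix Q assume "Q \<in> \<P>"
      then obtain y where y: "y \<in> S" "Q = {x \<in> S. key x = key y}" unfolding \<P>_def by auto
      let ?R = "\<lambda>w. {x \<in> S. infdist (J w) (\<tau> x) < \<delta> * (key y w + 1)} - {x \<in> S. infdist (J w) (\<tau> x) < \<delta> * key y w}"
      have "Q = S \<inter> (\<Inter>w\<in>W. {x \<in> S. \<lfloor>infdist (J w) (\<tau> x) / \<delta>\<rfloor> = key y w})" (is "_ = S \<inter> (\<Inter>w\<in>W. ?T w)")
        unfolding y(2) key_def by (auto simp: fun_eq_iff restrict_def)
      also have "\<dots> = S \<inter> (\<Inter>w\<in>W. ?R w)"
      proof -
        have "?T w = ?R w" for w
          using delta(1) by (auto simp: floor_eq_iff not_less field_simps)
        then show ?thesis by simp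
      qed
      also have "\<dots> \<in> sets borel"
      proof (cases "W = {}")
        case False
        then show ?thesis using S W(2) borel by (intro sets.Int sets.finite_INT) auto
      qed (use S in simp)
      finally show "Q \<in> sets borel" .
    qed
    fix Q assume "Q \<in> \<P>"
    then obtain y where y: "y \<in> S" "Q = {x \<in> S. key x = key y}" unfolding \<P>_def by auto
    \<comment> \<open>As \<open>vec_coords ix\<close> is the adjoint of J, a vector e is orthogonal
      to V exactly if \<open>J e\<close> is orthogonal to the tangent space at y. The dimension can
      only drop.\<close>
    define V where "V = vec_coords ix ` \<tau> y"
    obtain B0 where B0: "finite B0" "\<tau> y = span B0" "independent B0" "card B0 = d"
      by (rule grassmannian_finite_basis[OF tG[OF y(1)]])
    have V: "V = span (vec_coords ix ` B0)" unfolding V_def B0(2) by (simp add: linear_span_image[OF linear_coords])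
    then have sV: "subspace V" by simp
    have "dim V \<le> card (vec_coords ix ` B0)" unfolding V using B0(1) by (simp add: dim_le_card')
    also have "\<dots> \<le> d" using card_image_le[OF B0(1), of "vec_coords ix"] B0(4) by simp
    finally have dV: "dim V \<le> d" .
    from orthonormal_split[OF sV] obtain E B where EB0: "finite E" "finite B" "card B = dim V" "card E \<le> DIM(real ^ 'm)"
      "pairwise orthogonal (E \<union> B)" "\<forall>b\<in>E \<union> B. norm b = 1" "span (E \<union> B) = UNIV"
      "\<forall>e\<in>E. \<forall>v\<in>V. inner e v = 0"
      by (elim exE conjE) (rule that)
    note EB = EB0(1-5) EB0(6)[rule_format] EB0(7) EB0(8)[rule_format]
    \<comment> \<open>The loss is \<delta> for passing from e to the net point w, \<delta> for
      passing back, and \<delta> for the width of a quantisation class.\<close>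
    have far: "1 - 3 * \<delta> \<le> infdist (J e) (\<tau> x)" if e: "e \<in> E" and x: "x \<in> Q" for e x
    proof -
      have ne: "norm e = 1" using EB(6) e by blast
      have 1: "1 \<le> infdist (J e) (\<tau> y)"
      proof -
        have "1 \<le> dist (J e) w" if w: "w \<in> span B0" for w
        proof -
        have "inner (J e) w = 0" using w EB(8)[OF e, of "vec_coords ix w"] B0(2) by (simp add: J(4) V_def)
        then have "(norm (J e - w))\<^sup>2 = 1 + (norm w)\<^sup>2"
          using ne J(3)[of e e] by (simp add: power2_norm_eq_inner inner_diff_left inner_diff_right inner_commute norm_eq_1)
        then have "1\<^sup>2 \<le> (norm (J e - w))\<^sup>2" by simp
        then show ?thesis unfolding dist_norm by (rule power2_le_imp_le) simp
        qed
        moreover have "span B0 \<noteq> {}" using span_0 by blast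
        ultimately show ?thesis unfolding infdist_def B0(2) by (simp add: cINF_greatest)
      qed
      have "e \<in> cball 0 1" using ne by simp
      then have "e \<in> (\<Union>w\<in>W. ball w \<delta>)" using W(3) by blast
      then obtain w where w: "w \<in> W" "dist w e < \<delta>" by auto
      have dJ: "dist (J e) (J w) < \<delta>"
        using w(2) by (simp add: dist_norm linear_diff[OF J(1), symmetric] J(2) norm_minus_commute)
      have "key x w = key y w" using x y(2) by simp
      then have "\<lfloor>infdist (J w) (\<tau> x) / \<delta>\<rfloor> = \<lfloor>infdist (J w) (\<tau> y) / \<delta>\<rfloor>" using w(1) by (simp add: key_def)
      then have "infdist (J w) (\<tau> y) / \<delta> - 1 < infdist (J w) (\<tau> x) / \<delta>" by linarith
      from mult_strict_right_mono[OF this delta(1)]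
      have "infdist (J w) (\<tau> y) - \<delta> < infdist (J w) (\<tau> x)" using delta(1) by (simp add: left_diff_distrib)
      then show ?thesis
        using 1 dJ infdist_triangle[of "J e" "\<tau> y" "J w"] infdist_triangle[of "J w" "\<tau> x" "J e"]
        by (simp add: dist_commute)
    qed
    have slow: "slow_on Q (\<lambda>x. inner e (f x)) \<epsilon>" if e: "e \<in> E" for e
      unfolding slow_on_def
    proof (intro allI impI, elim conjE)
      fix D \<gamma> L assume D: "curve_fragment D \<gamma>" and L: "L-lipschitz_on D \<gamma>" and Q: "\<gamma> ` D \<subseteq> Q"
      define N where "N = {t \<in> D. \<gamma> t \<in> S \<and> \<not> (\<exists>v. ((F \<circ> \<gamma>) has_vector_derivative v) (at t within D) \<and> v \<in> \<tau> (\<gamma> t))}"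
      have N: "hausdorff_measure 1 N = 0"
        using tau D unfolding weak_tangent_field_def N_def by blast
      have L0: "0 \<le> L" using L by (rule lipschitz_on_nonneg)
      have "\<exists>v. ((\<lambda>x. inner e (f x)) \<circ> \<gamma> has_real_derivative v) (at t within D) \<and> \<bar>v\<bar> \<le> \<epsilon> * L"
        if t: "t \<in> D - N" for t
      proof (cases "at t within D = bot")
        \<comment> \<open>At an isolated point of D every number is a derivative. The vector given
          by the field need not be bounded by L there, so 0 is taken.\<close>
        case True
        have "((\<lambda>x. inner e (f x)) \<circ> \<gamma> has_real_derivative 0) (at t within D)"
          unfolding True has_field_derivative_def has_derivative_def by (simp add: bounded_linear_mult_right)
        then show ?thesis using eps L0 by (intro exI[of _ 0]) simp
      next
        case False
        have tD: "t \<in> D" using t by simp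
        have tQ: "\<gamma> t \<in> Q" using tD Q by blast
        have tS: "\<gamma> t \<in> S" using tQ y(2) by blast
        obtain v where v: "((F \<circ> \<gamma>) has_vector_derivative v) (at t within D)" "v \<in> \<tau> (\<gamma> t)"
          using t tS unfolding N_def by blast
        have "((\<lambda>s. inner (J e) ((F \<circ> \<gamma>) s)) has_vector_derivative inner (J e) v) (at t within D)"
          by (rule bounded_linear.has_vector_derivative[OF bounded_linear_inner_right v(1)])
        moreover have "(\<lambda>s. inner (J e) ((F \<circ> \<gamma>) s)) = (\<lambda>x. inner e (f x)) \<circ> \<gamma>"
          by (simp add: fun_eq_iff F_def J(3))
        ultimately have der: "((\<lambda>x. inner e (f x)) \<circ> \<gamma> has_real_derivative inner (J e) v) (at t within D)"
          by (simp add: has_real_derivative_iff_has_vector_derivative)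
        have "(1 * L)-lipschitz_on D (F \<circ> \<gamma>)"
          using L lipschitz_on_subset[OF Fl] by (intro lipschitz_on_compose) auto
        then have nv: "norm v \<le> L" using norm_vector_derivative_le[OF _ v(1) tD False] by simp
        have sub: "subspace (\<tau> (\<gamma> t))" using tG[OF tS] by (simp add: grassmannian_def)
        have nJ: "norm (J e) = 1" using EB(6)[of e] e J(2) by simp
        have "(inner (J e) v)\<^sup>2 \<le> (1 - (1 - 3 * \<delta>)\<^sup>2) * (norm v)\<^sup>2"
          using infdist_ge_imp_inner_le[OF sub v(2) nJ _ far[OF e tQ]] delta(3) by simp
        also have "\<dots> \<le> \<epsilon>\<^sup>2 * L\<^sup>2"
        proof (rule mult_mono)
          have "1 - (1 - 3 * \<delta>)\<^sup>2 = 6 * \<delta> - 9 * \<delta>\<^sup>2" by (simp add: power2_eq_square algebra_simps)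
          moreover have "0 \<le> 9 * \<delta>\<^sup>2" by simp
          ultimately show "1 - (1 - 3 * \<delta>)\<^sup>2 \<le> \<epsilon>\<^sup>2" using delta(2) by linarith
          show "(norm v)\<^sup>2 \<le> L\<^sup>2" using nv by (simp add: power_mono)
        qed auto
        finally have "(inner (J e) v)\<^sup>2 \<le> (\<epsilon> * L)\<^sup>2" by (simp add: power_mult_distrib)
        then have "\<bar>inner (J e) v\<bar> \<le> \<epsilon> * L" using eps L0 by (simp add: abs_le_square_iff[symmetric])
        then show ?thesis using der by blast
      qed
      then show "\<exists>N. hausdorff_measure 1 N = 0 \<and> (\<forall>t\<in>D - N. \<exists>v. ((\<lambda>x. inner e (f x)) \<circ> \<gamma> has_real_derivative v) (at t within D) \<and> \<bar>v\<bar> \<le> \<epsilon> * L)"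
        using N by blast
    qed
    have cE: "card E \<le> CARD('m)" using EB(4) by simp
    show "\<exists>E B. finite E \<and> finite B \<and> card B \<le> d \<and> card E \<le> CARD('m) \<and>
      pairwise orthogonal (E \<union> B) \<and> (\<forall>b\<in>E \<union> B. norm b = 1) \<and> span (E \<union> B) = UNIV \<and>
      (\<forall>e\<in>E. slow_on Q (\<lambda>x. inner e (f x)) \<epsilon>)"
      by (rule exI[of _ E], rule exI[of _ B]) (use EB(1-3,5-7) cE slow dV in auto)
  qed
qed

section \<open>Residuality\<close>

lemma compact_closed_separated:
  fixes A B :: "'a::metric_space set"
  assumes "compact A" "closed B" "A \<inter> B = {}"
  shows "\<exists>r>0. \<forall>x\<in>A. \<forall>y\<in>B. r \<le> dist x y"
proof (cases "A = {} \<or> B = {}")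
  case True
  then show ?thesis by (intro exI[of _ 1]) auto
next
  case False
  have "continuous_on A (\<lambda>x. infdist x B)" by (intro continuous_intros)
  then obtain a where a: "a \<in> A" "\<And>x. x \<in> A \<Longrightarrow> infdist a B \<le> infdist x B"
    using continuous_attains_inf[OF assms(1)] False by blast
  have "a \<notin> B" using a(1) assms(3) by blast
  then have "0 < infdist a B" using assms(2) False by (intro infdist_pos_not_in_closed) auto
  moreover have "infdist a B \<le> dist x y" if "x \<in> A" "y \<in> B" for x y
    using a(2)[OF that(1)] infdist_le[OF that(2), of x] by linarith
  ultimately show ?thesis by blast
qed

lemma disjoint_compact_family_separated:
  fixes K :: "'i \<Rightarrow> 'a::metric_space set"
  assumes I: "finite I" and K: "\<And>i. i \<in> I \<Longrightarrow> compact (K i)"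
    and disj: "\<And>i j. i \<in> I \<Longrightarrow> j \<in> I \<Longrightarrow> i \<noteq> j \<Longrightarrow> K i \<inter> K j = {}"
  obtains r where "0 < r" "\<And>i j x y. i \<in> I \<Longrightarrow> j \<in> I \<Longrightarrow> i \<noteq> j \<Longrightarrow> x \<in> K i \<Longrightarrow> y \<in> K j \<Longrightarrow> r \<le> dist x y"
proof -
  let ?P = "{p \<in> I \<times> I. fst p \<noteq> snd p}"
  have "\<forall>p\<in>?P. \<exists>r>0. \<forall>x\<in>K (fst p). \<forall>y\<in>K (snd p). r \<le> dist x y"
    using K disj by (auto intro!: compact_closed_separated compact_imp_closed)
  then obtain r where r: "\<forall>p\<in>?P. 0 < r p \<and> (\<forall>x\<in>K (fst p). \<forall>y\<in>K (snd p). r p \<le> dist x y)"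
    by (elim bchoice[THEN exE])
  have fin: "finite (insert 1 (r ` ?P))" using I by simp
  show thesis
  proof (rule that[of "Min (insert 1 (r ` ?P))"])
    show "0 < Min (insert 1 (r ` ?P))" using fin r by (subst Min_gr_iff) auto
    fix i j x y assume ij: "i \<in> I" "j \<in> I" "i \<noteq> j" and xy: "x \<in> K i" "y \<in> K j"
    then have p: "(i, j) \<in> ?P" by simp
    then have "r (i, j) \<in> insert 1 (r ` ?P)" by blast
    then have "Min (insert 1 (r ` ?P)) \<le> r (i, j)" by (rule Min_le[OF fin])
    also have "\<dots> \<le> dist x y" using bspec[OF r p] xy by simp
    finally show "Min (insert 1 (r ` ?P)) \<le> dist x y" .
  qed
qed

lemma ball_cover_Un:
  assumes "ball_cover s a A" "ball_cover s b B" "0 \<le> a" "0 \<le> b"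
  shows "ball_cover s (a + b) (A \<union> B)"
proof -
  obtain P where P: "\<forall>p\<in>set P. 0 < snd p \<and> 2 * snd p \<le> a" "A \<subseteq> (\<Union>p\<in>set P. ball (fst p) (snd p))"
    "(\<Sum>p\<leftarrow>P. (2 * snd p) powr s) \<le> a" using assms(1) unfolding ball_cover_def by blast
  obtain Q where Q: "\<forall>p\<in>set Q. 0 < snd p \<and> 2 * snd p \<le> b" "B \<subseteq> (\<Union>p\<in>set Q. ball (fst p) (snd p))"
    "(\<Sum>p\<leftarrow>Q. (2 * snd p) powr s) \<le> b" using assms(2) unfolding ball_cover_def by blast
  show ?thesis
    unfolding ball_cover_def
  proof (intro exI[of _ "P @ Q"] conjI ballI)
    fix p assume "p \<in> set (P @ Q)"
    then show "0 < snd p" "2 * snd p \<le> a + b" using P(1) Q(1) assms(3,4) by fastforce+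
  next
    show "A \<union> B \<subseteq> (\<Union>p\<in>set (P @ Q). ball (fst p) (snd p))" using P(2) Q(2) by auto
    show "(\<Sum>p\<leftarrow>P @ Q. (2 * snd p) powr s) \<le> a + b" using P(3) Q(3) by simp
  qed
qed

lemma ball_cover_UN:
  assumes "finite I" "\<forall>i\<in>I. \<forall>e>0. ball_cover s e (A i)" "0 < e"
  shows "ball_cover s e (\<Union>i\<in>I. A i)"
  using assms
proof (induction I arbitrary: e rule: finite_induct)
  case empty
  then show ?case unfolding ball_cover_def by (intro exI[of _ "[]"]) auto
next
  case (insert i I)
  have "ball_cover s (e / 2 + e / 2) (A i \<union> (\<Union>i\<in>I. A i))"
    using insert.prems by (intro ball_cover_Un insert.IH) auto
  then show ?case by simp
qed

text \<open>The exponent has to exceed d, since bounded parts of d-dimensional slices can have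
  positive d-dimensional content; the excess tends to 0 with n.\<close>

definition good_maps :: "nat \<Rightarrow> 'a::metric_space set \<Rightarrow> 'a measure \<Rightarrow> nat \<Rightarrow> ('a \<Rightarrow>\<^sub>C 'b::metric_space) set"
  where "good_maps d S \<mu> n = {f \<in> Lip1. \<exists>K. compact K \<and> K \<subseteq> S \<and> measure \<mu> (S - K) \<le> (1/2) ^ n \<and>
    ball_cover (real d + 1 / Suc n) ((1/2) ^ n) (apply_bcontfun f ` K)}"

text \<open>The compact image keeps a positive distance r from the closed complement of the balls,
  so the same K and the same balls serve every map of the space within r.\<close>

lemma openin_good_maps: "openin (top_of_set Lip1) (good_maps d S \<mu> n :: ('a::metric_space \<Rightarrow>\<^sub>C 'b::metric_space) set)"
  unfolding openin_euclidean_subtopology_iff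
proof (intro conjI ballI)
  show "(good_maps d S \<mu> n :: ('a \<Rightarrow>\<^sub>C 'b) set) \<subseteq> Lip1" by (auto simp: good_maps_def)
  fix f :: "'a \<Rightarrow>\<^sub>C 'b" assume "f \<in> good_maps d S \<mu> n"
  then obtain K P where K: "compact K" "K \<subseteq> S" "measure \<mu> (S - K) \<le> (1/2) ^ n"
    and P: "\<forall>p\<in>set P. 0 < snd p \<and> 2 * snd p \<le> (1/2) ^ n"
      "apply_bcontfun f ` K \<subseteq> (\<Union>p\<in>set P. ball (fst p) (snd p))"
      "(\<Sum>p\<leftarrow>P. (2 * snd p) powr (real d + 1 / Suc n)) \<le> (1/2) ^ n"
    unfolding good_maps_def ball_cover_def by blast
  let ?U = "\<Union>p\<in>set P. ball (fst p) (snd p)"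
  have "continuous_on K (apply_bcontfun f)" by (intro continuous_on_apply_bcontfun)
  then have "compact (apply_bcontfun f ` K)" using K(1) compact_continuous_image by blast
  moreover have "closed (- ?U)" by (intro closed_Compl open_UN) auto
  ultimately obtain r where r: "0 < r" "\<forall>x\<in>apply_bcontfun f ` K. \<forall>y\<in>- ?U. r \<le> dist x y"
    using compact_closed_separated[of "apply_bcontfun f ` K" "- ?U"] P(2) by blast
  show "\<exists>e>0. \<forall>g\<in>Lip1. dist g f < e \<longrightarrow> g \<in> good_maps d S \<mu> n"
  proof (intro exI[of _ r] conjI ballI impI r(1))
    fix g :: "'a \<Rightarrow>\<^sub>C 'b" assume g: "g \<in> Lip1" "dist g f < r"
    have "apply_bcontfun g ` K \<subseteq> ?U"
    proof (rule image_subsetI, rule ccontr)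
      fix x assume x: "x \<in> K" "apply_bcontfun g x \<notin> ?U"
      then have "r \<le> dist (apply_bcontfun f x) (apply_bcontfun g x)" using r(2) by blast
      also have "\<dots> \<le> dist f g" by (rule dist_bounded)
      finally show False using g(2) by (simp add: dist_commute)
    qed
    then show "g \<in> good_maps d S \<mu> n"
      using g(1) K P unfolding good_maps_def ball_cover_def by blast
  qed
qed

text \<open>A point of S outside N lies in K n for infinitely many n, so f maps it into the limsup
  of the covered images. Correspondingly N is the liminf of the sets S - K n, null because their
  measures tend to 0.\<close>

lemma dim_le_of_good_maps:
  fixes S :: "'a::metric_space set" and f :: "'a \<Rightarrow>\<^sub>C 'b::metric_space"
  assumes S: "S \<in> sets borel" and fin: "finite_measure \<mu>" and sets: "sets \<mu> = sets (restrict_space borel S)"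
    and f: "\<And>n. f \<in> good_maps d S \<mu> n"
  shows "\<exists>N\<subseteq>S. N \<in> null_sets \<mu> \<and> hausdorff_dim (apply_bcontfun f ` (S - N)) \<le> of_nat d"
proof -
  interpret finite_measure \<mu> by (rule fin)
  have sets': "A \<in> sets \<mu> \<longleftrightarrow> A \<in> sets borel \<and> A \<subseteq> S" for A
    unfolding sets using S by (auto simp: sets_restrict_space_iff)
  have "\<forall>n. \<exists>K. compact K \<and> K \<subseteq> S \<and> measure \<mu> (S - K) \<le> (1/2) ^ n \<and>
    ball_cover (real d + 1 / Suc n) ((1/2) ^ n) (apply_bcontfun f ` K)"
    using f unfolding good_maps_def by blast
  then obtain K where K: "\<forall>n. compact (K n) \<and> K n \<subseteq> S \<and> measure \<mu> (S - K n) \<le> (1/2) ^ n \<and>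
    ball_cover (real d + 1 / Suc n) ((1/2) ^ n) (apply_bcontfun f ` K n)"
    by (rule choice[THEN exE])
  have mK: "S - K n \<in> sets \<mu>" for n
  proof -
    have "K n \<in> sets borel" using K compact_imp_closed borel_closed by blast
    then show ?thesis using sets.Diff[OF S] by (auto simp: sets')
  qed
  define N where "N = (\<Union>m. \<Inter>n\<in>{m..}. S - K n)"
  have "(\<Inter>n\<in>{m..}. S - K n) \<in> null_sets \<mu>" for m
  proof -
    have meas: "(\<Inter>n\<in>{m..}. S - K n) \<in> sets \<mu>" using mK by (intro sets.countable_INT') auto
    have "measure \<mu> (\<Inter>n\<in>{m..}. S - K n) \<le> (1/2) ^ n" if "m \<le> n" for n
    proof -
      have "measure \<mu> (\<Inter>n\<in>{m..}. S - K n) \<le> measure \<mu> (S - K n)"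
        using that mK by (intro finite_measure_mono) auto
      then show ?thesis using K[rule_format, of n] by linarith
    qed
    then have "measure \<mu> (\<Inter>n\<in>{m..}. S - K n) \<le> 0"
      by (intro LIMSEQ_le_const[OF LIMSEQ_realpow_zero[of "1/2"]]) auto
    then have "measure \<mu> (\<Inter>n\<in>{m..}. S - K n) = 0" by (rule antisym[OF _ measure_nonneg])
    then have "emeasure \<mu> (\<Inter>n\<in>{m..}. S - K n) = 0" by (simp only: emeasure_eq_measure ennreal_0)
    then show ?thesis using meas by blast
  qed
  then have null: "N \<in> null_sets \<mu>" unfolding N_def by (intro null_sets_UN) auto
  have "hausdorff_dim (apply_bcontfun f ` (S - N)) \<le> ennreal (real d)"
  proof (rule hausdorff_dim_leI)
    fix t assume t: "real d < t"
    have "hausdorff_measure t (\<Inter>m. \<Union>n\<in>{m..}. apply_bcontfun f ` K n) = 0"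
      using K t by (intro hausdorff_null_of_ball_covers[of "real d"]) auto
    moreover have "apply_bcontfun f ` (S - N) \<subseteq> (\<Inter>m. \<Union>n\<in>{m..}. apply_bcontfun f ` K n)"
    proof (intro image_subsetI INT_I)
      fix x m assume "x \<in> S - N"
      then have "x \<in> S" "x \<notin> (\<Inter>n\<in>{m..}. S - K n)" unfolding N_def by blast+
      then show "apply_bcontfun f x \<in> (\<Union>n\<in>{m..}. apply_bcontfun f ` K n)" by blast
    qed
    ultimately show "hausdorff_measure t (apply_bcontfun f ` (S - N)) = 0"
      using hausdorff_measure_mono by (metis le_zero_eq)
  qed simp
  then have "hausdorff_dim (apply_bcontfun f ` (S - N)) \<le> of_nat d"
    by (simp add: ennreal_of_nat_eq_real_of_nat)
  moreover have "N \<subseteq> S" unfolding N_def by auto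
  ultimately show ?thesis using null by blast
qed

text \<open>The collapsed maps of finitely many compact pieces are glued by adding up their
  perturbations. Each lives in a small neighbourhood of its piece and the pieces are separated, so
  at any point at most one is active.\<close>

lemma good_maps_dense:
  fixes S :: "'a::complete_space set" and f :: "'a \<Rightarrow>\<^sub>C (real ^ 'm)"
  assumes S: "S \<in> sets borel" and sep: "separable_space (top_of_set S)"
    and adm: "admits_weak_tangent_field d S"
    and fin: "finite_measure \<mu>" and sets: "sets \<mu> = sets (restrict_space borel S)"
    and f: "f \<in> Lip1" and eta: "0 < \<eta>"
  shows "\<exists>g\<in>good_maps d S \<mu> n. dist g f < \<eta>"
proof -
  interpret finite_measure \<mu> by (rule fin)
  have sets': "A \<in> sets \<mu> \<longleftrightarrow> A \<in> sets borel \<and> A \<subseteq> S" for A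
    unfolding sets using S by (auto simp: sets_restrict_space_iff)
  define m where "m = real CARD('m)"
  have m: "1 \<le> m" by (simp add: m_def Suc_le_eq)
  define e0 where "e0 = (1/2::real) ^ n"
  have e0: "0 < e0" by (simp add: e0_def)
  define R where "R = norm f"
  have R: "0 \<le> R" "norm (apply_bcontfun f x) \<le> R" for x unfolding R_def by (simp_all add: norm_bounded)
  \<comment> \<open>Scaling by 1 - \<theta> moves f by at most \<theta> * R \<le> \<eta> / 4 and
    lowers its Lipschitz constant to 1 - \<theta>.\<close>
  define \<theta> where "\<theta> = min (1/2) (\<eta> / (4 * (R + 1)))"
  have th: "0 < \<theta>" "\<theta> \<le> 1/2" using R eta unfolding \<theta>_def by (simp, intro min.cobounded1)
  have thR: "\<theta> * R \<le> \<eta> / 4"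
  proof -
    have "\<theta> * R \<le> \<eta> / (4 * (R + 1)) * (R + 1)" using R eta th by (intro mult_mono) (auto simp: \<theta>_def)
    also have "\<dots> = \<eta> / 4" using R by (simp add: field_simps)
    finally show ?thesis .
  qed
  define f0 where "f0 x = (1 - \<theta>) *\<^sub>R apply_bcontfun f x" for x
  have f0_lip: "(1 - \<theta>)-lipschitz_on UNIV f0"
  proof (rule lipschitz_onI)
    fix x y
    have "dist (apply_bcontfun f x) (apply_bcontfun f y) \<le> 1 * dist x y"
      using f by (intro lipschitz_onD[where X = UNIV]) (auto simp: Lip1_def)
    then have "(1 - \<theta>) * dist (apply_bcontfun f x) (apply_bcontfun f y) \<le> (1 - \<theta>) * dist x y"
      using th by (intro mult_left_mono) auto
    then show "dist (f0 x) (f0 y) \<le> (1 - \<theta>) * dist x y"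
      unfolding f0_def dist_norm[of "_ *\<^sub>R _"] scaleR_diff_right[symmetric] norm_scaleR
      using th by (simp add: dist_norm)
  qed (use th in simp)
  have f0f: "dist (f0 x) (apply_bcontfun f x) \<le> \<eta> / 4" for x
  proof -
    have "f0 x - apply_bcontfun f x = - (\<theta> *\<^sub>R apply_bcontfun f x)" by (simp add: f0_def algebra_simps)
    then have "dist (f0 x) (apply_bcontfun f x) = \<theta> * norm (apply_bcontfun f x)" using th by (simp add: dist_norm)
    also have "\<dots> \<le> \<theta> * R" using R th by (intro mult_left_mono) auto
    finally show ?thesis using thR by linarith
  qed
  \<comment> \<open>At most m normal directions then raise the Lipschitz constant by m * \<kappa> =
    \<theta> / 2 altogether.\<close>
  define \<kappa> where "\<kappa> = \<theta> / (2 * m)"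
  have kappa: "0 < \<kappa>" using th m by (simp add: \<kappa>_def)
  \<comment> \<open>N is so large that collapsing loses at most measure e0 / 3; another e0 / 3 is
    reserved for the compact approximation of the pieces.\<close>
  obtain N :: nat where N: "3 * m * measure \<mu> S / e0 < N" using reals_Archimedean2 by blast
  have N0: "0 < N"
  proof (rule ccontr)
    assume "\<not> 0 < N"
    then show False using N m e0 measure_nonneg[of \<mu> S] by (simp add: divide_less_0_iff mult_less_0_iff)
  qed
  have Nm: "m * (measure \<mu> S / N) \<le> e0 / 3" using N N0 e0 by (simp add: field_simps)
  define \<epsilon> where "\<epsilon> = \<kappa> / N"
  have eps: "0 < \<epsilon>" "real N * \<epsilon> \<le> \<kappa>" using kappa N0 by (auto simp: \<epsilon>_def)
  have f0_lip1: "1-lipschitz_on UNIV f0" using f0_lip th by (intro lipschitz_on_le[OF f0_lip]) simp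
  obtain \<P> where PP: "finite \<P>" "disjoint \<P>" "\<Union>\<P> = S" "\<P> \<subseteq> sets borel"
    and slow: "\<And>Q. Q \<in> \<P> \<Longrightarrow> \<exists>E B. finite E \<and> finite B \<and> card B \<le> d \<and> card E \<le> CARD('m) \<and>
      pairwise orthogonal (E \<union> B) \<and> (\<forall>b\<in>E \<union> B. norm b = 1) \<and> span (E \<union> B) = UNIV \<and>
      (\<forall>e\<in>E. slow_on Q (\<lambda>x. inner e (f0 x)) \<epsilon>)"
    by (rule slow_partition[OF S adm f0_lip1 eps(1)]) blast
  define e1 where "e1 = e0 / (3 * (real (card \<P>) + 1))"
  have e1: "0 < e1" using e0 by (simp add: e1_def)
  have PS: "Q \<in> sets \<mu>" if "Q \<in> \<P>" for Q using that PP(3,4) by (auto simp: sets')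
  have "\<forall>Q\<in>\<P>. \<exists>K. compact K \<and> K \<subseteq> Q \<and> measure \<mu> (Q - K) < e1"
    using compact_approx[OF S sep fin sets PS e1] by blast
  then obtain K where K: "\<forall>Q\<in>\<P>. compact (K Q) \<and> K Q \<subseteq> Q \<and> measure \<mu> (Q - K Q) < e1"
    by (elim bchoice[THEN exE])
  have disj: "K Q \<inter> K Q' = {}" if "Q \<in> \<P>" "Q' \<in> \<P>" "Q \<noteq> Q'" for Q Q'
  proof -
    have "Q \<inter> Q' = {}" using disjointD[OF PP(2) that] .
    then show ?thesis using K that by blast
  qed
  obtain r where r: "0 < r" "\<And>Q Q' x y. Q \<in> \<P> \<Longrightarrow> Q' \<in> \<P> \<Longrightarrow> Q \<noteq> Q' \<Longrightarrow> x \<in> K Q \<Longrightarrow> y \<in> K Q' \<Longrightarrow> r \<le> dist x y"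
    using disjoint_compact_family_separated[of \<P> K] PP(1) K disj by metis
  \<comment> \<open>With a third of the separation, the \<sigma>-neighbourhoods of different pieces
    are still more than \<sigma> apart.\<close>
  define \<sigma> where "\<sigma> = r / 3"
  have sig: "0 < \<sigma>" using r by (simp add: \<sigma>_def)
  \<comment> \<open>\<eta> / 4 limits the displacement, and 2 * \<omega> \<le> \<theta> / 2 *
    \<sigma> allows points at least \<sigma> apart to be displaced independently.\<close>
  define \<omega> where "\<omega> = min (\<eta> / 4) (\<theta> * \<sigma> / 4)"
  have om: "0 < \<omega>" "\<omega> \<le> \<eta> / 4" "\<omega> \<le> \<theta> * \<sigma> / 4" using eta th sig by (auto simp: \<omega>_def)
  define \<eta>' where "\<eta>' = \<omega> / m"
  have eta': "0 < \<eta>'" using om m by (simp add: \<eta>'_def)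
  have "\<forall>Q\<in>\<P>. \<exists>p. snd p \<subseteq> K Q \<and> compact (snd p) \<and> measure \<mu> (K Q - snd p) \<le> m * (measure \<mu> (K Q) / N) \<and>
    (1 - \<theta> / 2)-lipschitz_on UNIV (fst p) \<and> (\<forall>x. norm (fst p x - f0 x) \<le> \<omega>) \<and>
    (\<forall>x. (\<forall>y\<in>K Q. \<sigma> \<le> dist x y) \<longrightarrow> fst p x = f0 x) \<and>
    (\<forall>e>0. ball_cover (real d + 1 / Suc n) e (fst p ` snd p))"
  proof
    fix Q assume Q: "Q \<in> \<P>"
    note KQ = bspec[OF K Q]
    from slow[OF Q] obtain E B where EB: "finite E" "finite B" "card B \<le> d" "card E \<le> CARD('m)"
      "pairwise orthogonal (E \<union> B)" "\<forall>b\<in>E \<union> B. norm b = 1" "span (E \<union> B) = UNIV"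
      "\<forall>e\<in>E. slow_on Q (\<lambda>x. inner e (f0 x)) \<epsilon>" by (elim exE conjE) (rule that)
    have orthE: "pairwise orthogonal E" using EB(5) by (rule pairwise_subset) simp
    have unitE: "\<forall>e\<in>E. norm e = 1" using EB(6) by simp
    have slowK: "\<forall>e\<in>E. slow_on (K Q) (\<lambda>x. inner e (f0 x)) \<epsilon>"
      using EB(8) KQ slow_on_subset by blast
    have setsK: "\<forall>A\<in>sets borel. A \<subseteq> K Q \<longrightarrow> A \<in> sets \<mu>" using KQ PS[OF Q] by (auto simp: sets')
    have cKQ: "compact (K Q)" using KQ by simp
    have cE: "real (card E) \<le> m" using EB(4) by (simp add: m_def)
    from collapse_directions[OF EB(1) orthE unitE cKQ f0_lip kappa N0 eps slowK eta' sig fin setsK]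
    obtain g K' where g: "K' \<subseteq> K Q" "compact K'" "measure \<mu> (K Q - K') \<le> real (card E) * (measure \<mu> (K Q) / N)"
      "\<forall>e\<in>E. finite ((\<lambda>x. inner e (g x)) ` K')" "(1 - \<theta> + real (card E) * \<kappa>)-lipschitz_on UNIV g"
      "\<forall>x. norm (g x - f0 x) \<le> real (card E) * \<eta>'" "\<forall>x. (\<forall>y\<in>K Q. \<sigma> \<le> dist x y) \<longrightarrow> g x = f0 x"
      by (elim exE conjE) (rule that)
    show "\<exists>p. snd p \<subseteq> K Q \<and> compact (snd p) \<and> measure \<mu> (K Q - snd p) \<le> m * (measure \<mu> (K Q) / N) \<and>
      (1 - \<theta> / 2)-lipschitz_on UNIV (fst p) \<and> (\<forall>x. norm (fst p x - f0 x) \<le> \<omega>) \<and>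
      (\<forall>x. (\<forall>y\<in>K Q. \<sigma> \<le> dist x y) \<longrightarrow> fst p x = f0 x) \<and>
      (\<forall>e>0. ball_cover (real d + 1 / Suc n) e (fst p ` snd p))"
    proof (rule exI[of _ "(g, K')"], unfold fst_conv snd_conv, intro conjI allI impI)
      show "K' \<subseteq> K Q" "compact K'" by fact+
      have "real (card E) * (measure \<mu> (K Q) / N) \<le> m * (measure \<mu> (K Q) / N)"
        using cE by (intro mult_right_mono) auto
      then show "measure \<mu> (K Q - K') \<le> m * (measure \<mu> (K Q) / N)" using g(3) by linarith
      have "real (card E) * \<kappa> \<le> m * \<kappa>" using cE kappa by (intro mult_right_mono) auto
      also have "m * \<kappa> = \<theta> / 2" using m by (simp add: \<kappa>_def)
      finally show "(1 - \<theta> / 2)-lipschitz_on UNIV g" by (intro lipschitz_on_le[OF g(5)]) simp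
      have "real (card E) * \<eta>' \<le> m * \<eta>'" using cE eta' by (intro mult_right_mono) auto
      also have "m * \<eta>' = \<omega>" using m by (simp add: \<eta>'_def)
      finally show "norm (g x - f0 x) \<le> \<omega>" for x using g(6)[rule_format, of x] by linarith
      show "g x = f0 x" if "\<forall>y\<in>K Q. \<sigma> \<le> dist x y" for x using g(7) that by blast
      fix e :: real assume e: "0 < e"
      have "continuous_on K' g"
        using lipschitz_on_continuous_on[OF g(5)] continuous_on_subset by blast
      then have bdd: "bounded (g ` K')" using g(2) compact_continuous_image compact_imp_bounded by blast
      show "ball_cover (real d + 1 / Suc n) e (g ` K')"
      proof (rule slices_ball_cover[OF EB(1-3,5) _ EB(7) bdd _ _ e])
        show "norm b = 1" if "b \<in> E \<union> B" for b using EB(6) that by blast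
        show "finite (inner a ` g ` K')" if "a \<in> E" for a
          using bspec[OF g(4) that] by (simp add: image_image)
      qed simp
    qed
  qed
  then obtain p where p: "\<forall>Q\<in>\<P>. snd (p Q) \<subseteq> K Q \<and> compact (snd (p Q)) \<and>
    measure \<mu> (K Q - snd (p Q)) \<le> m * (measure \<mu> (K Q) / N) \<and>
    (1 - \<theta> / 2)-lipschitz_on UNIV (fst (p Q)) \<and> (\<forall>x. norm (fst (p Q) x - f0 x) \<le> \<omega>) \<and>
    (\<forall>x. (\<forall>y\<in>K Q. \<sigma> \<le> dist x y) \<longrightarrow> fst (p Q) x = f0 x) \<and>
    (\<forall>e>0. ball_cover (real d + 1 / Suc n) e (fst (p Q) ` snd (p Q)))"
    by (elim bchoice[THEN exE])
  define G where "G Q = fst (p Q)" for Q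
  define K' where "K' Q = snd (p Q)" for Q
  have K': "K' Q \<subseteq> K Q" "compact (K' Q)" "measure \<mu> (K Q - K' Q) \<le> m * (measure \<mu> (K Q) / N)"
    and G_lip: "(1 - \<theta> / 2)-lipschitz_on UNIV (G Q)"
    and G_cover: "\<forall>e>0. ball_cover (real d + 1 / Suc n) e (G Q ` K' Q)" if "Q \<in> \<P>" for Q
    using bspec[OF p that] unfolding G_def K'_def by blast+
  have G_close: "norm (G Q x - f0 x) \<le> \<omega>" if "Q \<in> \<P>" for Q x
    using bspec[OF p that] unfolding G_def by blast
  have G_far: "G Q x = f0 x" if "Q \<in> \<P>" "\<not> (\<exists>y\<in>K Q. dist x y < \<sigma>)" for Q x
    using bspec[OF p that(1)] that(2) unfolding G_def by (simp add: not_less)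
  have apart: "\<sigma> < dist x x'" if Qs: "Q \<in> \<P>" "Q' \<in> \<P>" "Q \<noteq> Q'" "\<exists>y\<in>K Q. dist x y < \<sigma>" "\<exists>y\<in>K Q'. dist x' y < \<sigma>" for Q Q' x x'
  proof -
    obtain y y' where y: "y \<in> K Q" "dist x y < \<sigma>" "y' \<in> K Q'" "dist x' y' < \<sigma>" using Qs(4,5) by blast
    have "3 * \<sigma> \<le> dist y y'" using r(2)[OF Qs(1-3) y(1,3)] by (simp add: \<sigma>_def)
    then show ?thesis
      using y dist_triangle[of y y' x] dist_triangle[of x y' x'] by (simp add: dist_commute)
  qed
  define g where "g x = f0 x + (\<Sum>Q\<in>\<P>. G Q x - f0 x)" for x
  have g_eq: "g x = G Q x" if "Q \<in> \<P>" "\<And>Q'. Q' \<in> \<P> \<Longrightarrow> Q' \<noteq> Q \<Longrightarrow> \<not> (\<exists>y\<in>K Q'. dist x y < \<sigma>)" for x Q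
  proof -
    have "(\<Sum>Q'\<in>\<P>. G Q' x - f0 x) = (\<Sum>Q'\<in>\<P>. if Q' = Q then G Q x - f0 x else 0)"
      using that G_far by (intro sum.cong) auto
    then show ?thesis using that(1) PP(1) by (simp add: g_def)
  qed
  have g_near: "g x = G Q x" if "Q \<in> \<P>" "\<exists>y\<in>K Q. dist x y < \<sigma>" for x Q
  proof (rule g_eq[OF that(1)])
    fix Q' assume Q': "Q' \<in> \<P>" "Q' \<noteq> Q"
    show "\<not> (\<exists>y\<in>K Q'. dist x y < \<sigma>)"
      using apart[OF that(1) Q'(1) Q'(2)[symmetric] that(2), of x] sig by auto
  qed
  have g_far: "g x = f0 x" if "\<forall>Q\<in>\<P>. \<not> (\<exists>y\<in>K Q. dist x y < \<sigma>)" for x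
    using that G_far by (simp add: g_def)
  have g_close: "norm (g x - f0 x) \<le> \<omega>" for x
    using g_far[of x] g_near[of _ x] G_close[of _ x] om(1) by (metis diff_self less_imp_le norm_zero)
  \<comment> \<open>Off its own neighbourhood each G Q equals f0, so two points less than \<sigma>
    apart are governed by a single G Q or by f0, whose Lipschitz bound then applies.\<close>
  have g_cases: "(\<exists>Q\<in>\<P>. g x = G Q x \<and> g y = G Q y) \<or> (g x = f0 x \<and> g y = f0 y) \<or> \<sigma> \<le> dist x y" for x y
  proof (cases "\<forall>Q\<in>\<P>. \<not> (\<exists>z\<in>K Q. dist x z < \<sigma>)")
    case far_x: True
    show ?thesis
    proof (cases "\<forall>Q\<in>\<P>. \<not> (\<exists>z\<in>K Q. dist y z < \<sigma>)")
      case True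
      then show ?thesis using g_far far_x by blast
    next
      case False
      then obtain Q where Q: "Q \<in> \<P>" "\<exists>z\<in>K Q. dist y z < \<sigma>" by blast
      then have "g y = G Q y" "g x = G Q x" using g_near g_eq far_x by blast+
      then show ?thesis using Q(1) by blast
    qed
  next
    case False
    then obtain Q where Q: "Q \<in> \<P>" "\<exists>z\<in>K Q. dist x z < \<sigma>" by blast
    show ?thesis
    proof (cases "\<exists>Q'\<in>\<P>. Q' \<noteq> Q \<and> (\<exists>z\<in>K Q'. dist y z < \<sigma>)")
      case True
      then obtain Q' where Q': "Q' \<in> \<P>" "Q' \<noteq> Q" "\<exists>z\<in>K Q'. dist y z < \<sigma>" by blast
      show ?thesis using apart[OF Q(1) Q'(1) Q'(2)[symmetric] Q(2) Q'(3)] by simp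
    next
      case False
      then have "g y = G Q y" using g_eq[OF Q(1)] by blast
      then show ?thesis using g_near[OF Q] Q(1) by blast
    qed
  qed
  have g_lip: "(1 - \<theta> / 2)-lipschitz_on UNIV g"
  proof (rule lipschitz_onI)
    fix x y
    have f0xy: "dist (f0 x) (f0 y) \<le> (1 - \<theta>) * dist x y" using f0_lip by (rule lipschitz_onD) auto
    have split: "(1 - \<theta>) * dist x y + \<theta> / 2 * dist x y = (1 - \<theta> / 2) * dist x y" by (simp add: algebra_simps)
    have nonneg: "0 \<le> \<theta> / 2 * dist x y" using th by simp
    have G_dist: "dist (G Q x) (G Q y) \<le> (1 - \<theta> / 2) * dist x y" if "Q \<in> \<P>" for Q
      using G_lip[OF that] by (rule lipschitz_onD) auto
    have far: "dist (g x) (g y) \<le> (1 - \<theta>) * dist x y + \<theta> / 2 * dist x y" if "\<sigma> \<le> dist x y"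
    proof -
      have "dist (g x) (g y) \<le> dist (f0 x) (f0 y) + 2 * \<omega>"
        using g_close[of x] g_close[of y] dist_triangle[of "g x" "g y" "f0 x"] dist_triangle[of "f0 x" "g y" "f0 y"]
        by (simp add: dist_norm norm_minus_commute)
      moreover have "\<theta> / 2 * \<sigma> \<le> \<theta> / 2 * dist x y" using that th by (intro mult_left_mono) auto
      ultimately show ?thesis using f0xy om(3) by linarith
    qed
    from g_cases[of x y] show "dist (g x) (g y) \<le> (1 - \<theta> / 2) * dist x y"
    proof (elim disjE bexE conjE)
      fix Q assume "Q \<in> \<P>" "g x = G Q x" "g y = G Q y"
      then show ?thesis using G_dist[of Q] by simp
    next
      assume "g x = f0 x" "g y = f0 y"
      then show ?thesis using f0xy split nonneg by simp
    next
      assume "\<sigma> \<le> dist x y"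
      from far[OF this] show ?thesis unfolding split .
    qed
  qed (use th in simp)
  have gf: "dist (g x) (apply_bcontfun f x) \<le> \<eta> / 2" for x
    using g_close[of x] om(2) f0f[of x] dist_triangle[of "g x" "apply_bcontfun f x" "f0 x"]
    by (simp add: dist_norm)
  have "g \<in> bcontfun"
  proof (rule bcontfun_normI)
    show "continuous_on UNIV g" using g_lip by (rule lipschitz_on_continuous_on)
    show "norm (g x) \<le> \<eta> / 2 + R" for x
      using gf[of x] R(2)[of x] norm_triangle_sub[of "g x" "apply_bcontfun f x"] by (simp add: dist_norm)
  qed
  then have ap: "apply_bcontfun (Bcontfun g) = g" by (rule Bcontfun_inverse)
  have "1-lipschitz_on UNIV g" using th by (intro lipschitz_on_le[OF g_lip]) simp
  then have gL: "Bcontfun g \<in> Lip1" by (simp add: Lip1_def ap)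
  have "dist (Bcontfun g) f \<le> \<eta> / 2" by (rule dist_bound) (simp only: ap gf)
  then have dist: "dist (Bcontfun g) f < \<eta>" using eta by linarith
  let ?K = "\<Union>Q\<in>\<P>. K' Q"
  have KS: "K Q \<in> sets \<mu>" "K' Q \<in> sets \<mu>" "K Q \<subseteq> Q" if "Q \<in> \<P>" for Q
    using bspec[OF K that] K'[OF that] that PP(3) compact_imp_closed by (auto simp: sets' borel_closed)
  have gK: "g ` ?K = (\<Union>Q\<in>\<P>. G Q ` K' Q)"
  proof -
    have "g x = G Q x" if "Q \<in> \<P>" "x \<in> K' Q" for Q x
      using g_near[OF that(1), of x] K'(1)[OF that(1)] that(2) sig by (metis dist_self subsetD)
    then show ?thesis by (auto simp: image_UN intro!: SUP_cong)
  qed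
  have "Bcontfun g \<in> good_maps d S \<mu> n"
    unfolding good_maps_def
  proof (intro CollectI conjI gL exI[of _ ?K])
    show "compact ?K" using PP(1) K'(2) by (intro compact_UN) auto
    show "?K \<subseteq> S" using K'(1) KS(3) PP(3) by blast
    have "measure \<mu> (S - ?K) \<le> measure \<mu> (\<Union>Q\<in>\<P>. Q - K' Q)"
      using PP KS PS by (intro finite_measure_mono) auto
    also have "\<dots> \<le> (\<Sum>Q\<in>\<P>. measure \<mu> (Q - K' Q))"
      using PP(1) KS PS by (intro finite_measure_subadditive_finite) auto
    also have "\<dots> \<le> (\<Sum>Q\<in>\<P>. e1 + m * (measure \<mu> (K Q) / N))"
    proof (rule sum_mono)
      fix Q assume Q: "Q \<in> \<P>"
      have "measure \<mu> (Q - K' Q) = measure \<mu> ((Q - K Q) \<union> (K Q - K' Q))"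
        using K'(1)[OF Q] KS(3)[OF Q] by (intro arg_cong[of _ _ "measure \<mu>"]) auto
      also have "\<dots> \<le> measure \<mu> (Q - K Q) + measure \<mu> (K Q - K' Q)"
        using KS[OF Q] PS[OF Q] by (intro measure_Un_le) auto
      finally show "measure \<mu> (Q - K' Q) \<le> e1 + m * (measure \<mu> (K Q) / N)"
        using bspec[OF K Q] K'(3)[OF Q] by linarith
    qed
    also have "\<dots> = real (card \<P>) * e1 + m * ((\<Sum>Q\<in>\<P>. measure \<mu> (K Q)) / N)"
      by (simp add: sum.distrib sum_distrib_left sum_divide_distrib)
    also have "(\<Sum>Q\<in>\<P>. measure \<mu> (K Q)) = measure \<mu> (\<Union>Q\<in>\<P>. K Q)"
      using PP(1) KS disj by (intro finite_measure_finite_Union[symmetric]) (auto simp: disjoint_family_on_def)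
    also have "real (card \<P>) * e1 + m * (measure \<mu> (\<Union>Q\<in>\<P>. K Q) / N) \<le> e0 / 3 + m * (measure \<mu> S / N)"
    proof (rule add_mono)
      show "real (card \<P>) * e1 \<le> e0 / 3" using e0 by (simp add: e1_def field_simps)
      have "measure \<mu> (\<Union>Q\<in>\<P>. K Q) \<le> measure \<mu> S"
        using KS PP(3) S by (intro finite_measure_mono) (auto simp: sets')
      then show "m * (measure \<mu> (\<Union>Q\<in>\<P>. K Q) / N) \<le> m * (measure \<mu> S / N)"
        using m by (intro mult_left_mono divide_right_mono) auto
    qed
    finally show "measure \<mu> (S - ?K) \<le> (1/2) ^ n" using Nm e0 unfolding e0_def[symmetric] by linarith
    show "ball_cover (real d + 1 / real (Suc n)) ((1/2) ^ n) (apply_bcontfun (Bcontfun g) ` ?K)"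
      unfolding ap gK using PP(1) G_cover by (intro ball_cover_UN) auto
  qed
  then show ?thesis using dist by blast
qed

theorem theorem1p4:
  fixes d :: nat and S :: "'a::complete_space set" and \<mu> :: "'a measure"
  assumes "S \<in> sets borel"
    and "separable_space (top_of_set S)"
    and "admits_weak_tangent_field d S"
    and "finite_measure \<mu>"
    and "sets \<mu> = sets (restrict_space borel S)"
  shows "residual_in (top_of_set (Lip1 :: ('a \<Rightarrow>\<^sub>C (real ^ 'm)) set))
    {f \<in> Lip1. \<exists>N\<subseteq>S. N \<in> null_sets \<mu> \<and> hausdorff_dim (apply_bcontfun f ` (S - N)) \<le> of_nat d}"
  unfolding residual_in_def
proof (intro conjI exI[of _ "range (good_maps d S \<mu>)"] ballI)
  let ?T = "top_of_set (Lip1 :: ('a \<Rightarrow>\<^sub>C (real ^ 'm)) set)"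
  fix U :: "('a \<Rightarrow>\<^sub>C (real ^ 'm)) set" assume "U \<in> range (good_maps d S \<mu>)"
  then obtain n where U: "U = good_maps d S \<mu> n" by blast
  show "openin ?T U" unfolding U by (rule openin_good_maps)
  show "?T closure_of U = topspace ?T"
  proof
    show "topspace ?T \<subseteq> ?T closure_of U"
    proof (rule subsetI, unfold in_closure_of, intro conjI allI impI, assumption, elim conjE)
      fix f V assume "f \<in> V" and V: "openin ?T V"
      then obtain e where e: "0 < e" "\<forall>g\<in>Lip1. dist g f < e \<longrightarrow> g \<in> V" and f: "f \<in> Lip1"
        unfolding openin_euclidean_subtopology_iff by blast
      obtain g where g: "g \<in> good_maps d S \<mu> n" "dist g f < e"
        using good_maps_dense[OF assms f e(1)] by blast
      then have "g \<in> Lip1" by (simp add: good_maps_def)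
      then show "\<exists>y. y \<in> U \<and> y \<in> V" using g e(2) U by blast
    qed
  qed (rule closure_of_subset_topspace)
next
  show "topspace (top_of_set Lip1) \<inter> \<Inter> (range (good_maps d S \<mu>))
    \<subseteq> {f \<in> Lip1. \<exists>N\<subseteq>S. N \<in> null_sets \<mu> \<and> hausdorff_dim (apply_bcontfun f ` (S - N)) \<le> of_nat d}"
  proof
    fix f assume f: "f \<in> topspace (top_of_set Lip1) \<inter> \<Inter> (range (good_maps d S \<mu>))"
    then have "f \<in> good_maps d S \<mu> n" for n by blast
    from dim_le_of_good_maps[OF assms(1,4,5) this] f
    show "f \<in> {f \<in> Lip1. \<exists>N\<subseteq>S. N \<in> null_sets \<mu> \<and> hausdorff_dim (apply_bcontfun f ` (S - N)) \<le> of_nat d}"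
      by simp
  qed
qed auto

end
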